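(* Let $\Omega\subset\mathbb{R}^3$ be a bounded domain with connected Lipschitz continuous boundary $\Gamma=\partial\Omega$. Then on $\overset{\circ}{\mathsf{H}}(\mathrm{Curl};\Omega)$ the norm $$\|P\|_{\mathsf{H}(\mathrm{Curl};\Omega)}=\big(\|P\|_{\mathsf{L}^2(\Omega)}^2+\|\mathrm{Curl}\,P\|_{\mathsf{L}^2(\Omega)}^2\big)^{1/2}$$ and $$|||P|||:=\big(\|\mathrm{sym}\,P\|_{\mathsf{L}^2(\Omega)}^2+\|\mathrm{Curl}\,P\|_{\mathsf{L}^2(\Omega)}^2\big)^{1/2}$$ are equivalent norms. In particular, $|||\cdot|||$ is a norm on $\overset{\circ}{\mathsf{H}}(\mathrm{Curl};\Omega)$, and there exists a constant $c>0$ such that for all $P\in\overset{\circ}{\mathsf{H}}(\mathrm{Curl};\Omega)$ $$c\,\|P\|_{\mathsf{H}(\mathrm{Curl};\Omega)}\le\|\mathrm{sym}\,P\|_{\mathsf{L}^2(\Omega)}+\|\mathrm{Curl}\,P\|_{\mathsf{L}^2(\Omega)}.$$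
   Context: $\mathsf{L}^2(\Omega)$ denotes square integrable functions, vector fields or tensor fields on $\Omega$ with values in $\mathbb{R}$, $\mathbb{R}^3$ or $\mathbb{R}^{3\times3}$, respectively. For vector fields, $\mathsf{H}(\mathrm{curl};\Omega)=\{v\in\mathsf{L}^2(\Omega):\mathrm{curl}\,v\in\mathsf{L}^2(\Omega)\}$ (weak curl), with norm $(\|v\|_{\mathsf{L}^2(\Omega)}^2+\|\mathrm{curl}\,v\|_{\mathsf{L}^2(\Omega)}^2)^{1/2}$, and $\overset{\circ}{\mathsf{H}}(\mathrm{curl};\Omega)$ is the closure in $\mathsf{H}(\mathrm{curl};\Omega)$ of the smooth compactly supported vector fields on $\Omega$ (this generalizes the tangential boundary condition $\nu\times v|_\Gamma=0$, with $\nu$ the outer unit normal). For a tensor field $P:\Omega\to\mathbb{R}^{3\times3}$ whose rows lie in $\mathsf{H}(\mathrm{curl};\Omega)$, $\mathrm{Curl}\,P$ is the tensor field obtained by applying $\mathrm{curl}$ to each row. $\mathsf{H}(\mathrm{Curl};\Omega)$ is the space of tensor fields with all three rows in $\mathsf{H}(\mathrm{curl};\Omega)$, and $\overset{\circ}{\mathsf{H}}(\mathrm{Curl};\Omega)$ is the space of tensor fields with all three rows in $\overset{\circ}{\mathsf{H}}(\mathrm{curl};\Omega)$. $\mathrm{sym}\,P=\tfrac12(P+P^T)$ is the symmetric part. *)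

theory Defs
  imports "HOL-Analysis.Analysis"
begin

section \<open>Bounded domains with Lipschitz boundary\<close>

text \<open>
  Near each boundary point, after a rigid change of coordinates centred there, the set lies
  strictly above the graph of a Lipschitz function of the first two coordinates. Since this is an
  equality of sets inside an open ball, it also forces the boundary inside that ball to be
  the graph and the complement of the closure to be the part strictly below it.
\<close>

definition lipschitz_boundary :: "(real^3) set \<Rightarrow> bool" where
  "lipschitz_boundary \<Omega> \<longleftrightarrow>
    (\<forall>p \<in> frontier \<Omega>. \<exists>r > 0. \<exists>T :: real^3 \<Rightarrow> real^3. \<exists>\<gamma> :: real^2 \<Rightarrow> real. \<exists>L.
        orthogonal_transformation T \<and> L-lipschitz_on UNIV \<gamma> \<and>
        \<Omega> \<inter> ball p r =
          {x \<in> ball p r. T (x - p) $ 3 > \<gamma> (vector [T (x - p) $ 1, T (x - p) $ 2])})"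

definition bounded_domain :: "(real^3) set \<Rightarrow> bool" where
  "bounded_domain \<Omega> \<longleftrightarrow> open \<Omega> \<and> connected \<Omega> \<and> \<Omega> \<noteq> {} \<and> bounded \<Omega>"

section \<open>Square integrable fields\<close>

text \<open>
  Fields are total functions on \<open>real^3\<close>, of which only the values on \<open>\<Omega>\<close> matter; elements of the
  function spaces below are representatives of almost-everywhere classes. On \<open>real^3^3\<close> the
  library norm is the Frobenius norm.
\<close>

definition L2_space :: "(real^3) set \<Rightarrow> (real^3 \<Rightarrow> 'b::euclidean_space) set" where
  "L2_space \<Omega> = {f. f \<in> borel_measurable (lebesgue_on \<Omega>) \<and>
                     integrable (lebesgue_on \<Omega>) (\<lambda>x. (norm (f x))\<^sup>2)}"

definition norm_L2 :: "(real^3) set \<Rightarrow> (real^3 \<Rightarrow> 'b::euclidean_space) \<Rightarrow> real" where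
  "norm_L2 \<Omega> f = sqrt (LINT x|lebesgue_on \<Omega>. (norm (f x))\<^sup>2)"

section \<open>Test fields and the weak curl\<close>

primrec Ck_field :: "nat \<Rightarrow> (real^3 \<Rightarrow> real^3) \<Rightarrow> bool" where
  "Ck_field 0 f \<longleftrightarrow> continuous_on UNIV f"
| "Ck_field (Suc k) f \<longleftrightarrow>
     (\<forall>x. f differentiable (at x)) \<and> (\<forall>v. Ck_field k (\<lambda>x. frechet_derivative f (at x) v))"

text \<open>A smooth compactly supported field on \<open>\<Omega>\<close> is identified with its extension by zero.\<close>

definition test_fields :: "(real^3) set \<Rightarrow> (real^3 \<Rightarrow> real^3) set" where
  "test_fields \<Omega> = {\<phi>. (\<forall>k. Ck_field k \<phi>) \<and>
      compact (closure (support_on UNIV \<phi>)) \<and> closure (support_on UNIV \<phi>) \<subseteq> \<Omega>}"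

definition partial :: "3 \<Rightarrow> (real^3 \<Rightarrow> real^3) \<Rightarrow> real^3 \<Rightarrow> real^3" where
  "partial i f x = frechet_derivative f (at x) (axis i 1)"

definition classical_curl :: "(real^3 \<Rightarrow> real^3) \<Rightarrow> real^3 \<Rightarrow> real^3" where
  "classical_curl f x = vector
     [partial 2 f x $ 3 - partial 3 f x $ 2,
      partial 3 f x $ 1 - partial 1 f x $ 3,
      partial 1 f x $ 2 - partial 2 f x $ 1]"

definition has_weak_curl ::
    "(real^3) set \<Rightarrow> (real^3 \<Rightarrow> real^3) \<Rightarrow> (real^3 \<Rightarrow> real^3) \<Rightarrow> bool" where
  "has_weak_curl \<Omega> v w \<longleftrightarrow>
    (\<forall>\<phi> \<in> test_fields \<Omega>.
       (LINT x|lebesgue_on \<Omega>. w x \<bullet> \<phi> x) = (LINT x|lebesgue_on \<Omega>. v x \<bullet> classical_curl \<phi> x))"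

definition H_curl :: "(real^3) set \<Rightarrow> (real^3 \<Rightarrow> real^3) set" where
  "H_curl \<Omega> = {v \<in> L2_space \<Omega>. \<exists>w \<in> L2_space \<Omega>. has_weak_curl \<Omega> v w}"

text \<open>A representative of the weak curl, which is unique up to null sets; only meaningful on
  \<open>H_curl \<Omega>\<close>.\<close>

definition weak_curl :: "(real^3) set \<Rightarrow> (real^3 \<Rightarrow> real^3) \<Rightarrow> real^3 \<Rightarrow> real^3" where
  "weak_curl \<Omega> v = (SOME w. w \<in> L2_space \<Omega> \<and> has_weak_curl \<Omega> v w)"

definition norm_H_curl :: "(real^3) set \<Rightarrow> (real^3 \<Rightarrow> real^3) \<Rightarrow> real" where
  "norm_H_curl \<Omega> v = sqrt ((norm_L2 \<Omega> v)\<^sup>2 + (norm_L2 \<Omega> (weak_curl \<Omega> v))\<^sup>2)"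

definition H0_curl :: "(real^3) set \<Rightarrow> (real^3 \<Rightarrow> real^3) set" where
  "H0_curl \<Omega> = {v \<in> H_curl \<Omega>.
      \<forall>\<epsilon> > 0. \<exists>\<phi> \<in> test_fields \<Omega>. norm_H_curl \<Omega> (\<lambda>x. v x - \<phi> x) < \<epsilon>}"

section \<open>Tensor fields\<close>

definition H0_Curl :: "(real^3) set \<Rightarrow> (real^3 \<Rightarrow> real^3^3) set" where
  "H0_Curl \<Omega> = {P. \<forall>i. (\<lambda>x. row i (P x)) \<in> H0_curl \<Omega>}"

definition weak_Curl :: "(real^3) set \<Rightarrow> (real^3 \<Rightarrow> real^3^3) \<Rightarrow> real^3 \<Rightarrow> real^3^3" where
  "weak_Curl \<Omega> P x = (\<chi> i. weak_curl \<Omega> (\<lambda>y. row i (P y)) x)"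

definition sym_part :: "real^3^3 \<Rightarrow> real^3^3" where
  "sym_part A = (1/2) *\<^sub>R (A + transpose A)"

definition norm_H_Curl :: "(real^3) set \<Rightarrow> (real^3 \<Rightarrow> real^3^3) \<Rightarrow> real" where
  "norm_H_Curl \<Omega> P = sqrt ((norm_L2 \<Omega> P)\<^sup>2 + (norm_L2 \<Omega> (weak_Curl \<Omega> P))\<^sup>2)"

definition norm_sym_Curl :: "(real^3) set \<Rightarrow> (real^3 \<Rightarrow> real^3^3) \<Rightarrow> real" where
  "norm_sym_Curl \<Omega> P =
     sqrt ((norm_L2 \<Omega> (\<lambda>x. sym_part (P x)))\<^sup>2 + (norm_L2 \<Omega> (weak_Curl \<Omega> P))\<^sup>2)"

section \<open>Norms on spaces of almost-everywhere classes\<close>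

text \<open>
  \<open>V\<close> is a set of representatives closed under almost-everywhere equality, and \<open>N\<close> induces a norm
  on the vector space of classes, so definiteness is up to null sets.
\<close>

definition ae_norm_on ::
    "'a measure \<Rightarrow> ('a \<Rightarrow> 'b::real_vector) set \<Rightarrow> (('a \<Rightarrow> 'b) \<Rightarrow> real) \<Rightarrow> bool" where
  "ae_norm_on M V N \<longleftrightarrow>
     (\<lambda>x. 0) \<in> V \<and>
     (\<forall>f \<in> V. \<forall>g \<in> V. (\<lambda>x. f x + g x) \<in> V) \<and>
     (\<forall>a. \<forall>f \<in> V. (\<lambda>x. a *\<^sub>R f x) \<in> V) \<and>
     (\<forall>f \<in> V. \<forall>g. (AE x in M. f x = g x) \<longrightarrow> g \<in> V \<and> N g = N f) \<and>
     (\<forall>f \<in> V. N f \<ge> 0) \<and>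
     (\<forall>f \<in> V. N f = 0 \<longleftrightarrow> (AE x in M. f x = 0)) \<and>
     (\<forall>a. \<forall>f \<in> V. N (\<lambda>x. a *\<^sub>R f x) = \<bar>a\<bar> * N f) \<and>
     (\<forall>f \<in> V. \<forall>g \<in> V. N (\<lambda>x. f x + g x) \<le> N f + N g)"

definition equivalent_ae_norms_on ::
    "'a measure \<Rightarrow> ('a \<Rightarrow> 'b::real_vector) set \<Rightarrow>
     (('a \<Rightarrow> 'b) \<Rightarrow> real) \<Rightarrow> (('a \<Rightarrow> 'b) \<Rightarrow> real) \<Rightarrow> bool" where
  "equivalent_ae_norms_on M V N1 N2 \<longleftrightarrow>
     ae_norm_on M V N1 \<and> ae_norm_on M V N2 \<and>
     (\<exists>c > 0. \<exists>C > 0. \<forall>f \<in> V. c * N1 f \<le> N2 f \<and> N2 f \<le> C * N1 f)"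

end

theory Submission
  imports Defs
begin

text \<open>
  A tensor field in the closure of the test fields can be replaced by one whose rows are smooth with
  compact support in \<open>\<Omega>\<close>, and extension by zero turns such a field into one on a cube containing
  \<open>\<Omega>\<close> that vanishes near the faces of the cube. The estimate can then be read off its Fourier
  coefficients. At a frequency \<open>\<xi> \<noteq> 0\<close> the operator Curl acts on a coefficient \<open>A\<close> as the row-wise
  cross product \<open>\<xi> \<times> A\<close>, and the part of \<open>A\<close> that \<open>sym A\<close> does not see is visible there: a skew
  matrix \<open>W\<close> with axial vector \<open>w\<close> has
  \<open>\<bar>\<xi> \<times> W\<bar>\<^sup>2 = \<bar>\<xi>\<bar>\<^sup>2 \<bar>w\<bar>\<^sup>2 + (\<xi> \<bullet> w)\<^sup>2\<close>. Hence \<open>\<bar>\<xi>\<bar>\<^sup>2 \<bar>A\<bar>\<^sup>2\<close> is bounded by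
  \<open>\<bar>\<xi>\<bar>\<^sup>2 \<bar>sym A\<bar>\<^sup>2 + \<bar>\<xi> \<times> A\<bar>\<^sup>2\<close> up to a constant (\<open>norm_le_sym_part_cross_rows\<close>), and the
  frequencies of a cube stay away from zero, so that one may divide by \<open>\<bar>\<xi>\<bar>\<^sup>2\<close> and sum with
  Parseval's identity.

  Only the coefficient at frequency zero, the mean, escapes this argument. But the mean is an
  integral over \<open>\<Omega>\<close> alone, so by Cauchy-Schwarz it carries at most the fraction
  \<open>\<bar>\<Omega>\<bar> / \<bar>cube\<bar>\<close> of the squared norm. In a cube of at least twice the volume of \<open>\<Omega>\<close> it can be
  absorbed into the left-hand side. This is \<open>sym_Curl_inequality_C1\<close>.

  Parseval's identity comes from the orthogonality of the waves (\<open>Bessel\<close>) and the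
  Stone-Weierstrass theorem on the torus (\<open>Fourier_completeness\<close>).

  For general elements of the space, weak curls have to be compared with classical ones and added;
  both rest on the uniqueness of the weak curl up to null sets, that is, on the fundamental lemma of
  the calculus of variations (\<open>fundamental_lemma_test_fields\<close>). Its proof needs enough test fields,
  and these are built from the function \<open>exp (- 1 / t)\<close>. The norm axioms are then inherited from the
  Hilbert space norm of the pair \<open>(P, Curl P)\<close> or \<open>(sym P, Curl P)\<close>, except for the definiteness of
  the second, which is the estimate itself.
\<close>

section \<open>Waves on a cube\<close>

definition cube :: "real \<Rightarrow> 'a::euclidean_space set" where
  "cube L = {x. \<forall>b\<in>Basis. \<bar>x \<bullet> b\<bar> \<le> pi * L}"

text \<open>
  The dual lattice of the cube: the waves at these frequencies are the characters of the torus
  obtained by gluing opposite faces of \<open>cube L\<close>.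
\<close>

definition frequencies :: "real \<Rightarrow> 'a::euclidean_space set" where
  "frequencies L = {\<xi>. \<forall>b\<in>Basis. L * (\<xi> \<bullet> b) \<in> \<int>}"

definition wave :: "'a::euclidean_space \<Rightarrow> 'a \<Rightarrow> complex" where
  "wave \<xi> x = cis (\<xi> \<bullet> x)"

lemma cube_eq_cbox: "cube L = cbox (- (pi * L) *\<^sub>R One) ((pi * L) *\<^sub>R One)"
  by (auto simp: cube_def cbox_def abs_le_iff)

lemma compact_cube: "compact (cube L)"
  by (simp add: cube_eq_cbox)

lemma cube_sets: "cube L \<in> sets lebesgue" "cube L \<in> sets borel"
  by (simp_all add: cube_eq_cbox)

lemma measure_cube:
  assumes "L > 0" shows "measure lebesgue (cube L :: 'a::euclidean_space set) = (2 * pi * L) ^ DIM('a)"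
proof -
  have "measure lborel (cube L :: 'a set) = (\<Prod>b\<in>(Basis::'a set). 2 * pi * L)"
    unfolding cube_eq_cbox measure_lborel_cbox_eq using assms
    by (auto intro!: prod.cong simp: inner_diff_left algebra_simps)
  then show ?thesis by (simp add: measure_completion cube_sets)
qed

lemma measure_cube_pos: "L > 0 \<Longrightarrow> measure lebesgue (cube L :: 'a::euclidean_space set) > 0"
  by (simp add: measure_cube)

lemma wave_add: "wave (\<xi> + \<eta>) x = wave \<xi> x * wave \<eta> x"
  by (simp add: wave_def cis_mult inner_add_left)

lemma wave_zero: "wave 0 x = 1"
  by (simp add: wave_def)

lemma continuous_on_wave: "continuous_on A (wave \<xi>)"
  unfolding wave_def by (intro continuous_intros)

lemma frequencies_zero: "0 \<in> frequencies L"
  by (simp add: frequencies_def)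

lemma frequencies_add: "\<xi> \<in> frequencies L \<Longrightarrow> \<eta> \<in> frequencies L \<Longrightarrow> \<xi> + \<eta> \<in> frequencies L"
  by (simp add: frequencies_def inner_add_left ring_distribs)

lemma frequencies_diff: "\<xi> \<in> frequencies L \<Longrightarrow> \<eta> \<in> frequencies L \<Longrightarrow> \<xi> - \<eta> \<in> frequencies L"
  by (simp add: frequencies_def inner_diff_left ring_distribs)

text \<open>
  On the one-dimensional factor the primitive \<open>cis (c t) / (\<i> c)\<close> takes equal values at the two
  ends, since their distance \<open>2 \<pi> L\<close> is a multiple of the period.
\<close>

lemma integral_cis_period:
  assumes "L > 0" "L * c \<in> \<int>" "c \<noteq> 0"
  shows "(LINT t|lborel. indicator {- (pi * L)..pi * L} t *\<^sub>R cis (c * t)) = 0"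
proof -
  from assms obtain m where m: "L * c = of_int m" by (auto elim: Ints_cases)
  have d: "((\<lambda>t. cis (c * t) / (\<i> * c)) has_vector_derivative cis (c * t)) (at t within S)" for t S
  proof -
    have "((\<lambda>z. exp (\<i> * (of_real c * z)) / (\<i> * of_real c)) has_field_derivative
        exp (\<i> * (of_real c * of_real t))) (at (of_real t))"
      using assms(3) by (auto intro!: derivative_eq_intros simp: algebra_simps)
    from has_vector_derivative_real_field[OF this] show ?thesis
      by (simp add: cis_conv_exp)
  qed
  have "(LBINT t:{- (pi * L)..pi * L}. cis (c * t)) = cis (c * (pi * L)) / (\<i> * c) - cis (c * (- (pi * L))) / (\<i> * c)"
    unfolding set_lebesgue_integral_def
    using assms
    by (intro integral_FTC_Icc d continuous_intros) auto
  also have "c * (pi * L) = pi * of_int m" using m by (simp add: algebra_simps)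
  also have "c * (- (pi * L)) = - (pi * of_int m)" using m by (simp add: algebra_simps)
  also have "cis (pi * of_int m) = cis (- (pi * of_int m))"
    by (auto simp: complex_eq_iff sin_zero_iff_int2 intro!: exI[of _ m])
  finally show ?thesis by (simp add: set_lebesgue_integral_def)
qed

lemma integral_lborel_prod:
  fixes f :: "'a::euclidean_space \<Rightarrow> real \<Rightarrow> complex"
  assumes int: "\<And>b. b \<in> Basis \<Longrightarrow> integrable lborel (f b)"
  shows "(LINT x|lborel. (\<Prod>b\<in>Basis. f b (x \<bullet> b))) = (\<Prod>b\<in>(Basis::'a set). LINT t|lborel. f b t)"
proof -
  interpret product_sigma_finite "\<lambda>_::'a. lborel::real measure" ..
  have [measurable]: "f b \<in> borel_measurable borel" if "b \<in> Basis" for b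
    using int[OF that] by auto
  have "(LINT x|lborel. (\<Prod>b\<in>Basis. f b (x \<bullet> b))) =
      (LINT x|(\<Pi>\<^sub>M b\<in>(Basis::'a set). lborel). (\<Prod>b\<in>Basis. f b ((\<Sum>i\<in>Basis. x i *\<^sub>R i) \<bullet> b)))"
    unfolding lborel_eq_real[symmetric]
    by (subst lborel_def, subst integral_distr) (auto simp: lborel_eq_real)
  also have "\<dots> = (LINT x|(\<Pi>\<^sub>M b\<in>(Basis::'a set). lborel). (\<Prod>b\<in>Basis. f b (x b)))"
    by (intro Bochner_Integration.integral_cong prod.cong refl) simp
  also have "\<dots> = (\<Prod>b\<in>(Basis::'a set). LINT t|lborel. f b t)"
    by (rule product_integral_prod) (auto intro: int)
  finally show ?thesis .
qed

lemma integral_lebesgue_on_eq_lborel_indicator: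
  fixes f :: "'a::euclidean_space \<Rightarrow> 'b::{banach, second_countable_topology}"
  assumes "S \<in> sets lebesgue" "(\<lambda>x. indicator S x *\<^sub>R f x) \<in> borel_measurable borel"
  shows "(LINT x|lebesgue_on S. f x) = (LINT x|lborel. indicator S x *\<^sub>R f x)"
  using assms by (subst integral_restrict_space) (auto intro!: integral_completion)

lemma lebesgue_on_eq_lborel:
  fixes f :: "'a::euclidean_space \<Rightarrow> 'b::{banach, second_countable_topology}"
  assumes "S \<in> sets lebesgue" "f \<in> borel_measurable borel" "\<And>x. x \<notin> S \<Longrightarrow> f x = 0"
  shows "(LINT x|lebesgue_on S. f x) = (LINT x|lborel. f x)"
proof -
  have "(\<lambda>x. indicator S x *\<^sub>R f x) = f" using assms(3) by (auto simp: fun_eq_iff indicator_def)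
  then show ?thesis using integral_lebesgue_on_eq_lborel_indicator[of S f] assms(1,2) by simp
qed

text \<open>
  A wave is a product of one-dimensional waves, and a nonzero frequency makes at least one of the
  factors integrate to zero.
\<close>

lemma integral_wave_nonzero:
  fixes \<xi> :: "'a::euclidean_space"
  assumes "L > 0" "\<xi> \<in> frequencies L" "\<xi> \<noteq> 0"
  shows "(LINT x|lebesgue_on (cube L). wave \<xi> x) = 0"
proof -
  from assms(3) obtain b where b: "b \<in> Basis" "\<xi> \<bullet> b \<noteq> 0"
    by (metis euclidean_all_zero_iff)
  have eq: "indicator (cube L) x *\<^sub>R wave \<xi> x =
      (\<Prod>b\<in>Basis. indicator {- (pi * L)..pi * L} (x \<bullet> b) *\<^sub>R cis ((\<xi> \<bullet> b) * (x \<bullet> b)))" for x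
  proof -
    have "wave \<xi> x = (\<Prod>b\<in>Basis. cis ((\<xi> \<bullet> b) * (x \<bullet> b)))"
      unfolding wave_def by (subst euclidean_inner) (simp add: cis_conv_exp sum_distrib_left exp_sum)
    moreover have "(indicator (cube L) x :: complex) = (\<Prod>b\<in>Basis. indicator {- (pi * L)..pi * L} (x \<bullet> b))"
      by (auto simp: cube_def indicator_def abs_le_iff intro!: prod.neutral)
         (metis (no_types, lifting) minus_le_iff)+
    ultimately show ?thesis
      by (simp add: scaleR_conv_of_real prod.distrib of_real_indicator)
  qed
  have "(LINT x|lebesgue_on (cube L). wave \<xi> x) = (LINT x|lborel. indicator (cube L) x *\<^sub>R wave \<xi> x)"
    by (rule integral_lebesgue_on_eq_lborel_indicator)
       (intro cube_sets borel_measurable_scaleR borel_measurable_indicator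
          borel_measurable_continuous_onI continuous_on_wave)+
  also have "\<dots> = (\<Prod>b\<in>(Basis::'a set). LINT t|lborel. indicator {- (pi * L)..pi * L} t *\<^sub>R cis ((\<xi> \<bullet> b) * t))"
    unfolding eq
    by (rule integral_lborel_prod)
       (auto intro!: borel_integrable_compact continuous_intros)
  also have "\<dots> = 0"
    using b assms by (intro prod_zero) (auto intro!: bexI[of _ b] integral_cis_period simp: frequencies_def)
  finally show ?thesis .
qed

lemma integrable_on_cube:
  fixes f :: "'a::euclidean_space \<Rightarrow> 'b::euclidean_space"
  shows "continuous_on (cube L) f \<Longrightarrow> integrable (lebesgue_on (cube L)) f"
  by (simp add: cube_eq_cbox continuous_imp_integrable)

lemma wave_orthogonal:
  fixes \<xi> \<eta> :: "'a::euclidean_space"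
  assumes "L > 0" "\<xi> \<in> frequencies L" "\<eta> \<in> frequencies L"
  shows "(LINT x|lebesgue_on (cube L). wave \<xi> x * cnj (wave \<eta> x)) =
    (if \<xi> = \<eta> then of_real (measure lebesgue (cube L :: 'a set)) else 0)"
proof (cases "\<xi> = \<eta>")
  case True
  have "wave \<eta> x * cnj (wave \<eta> x) = 1" for x by (simp add: wave_def cis_cnj cis_mult)
  then show ?thesis using True
    by (simp add: measure_restrict_space cube_sets scaleR_conv_of_real)
next
  case False
  have "wave \<xi> x * cnj (wave \<eta> x) = wave (\<xi> - \<eta>) x" for x
    by (simp add: wave_def cis_cnj cis_mult inner_diff_left)
  then show ?thesis using False integral_wave_nonzero[OF assms(1) frequencies_diff[OF assms(2,3)]] by simp
qed

section \<open>Density of trigonometric polynomials\<close>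

text \<open>
  Trigonometric polynomials, generated by adding one wave at a time; the frequencies of a derivation
  may repeat, which makes closure under sums and products straightforward. Collecting equal
  frequencies is postponed to \<open>trig_poly_sum_form\<close>.
\<close>

inductive trig_poly :: "real \<Rightarrow> ('a::euclidean_space \<Rightarrow> complex) \<Rightarrow> bool" for L where
  zero: "trig_poly L (\<lambda>x. 0)"
| add_wave: "trig_poly L p \<Longrightarrow> \<xi> \<in> frequencies L \<Longrightarrow> trig_poly L (\<lambda>x. c * wave \<xi> x + p x)"

lemma trig_poly_wave: "\<xi> \<in> frequencies L \<Longrightarrow> trig_poly L (\<lambda>x. c * wave \<xi> x)"
  using add_wave[OF zero] by simp

lemma trig_poly_add: "trig_poly L p \<Longrightarrow> trig_poly L q \<Longrightarrow> trig_poly L (\<lambda>x. p x + q x)"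
  by (induction rule: trig_poly.induct) (auto simp: add.assoc intro: add_wave)

lemma trig_poly_mult_wave:
  "trig_poly L p \<Longrightarrow> \<xi> \<in> frequencies L \<Longrightarrow> trig_poly L (\<lambda>x. c * wave \<xi> x * p x)"
proof (induction rule: trig_poly.induct)
  case zero then show ?case by (simp add: trig_poly.zero)
next
  case (add_wave p \<eta> d)
  have "(\<lambda>x. c * wave \<xi> x * (d * wave \<eta> x + p x)) = (\<lambda>x. (c * d) * wave (\<xi> + \<eta>) x + c * wave \<xi> x * p x)"
    by (simp add: wave_add algebra_simps)
  with add_wave show ?case by (auto intro!: trig_poly.add_wave frequencies_add)
qed

lemma trig_poly_mult: "trig_poly L p \<Longrightarrow> trig_poly L q \<Longrightarrow> trig_poly L (\<lambda>x. p x * q x)"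
  by (induction rule: trig_poly.induct)
     (auto simp: ring_distribs intro: trig_poly_mult_wave trig_poly_add trig_poly.zero)

lemma trig_poly_const: "trig_poly L (\<lambda>x. c)"
  using trig_poly_wave[OF frequencies_zero, of L c] by (simp add: wave_zero)

lemma trig_poly_sum: "finite I \<Longrightarrow> (\<And>i. i \<in> I \<Longrightarrow> trig_poly L (f i)) \<Longrightarrow> trig_poly L (\<lambda>x. \<Sum>i\<in>I. f i x)"
  by (induction I rule: finite_induct) (auto intro: trig_poly_add trig_poly.zero)

lemma trig_poly_sum_form:
  "trig_poly L p \<Longrightarrow> \<exists>F a. finite F \<and> F \<subseteq> frequencies L \<and> p = (\<lambda>x. \<Sum>\<xi>\<in>F. a \<xi> * wave \<xi> x)"
proof (induction rule: trig_poly.induct)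
  case zero then show ?case by (intro exI[of _ "{}"]) auto
next
  case (add_wave p \<xi> c)
  then obtain F a where F: "finite F" "F \<subseteq> frequencies L" "p = (\<lambda>x. \<Sum>\<xi>\<in>F. a \<xi> * wave \<xi> x)" by blast
  \<comment> \<open>The new frequency may already occur in \<open>F\<close>, in which case the coefficients add up.\<close>
  define a' where "a' \<eta> = (if \<eta> \<in> F then a \<eta> else 0) + (if \<eta> = \<xi> then c else 0)" for \<eta>
  have "c * wave \<xi> x + p x = (\<Sum>\<eta>\<in>insert \<xi> F. a' \<eta> * wave \<eta> x)" for x
  proof -
    have "(\<Sum>\<eta>\<in>insert \<xi> F. a' \<eta> * wave \<eta> x) =
       (\<Sum>\<eta>\<in>insert \<xi> F. if \<eta> \<in> F then a \<eta> * wave \<eta> x else 0) + (\<Sum>\<eta>\<in>insert \<xi> F. if \<eta> = \<xi> then c * wave \<eta> x else 0)"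
      unfolding sum.distrib[symmetric] by (intro sum.cong) (auto simp: a'_def algebra_simps)
    also have "(\<Sum>\<eta>\<in>insert \<xi> F. if \<eta> = \<xi> then c * wave \<eta> x else 0) = c * wave \<xi> x"
      using F(1) by (simp add: sum.delta)
    also have "(\<Sum>\<eta>\<in>insert \<xi> F. if \<eta> \<in> F then a \<eta> * wave \<eta> x else 0) = (\<Sum>\<eta>\<in>F. a \<eta> * wave \<eta> x)"
      using F(1) by (intro sum.mono_neutral_cong_right) auto
    finally show ?thesis using F(3) by simp
  qed
  then show ?case using F add_wave.hyps by (intro exI[of _ "insert \<xi> F"] exI[of _ a']) auto
qed

text \<open>
  The quotient map that glues opposite faces of the cube. The torus is realised as a compact subset
  of a Euclidean space, which is where the Stone-Weierstrass theorem applies.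
\<close>

definition torus_map :: "real \<Rightarrow> 'a::euclidean_space \<Rightarrow> 'a \<times> 'a" where
  "torus_map L x = (\<Sum>b\<in>Basis. cos ((x \<bullet> b) / L) *\<^sub>R b, \<Sum>b\<in>Basis. sin ((x \<bullet> b) / L) *\<^sub>R b)"

lemma trig_poly_cos_sin:
  fixes b :: "'a::euclidean_space"
  assumes "L > 0" "b \<in> Basis"
  shows "trig_poly L (\<lambda>x. of_real (cos ((x \<bullet> b) / L)))" "trig_poly L (\<lambda>x. of_real (sin ((x \<bullet> b) / L)))"
proof -
  let ?\<xi> = "(1/L) *\<^sub>R b"
  have \<xi>: "?\<xi> \<in> frequencies L" "- ?\<xi> \<in> frequencies L"
    using assms by (auto simp: frequencies_def inner_Basis)
  have c: "(\<lambda>x. of_real (cos ((x \<bullet> b) / L))) = (\<lambda>x. (1/2) * wave ?\<xi> x + (1/2) * wave (- ?\<xi>) x)"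
    by (auto simp: wave_def complex_eq_iff inner_commute)
  have s: "(\<lambda>x. of_real (sin ((x \<bullet> b) / L))) = (\<lambda>x. (-\<i>/2) * wave ?\<xi> x + (\<i>/2) * wave (- ?\<xi>) x)"
    by (auto simp: wave_def complex_eq_iff inner_commute)
  show "trig_poly L (\<lambda>x. of_real (cos ((x \<bullet> b) / L)))" "trig_poly L (\<lambda>x. of_real (sin ((x \<bullet> b) / L)))"
    unfolding c s by (intro trig_poly_add trig_poly_wave \<xi>)+
qed

text \<open>
  The coordinates of the torus are cosines and sines, so polynomials on it pull back to trigonometric
  polynomials.
\<close>

lemma trig_poly_real_polynomial:
  fixes g :: "'a::euclidean_space \<times> 'a \<Rightarrow> real"
  assumes "real_polynomial_function g" "L > 0"
  shows "trig_poly L (\<lambda>x. of_real (g (torus_map L x)))"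
  using assms
proof (induction rule: real_polynomial_function.induct)
  case (linear g)
  interpret g: bounded_linear g by fact
  have eq: "g (torus_map L x) = (\<Sum>b\<in>Basis. cos ((x \<bullet> b) / L) * g (b, 0)) + (\<Sum>b\<in>Basis. sin ((x \<bullet> b) / L) * g (0, b))" for x
  proof -
    have "torus_map L x = (\<Sum>b\<in>Basis. cos ((x \<bullet> b) / L) *\<^sub>R (b, 0)) + (\<Sum>b\<in>Basis. sin ((x \<bullet> b) / L) *\<^sub>R (0, b))"
      by (auto simp: torus_map_def prod_eq_iff fst_sum snd_sum)
    then show ?thesis by (simp add: g.add g.sum g.scaleR del: scaleR_Pair)
  qed
  show ?case unfolding eq of_real_add of_real_sum of_real_mult
    using linear(2) by (intro trig_poly_add trig_poly_sum trig_poly_mult trig_poly_const trig_poly_cos_sin) auto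
next
  case const show ?case by (rule trig_poly_const)
next
  case add then show ?case by (simp add: trig_poly_add)
next
  case mult then show ?case by (simp add: trig_poly_mult)
qed

lemma continuous_on_torus_map: "continuous_on A (torus_map L)"
  unfolding torus_map_def divide_inverse by (intro continuous_intros)

lemma cos_sin_eq_imp:
  assumes "cos s = cos t" "sin s = sin t" "\<bar>s\<bar> \<le> pi" "\<bar>t\<bar> \<le> pi"
  shows "s = t \<or> \<bar>s\<bar> = pi \<and> \<bar>t\<bar> = pi"
proof -
  from assms obtain n where n: "s = t + 2 * pi * of_int n"
    using sin_cos_eq_iff[of s t] by auto
  with assms(3,4) have "\<bar>2 * pi * of_int n\<bar> \<le> 2 * pi" by linarith
  then have "\<bar>real_of_int n\<bar> \<le> 1" by (simp add: abs_mult)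
  then have "\<bar>n\<bar> \<le> 1" by linarith
  then have "n = 0 \<or> n = 1 \<or> n = -1" by linarith
  then show ?thesis using n assms(3,4) pi_gt_zero by (elim disjE; simp; linarith)
qed

text \<open>
  Gluing happens only on the boundary of the cube, so functions that vanish there factor through the
  torus.
\<close>

lemma torus_map_inject:
  fixes x y :: "'a::euclidean_space"
  assumes "L > 0" "x \<in> cube L" "y \<in> cube L" "torus_map L x = torus_map L y"
  shows "x = y \<or> x \<notin> interior (cube L) \<and> y \<notin> interior (cube L)"
proof (rule ccontr)
  assume neg: "\<not> ?thesis"
  then obtain b where b: "b \<in> Basis" "x \<bullet> b \<noteq> y \<bullet> b" using euclidean_eq_iff by blast
  have "cos ((x \<bullet> b) / L) = cos ((y \<bullet> b) / L)" "sin ((x \<bullet> b) / L) = sin ((y \<bullet> b) / L)"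
    using arg_cong[OF assms(4), of "\<lambda>z. fst z \<bullet> b"] arg_cong[OF assms(4), of "\<lambda>z. snd z \<bullet> b"] b(1)
    by (simp_all add: torus_map_def inner_sum_left_Basis)
  from cos_sin_eq_imp[OF this] have "\<bar>x \<bullet> b\<bar> = pi * L \<and> \<bar>y \<bullet> b\<bar> = pi * L"
    using assms(1-3) b by (auto simp: cube_def field_simps)
  moreover have "interior (cube L :: 'a set) = {x. \<forall>b\<in>Basis. \<bar>x \<bullet> b\<bar> < pi * L}"
    unfolding cube_eq_cbox interior_cbox box_def
    by (intro Collect_cong ball_cong) (auto simp: abs_less_iff)
  ultimately show False using neg b(1) by auto
qed

text \<open>
  A continuous function that vanishes outside the interior of the cube descends to the torus. The
  descended function is continuous because a continuous surjection from a compact space onto a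
  Hausdorff space is a quotient map. Stone-Weierstrass on the torus then gives the approximation.
\<close>

lemma trig_poly_dense:
  fixes f :: "'a::euclidean_space \<Rightarrow> real"
  assumes "L > 0" "continuous_on (cube L) f" "\<And>x. x \<notin> interior (cube L) \<Longrightarrow> f x = 0" "e > 0"
  shows "\<exists>p. trig_poly L p \<and> (\<forall>x\<in>cube L. cmod (of_real (f x) - p x) < e)"
proof -
  let ?T = "torus_map L ` cube L"
  \<comment> \<open>The descended function; by injectivity up to the boundary the choice of the preimage does not matter.\<close>
  define F where "F z = f (SOME x. x \<in> cube L \<and> torus_map L x = z)" for z
  have F: "F (torus_map L x) = f x" if "x \<in> cube L" for x
  proof -
    define y where "y = (SOME y. y \<in> cube L \<and> torus_map L y = torus_map L x)"
    have y: "y \<in> cube L \<and> torus_map L y = torus_map L x"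
      unfolding y_def by (rule someI[of _ x]) (use that in auto)
    then have "f y = f x"
      using torus_map_inject[OF assms(1), of y x] that assms(3)[of x] assms(3)[of y] by auto
    then show ?thesis by (simp add: F_def y_def)
  qed
  have "continuous_on ?T F"
  proof -
    have q: "quotient_map (top_of_set (cube L)) (top_of_set ?T) (torus_map L)"
    proof (rule continuous_closed_imp_quotient_map[OF _ T1_Spaces.continuous_imp_closed_map])
      show "continuous_map (top_of_set (cube L)) (top_of_set ?T) (torus_map L)"
        by (simp add: continuous_on_torus_map continuous_map_in_subtopology)
      show "continuous_map (top_of_set (cube L)) (top_of_set ?T) (torus_map L)"
        by (simp add: continuous_on_torus_map continuous_map_in_subtopology)
      show "compact_space (top_of_set (cube L))"
        by (simp add: compact_cube compact_space_subtopology)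
      show "Hausdorff_space (top_of_set ?T)"
        by (simp add: Hausdorff_space_subtopology)
    qed simp
    have "continuous_map (top_of_set (cube L)) euclideanreal (F \<circ> torus_map L)"
      using assms(2) F by (auto intro: continuous_on_cong[THEN iffD2])
    then have "continuous_map (top_of_set ?T) euclideanreal F"
      by (rule continuous_compose_quotient_map[OF q])
    then show ?thesis by simp
  qed
  moreover have "compact ?T" by (intro compact_continuous_image continuous_on_torus_map compact_cube)
  ultimately obtain g where g: "real_polynomial_function g" "\<And>z. z \<in> ?T \<Longrightarrow> \<bar>F z - g z\<bar> < e"
    using Stone_Weierstrass_real_polynomial_function assms(4) by metis
  show ?thesis
  proof (intro exI conjI ballI)
    show "trig_poly L (\<lambda>x. of_real (g (torus_map L x)))" by (rule trig_poly_real_polynomial) fact+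
    show "cmod (of_real (f x) - of_real (g (torus_map L x))) < e" if "x \<in> cube L" for x
      using g(2)[of "torus_map L x"] that F[OF that]
      by (metis imageI norm_of_real of_real_diff)
  qed
qed

section \<open>Fourier coefficients and Parseval's identity\<close>

text \<open>
  Cosine and sine coefficients are kept apart, instead of being combined into a complex one, because
  this makes sense for values in any Euclidean space; the tensor fields below have values in
  \<open>real^3^3\<close>.
\<close>

definition cosine_coeff :: "real \<Rightarrow> ('a::euclidean_space \<Rightarrow> 'b::euclidean_space) \<Rightarrow> 'a \<Rightarrow> 'b" where
  "cosine_coeff L f \<xi> = (LINT x|lebesgue_on (cube L). cos (\<xi> \<bullet> x) *\<^sub>R f x)"

definition sine_coeff :: "real \<Rightarrow> ('a::euclidean_space \<Rightarrow> 'b::euclidean_space) \<Rightarrow> 'a \<Rightarrow> 'b" where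
  "sine_coeff L f \<xi> = (LINT x|lebesgue_on (cube L). sin (\<xi> \<bullet> x) *\<^sub>R f x)"

text \<open>
  Completing the square, as \<open>V = \<bar>cube\<bar>\<close> is the squared norm of each wave. Taking \<open>a = h / V\<close> removes
  the last sum and gives Bessel's inequality; dropping that sum for a good approximation gives
  completeness.
\<close>

lemma L2_distance_trig_sum:
  fixes f :: "'a::euclidean_space \<Rightarrow> real"
  assumes "L > 0" "continuous_on (cube L) f" "finite F" "F \<subseteq> frequencies L"
  defines "V \<equiv> measure lebesgue (cube L :: 'a set)"
  defines "h \<equiv> \<lambda>\<xi>. (LINT x|lebesgue_on (cube L). cnj (wave \<xi> x) * of_real (f x))"
  shows "V * (LINT x|lebesgue_on (cube L). (cmod (of_real (f x) - (\<Sum>\<xi>\<in>F. a \<xi> * wave \<xi> x)))\<^sup>2) =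
    V * (LINT x|lebesgue_on (cube L). (f x)\<^sup>2) - (\<Sum>\<xi>\<in>F. (cmod (h \<xi>))\<^sup>2) + (\<Sum>\<xi>\<in>F. (cmod (of_real V * a \<xi> - h \<xi>))\<^sup>2)"
    (is "V * ?D = V * ?N - _ + _")
proof -
  let ?M = "lebesgue_on (cube L :: 'a set)"
  note cont = continuous_on_wave assms(2) continuous_on_mult continuous_on_of_real continuous_on_cnj continuous_on_power
  have i1: "integrable ?M (\<lambda>x. cnj (wave \<xi> x) * of_real (f x))"
    and i2: "integrable ?M (\<lambda>x. wave \<xi> x * of_real (f x))"
    and i3: "integrable ?M (\<lambda>x. wave \<xi> x * cnj (wave \<eta> x))"
    and i4: "integrable ?M (\<lambda>x. complex_of_real ((f x)\<^sup>2))" for \<xi> \<eta>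
    by (intro integrable_on_cube cont)+
  have h': "(LINT x|?M. wave \<xi> x * of_real (f x)) = cnj (h \<xi>)" for \<xi>
    unfolding h_def by (subst Bochner_Integration.integral_cnj[symmetric]) simp
  have pt: "complex_of_real ((cmod (of_real (f x) - (\<Sum>\<xi>\<in>F. a \<xi> * wave \<xi> x)))\<^sup>2) =
     of_real ((f x)\<^sup>2) - (\<Sum>\<xi>\<in>F. cnj (a \<xi>) * (cnj (wave \<xi> x) * of_real (f x)))
       - (\<Sum>\<xi>\<in>F. a \<xi> * (wave \<xi> x * of_real (f x)))
       + (\<Sum>\<xi>\<in>F. \<Sum>\<eta>\<in>F. a \<xi> * cnj (a \<eta>) * (wave \<xi> x * cnj (wave \<eta> x)))" for x
    unfolding complex_norm_square
    by (simp add: ring_distribs sum_distrib_left sum_distrib_right sum_product power2_eq_square ac_simps)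
       (subst sum.swap, simp add: ac_simps)
  have "complex_of_real ?D = (LINT x|?M. complex_of_real ((cmod (of_real (f x) - (\<Sum>\<xi>\<in>F. a \<xi> * wave \<xi> x)))\<^sup>2))"
    by (rule integral_complex_of_real[symmetric])
  also have "\<dots> = of_real ?N - (\<Sum>\<xi>\<in>F. cnj (a \<xi>) * h \<xi>) - (\<Sum>\<xi>\<in>F. a \<xi> * cnj (h \<xi>))
      + (\<Sum>\<xi>\<in>F. \<Sum>\<eta>\<in>F. a \<xi> * cnj (a \<eta>) * (if \<xi> = \<eta> then of_real V else 0))"
  proof -
    have o: "(LINT x|?M. wave \<xi> x * cnj (wave \<eta> x)) = (if \<xi> = \<eta> then of_real V else 0)"
      if "\<xi> \<in> F" "\<eta> \<in> F" for \<xi> \<eta>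
      using wave_orthogonal[OF assms(1), of \<xi> \<eta>] that assms(4) unfolding V_def by blast
    have b1: "has_bochner_integral ?M (\<lambda>x. cnj (wave \<xi> x) * of_real (f x)) (h \<xi>)" for \<xi>
      using has_bochner_integral_integrable[OF i1] unfolding h_def .
    have b2: "has_bochner_integral ?M (\<lambda>x. wave \<xi> x * of_real (f x)) (cnj (h \<xi>))" for \<xi>
      using has_bochner_integral_integrable[OF i2] unfolding h' .
    have b3: "has_bochner_integral ?M (\<lambda>x. wave \<xi> x * cnj (wave \<eta> x)) (if \<xi> = \<eta> then of_real V else 0)"
      if "\<xi> \<in> F" "\<eta> \<in> F" for \<xi> \<eta>
      using has_bochner_integral_integrable[OF i3[of \<xi> \<eta>]] unfolding o[OF that] .
    have b4: "has_bochner_integral ?M (\<lambda>x. complex_of_real ((f x)\<^sup>2)) (of_real ?N)"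
      using has_bochner_integral_integrable[OF i4] unfolding integral_complex_of_real .
    show ?thesis unfolding pt
      by (intro has_bochner_integral_integral_eq has_bochner_integral_add has_bochner_integral_diff
          has_bochner_integral_sum has_bochner_integral_mult_right b1 b2 b3 b4)
  qed
  also have "(\<Sum>\<xi>\<in>F. \<Sum>\<eta>\<in>F. a \<xi> * cnj (a \<eta>) * (if \<xi> = \<eta> then of_real V else 0)) = (\<Sum>\<xi>\<in>F. a \<xi> * cnj (a \<xi>) * of_real V)"
    using assms(3) by (intro sum.cong refl) (simp add: sum.delta if_distrib[of "\<lambda>z. _ * z"] cong: if_cong)
  finally have D: "complex_of_real ?D = of_real ?N - (\<Sum>\<xi>\<in>F. cnj (a \<xi>) * h \<xi>) - (\<Sum>\<xi>\<in>F. a \<xi> * cnj (h \<xi>))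
     + (\<Sum>\<xi>\<in>F. a \<xi> * cnj (a \<xi>) * of_real V)" .
  have "complex_of_real (V * ?D) = of_real (V * ?N - (\<Sum>\<xi>\<in>F. (cmod (h \<xi>))\<^sup>2) + (\<Sum>\<xi>\<in>F. (cmod (of_real V * a \<xi> - h \<xi>))\<^sup>2))"
    unfolding of_real_mult D of_real_add of_real_diff of_real_sum complex_norm_square
    by (simp add: ring_distribs sum_distrib_left sum.distrib sum_subtractf ac_simps)
  then show ?thesis using of_real_eq_iff by blast
qed

lemma cos_sine_coeff_eq_wave_coeff:
  fixes f :: "'a::euclidean_space \<Rightarrow> real"
  assumes "continuous_on (cube L) f"
  shows "(cmod (LINT x|lebesgue_on (cube L). cnj (wave \<xi> x) * of_real (f x)))\<^sup>2 = (cosine_coeff L f \<xi>)\<^sup>2 + (sine_coeff L f \<xi>)\<^sup>2"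
proof -
  let ?M = "lebesgue_on (cube L :: 'a set)"
  have i: "integrable ?M (\<lambda>x. cnj (wave \<xi> x) * of_real (f x))"
    by (intro integrable_on_cube continuous_intros continuous_on_wave assms)
  have "Re (LINT x|?M. cnj (wave \<xi> x) * of_real (f x)) = cosine_coeff L f \<xi>"
    unfolding cosine_coeff_def by (subst integral_Re[OF i, symmetric]) (simp add: wave_def)
  moreover have "Im (LINT x|?M. cnj (wave \<xi> x) * of_real (f x)) = - sine_coeff L f \<xi>"
    unfolding sine_coeff_def by (subst integral_Im[OF i, symmetric]) (simp add: wave_def)
  ultimately show ?thesis by (simp add: cmod_power2)
qed

text \<open>
  The distance of \<open>f\<close> to its partial Fourier sum is nonnegative.
\<close>

lemma Bessel_real:
  fixes f :: "'a::euclidean_space \<Rightarrow> real"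
  assumes "L > 0" "continuous_on (cube L) f" "finite F" "F \<subseteq> frequencies L"
  shows "(\<Sum>\<xi>\<in>F. (cosine_coeff L f \<xi>)\<^sup>2 + (sine_coeff L f \<xi>)\<^sup>2)
     \<le> measure lebesgue (cube L :: 'a set) * (LINT x|lebesgue_on (cube L). (f x)\<^sup>2)"
proof -
  let ?V = "measure lebesgue (cube L :: 'a set)"
  let ?h = "\<lambda>\<xi>. (LINT x|lebesgue_on (cube L). cnj (wave \<xi> x) * of_real (f x))"
  have "?V > 0" by (rule measure_cube_pos[OF assms(1)])
  then have "(\<Sum>\<xi>\<in>F. (cmod (of_real ?V * (?h \<xi> / of_real ?V) - ?h \<xi>))\<^sup>2) = 0" by simp
  then have "0 \<le> ?V * (LINT x|lebesgue_on (cube L). (f x)\<^sup>2) - (\<Sum>\<xi>\<in>F. (cmod (?h \<xi>))\<^sup>2)"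
    using L2_distance_trig_sum[OF assms, of "\<lambda>\<xi>. ?h \<xi> / of_real ?V"]
      mult_nonneg_nonneg[OF measure_nonneg Bochner_Integration.integral_nonneg, of "lebesgue_on (cube L)"
        "\<lambda>x. (cmod (of_real (f x) - (\<Sum>\<xi>\<in>F. ?h \<xi> / of_real ?V * wave \<xi> x)))\<^sup>2" lebesgue "cube L :: 'a set"]
    by simp
  then show ?thesis by (simp add: cos_sine_coeff_eq_wave_coeff[OF assms(2)])
qed

text \<open>
  A partial Fourier sum is at least as close to \<open>f\<close> in the mean square as a uniformly close
  trigonometric polynomial with the same frequencies.
\<close>

lemma Fourier_completeness_real:
  fixes f :: "'a::euclidean_space \<Rightarrow> real"
  assumes "L > 0" "continuous_on (cube L) f" "\<And>x. x \<notin> interior (cube L) \<Longrightarrow> f x = 0" "e > 0"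
  shows "\<exists>F. finite F \<and> F \<subseteq> frequencies L \<and>
     measure lebesgue (cube L :: 'a set) * (LINT x|lebesgue_on (cube L). (f x)\<^sup>2)
     \<le> (\<Sum>\<xi>\<in>F. (cosine_coeff L f \<xi>)\<^sup>2 + (sine_coeff L f \<xi>)\<^sup>2) + e"
proof -
  let ?M = "lebesgue_on (cube L :: 'a set)"
  let ?V = "measure lebesgue (cube L :: 'a set)"
  let ?h = "\<lambda>\<xi>. (LINT x|lebesgue_on (cube L). cnj (wave \<xi> x) * of_real (f x))"
  have V: "?V > 0" by (rule measure_cube_pos[OF assms(1)])
  \<comment> \<open>A uniform error \<open>d\<close> costs \<open>?V * (?V * d\<^sup>2) = e\<close>.\<close>
  define d where "d = sqrt e / ?V"
  have d: "d > 0" using V assms(4) by (simp add: d_def)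
  from trig_poly_dense[OF assms(1-3) d] obtain p where p: "trig_poly L p" "\<And>x. x\<in>cube L \<Longrightarrow> cmod (of_real (f x) - p x) < d"
    by blast
  from trig_poly_sum_form[OF p(1)] obtain F a where F: "finite F" "F \<subseteq> frequencies L" "p = (\<lambda>x. \<Sum>\<xi>\<in>F. a \<xi> * wave \<xi> x)" by blast
  have c: "continuous_on (cube L) (\<lambda>x. (cmod (of_real (f x) - p x))\<^sup>2)"
    unfolding F(3) by (intro continuous_intros continuous_on_wave assms)
  have "(LINT x|?M. (cmod (of_real (f x) - p x))\<^sup>2) \<le> (LINT x|?M. d\<^sup>2)"
    by (rule integral_mono) (auto intro!: integrable_on_cube c less_imp_le[OF p(2)] power_mono)
  also have "\<dots> = ?V * d\<^sup>2" by (simp add: measure_restrict_space cube_sets)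
  finally have "?V * (LINT x|?M. (cmod (of_real (f x) - p x))\<^sup>2) \<le> ?V * (?V * d\<^sup>2)"
    by (rule mult_left_mono) (use V in simp)
  also have "\<dots> = e" using V assms(4) by (simp add: d_def power_divide power2_eq_square)
  finally have "?V * (LINT x|?M. (f x)\<^sup>2) - (\<Sum>\<xi>\<in>F. (cmod (?h \<xi>))\<^sup>2) \<le> e"
    using L2_distance_trig_sum[OF assms(1,2) F(1,2), of a] sum_nonneg[of F "\<lambda>\<xi>. (cmod (of_real ?V * a \<xi> - ?h \<xi>))\<^sup>2"]
    unfolding F(3) by simp
  then show ?thesis using F
    by (intro exI[of _ F]) (simp add: cos_sine_coeff_eq_wave_coeff[OF assms(2)])
qed

lemma coeff_inner:
  fixes f :: "'a::euclidean_space \<Rightarrow> 'b::euclidean_space"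
  assumes "continuous_on (cube L) f"
  shows "cosine_coeff L f \<xi> \<bullet> b = cosine_coeff L (\<lambda>x. f x \<bullet> b) \<xi>" "sine_coeff L f \<xi> \<bullet> b = sine_coeff L (\<lambda>x. f x \<bullet> b) \<xi>"
proof -
  have i: "integrable (lebesgue_on (cube L)) (\<lambda>x. cos (\<xi> \<bullet> x) *\<^sub>R f x)" "integrable (lebesgue_on (cube L)) (\<lambda>x. sin (\<xi> \<bullet> x) *\<^sub>R f x)"
    by (intro integrable_on_cube continuous_intros assms)+
  show "cosine_coeff L f \<xi> \<bullet> b = cosine_coeff L (\<lambda>x. f x \<bullet> b) \<xi>" "sine_coeff L f \<xi> \<bullet> b = sine_coeff L (\<lambda>x. f x \<bullet> b) \<xi>"
    unfolding cosine_coeff_def sine_coeff_def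
    by (subst integral_inner_left[symmetric]; simp add: i)+
qed

lemma norm_sq_sum_Basis: "(norm (v::'b::euclidean_space))\<^sup>2 = (\<Sum>b\<in>Basis. (v \<bullet> b)\<^sup>2)"
  unfolding power2_norm_eq_inner by (subst euclidean_inner) (simp add: power2_eq_square)

lemma integral_norm_sq_sum_Basis:
  fixes f :: "'a::euclidean_space \<Rightarrow> 'b::euclidean_space"
  assumes "continuous_on (cube L) f"
  shows "(LINT x|lebesgue_on (cube L). (norm (f x))\<^sup>2) = (\<Sum>b\<in>Basis. LINT x|lebesgue_on (cube L). (f x \<bullet> b)\<^sup>2)"
  unfolding norm_sq_sum_Basis
  by (intro Bochner_Integration.integral_sum integrable_on_cube continuous_intros assms)

lemma Bessel:
  fixes f :: "'a::euclidean_space \<Rightarrow> 'b::euclidean_space"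
  assumes "L > 0" "continuous_on (cube L) f" "finite F" "F \<subseteq> frequencies L"
  shows "(\<Sum>\<xi>\<in>F. (norm (cosine_coeff L f \<xi>))\<^sup>2 + (norm (sine_coeff L f \<xi>))\<^sup>2)
     \<le> measure lebesgue (cube L :: 'a set) * (LINT x|lebesgue_on (cube L). (norm (f x))\<^sup>2)"
proof -
  have "(\<Sum>\<xi>\<in>F. (norm (cosine_coeff L f \<xi>))\<^sup>2 + (norm (sine_coeff L f \<xi>))\<^sup>2) =
     (\<Sum>b\<in>Basis. \<Sum>\<xi>\<in>F. (cosine_coeff L (\<lambda>x. f x \<bullet> b) \<xi>)\<^sup>2 + (sine_coeff L (\<lambda>x. f x \<bullet> b) \<xi>)\<^sup>2)"
    unfolding norm_sq_sum_Basis coeff_inner[OF assms(2)] sum.distrib[symmetric] by (rule sum.swap)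
  also have "\<dots> \<le> (\<Sum>b\<in>(Basis::'b set). measure lebesgue (cube L :: 'a set) * (LINT x|lebesgue_on (cube L). (f x \<bullet> b)\<^sup>2))"
    by (intro sum_mono Bessel_real assms continuous_intros)
  finally show ?thesis
    by (simp add: integral_norm_sq_sum_Basis[OF assms(2)] sum_distrib_left)
qed

lemma Fourier_completeness:
  fixes f :: "'a::euclidean_space \<Rightarrow> 'b::euclidean_space"
  assumes "L > 0" "continuous_on (cube L) f" "\<And>x. x \<notin> interior (cube L) \<Longrightarrow> f x = 0" "e > 0"
  shows "\<exists>F. finite F \<and> F \<subseteq> frequencies L \<and>
     measure lebesgue (cube L :: 'a set) * (LINT x|lebesgue_on (cube L). (norm (f x))\<^sup>2)
     \<le> (\<Sum>\<xi>\<in>F. (norm (cosine_coeff L f \<xi>))\<^sup>2 + (norm (sine_coeff L f \<xi>))\<^sup>2) + e"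
proof -
  let ?c = "\<lambda>b \<xi>. (cosine_coeff L (\<lambda>x. f x \<bullet> b) \<xi>)\<^sup>2 + (sine_coeff L (\<lambda>x. f x \<bullet> b) \<xi>)\<^sup>2"
  let ?d = "e / DIM('b)"
  have "\<forall>b\<in>Basis. \<exists>F. finite F \<and> F \<subseteq> frequencies L \<and>
     measure lebesgue (cube L :: 'a set) * (LINT x|lebesgue_on (cube L). (f x \<bullet> b)\<^sup>2) \<le> (\<Sum>\<xi>\<in>F. ?c b \<xi>) + ?d"
    by (rule ballI, rule Fourier_completeness_real)
       (use assms in \<open>auto intro!: continuous_intros\<close>)
  from bchoice[OF this] obtain F where F: "\<And>b. b \<in> Basis \<Longrightarrow> finite (F b) \<and> F b \<subseteq> frequencies L \<and>
     measure lebesgue (cube L :: 'a set) * (LINT x|lebesgue_on (cube L). (f x \<bullet> b)\<^sup>2) \<le> (\<Sum>\<xi>\<in>F b. ?c b \<xi>) + ?d"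
    by blast
  define G where "G = (\<Union>b\<in>Basis. F b)"
  have G: "finite G" "G \<subseteq> frequencies L" using F by (auto simp: G_def)
  have "measure lebesgue (cube L :: 'a set) * (LINT x|lebesgue_on (cube L). (norm (f x))\<^sup>2) =
     (\<Sum>b\<in>(Basis::'b set). measure lebesgue (cube L :: 'a set) * (LINT x|lebesgue_on (cube L). (f x \<bullet> b)\<^sup>2))"
    by (simp add: integral_norm_sq_sum_Basis[OF assms(2)] sum_distrib_left)
  also have "\<dots> \<le> (\<Sum>b\<in>Basis. (\<Sum>\<xi>\<in>G. ?c b \<xi>) + ?d)"
  proof (rule sum_mono)
    fix b :: 'b assume b: "b \<in> Basis"
    have "(\<Sum>\<xi>\<in>F b. ?c b \<xi>) \<le> (\<Sum>\<xi>\<in>G. ?c b \<xi>)"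
      using G(1) b by (intro sum_mono2) (auto simp: G_def)
    with F[OF b] show "measure lebesgue (cube L :: 'a set) * (LINT x|lebesgue_on (cube L). (f x \<bullet> b)\<^sup>2) \<le> (\<Sum>\<xi>\<in>G. ?c b \<xi>) + ?d"
      by linarith
  qed
  also have "\<dots> = (\<Sum>b\<in>Basis. \<Sum>\<xi>\<in>G. ?c b \<xi>) + e" by (simp add: sum.distrib)
  also have "(\<Sum>b\<in>Basis. \<Sum>\<xi>\<in>G. ?c b \<xi>) = (\<Sum>\<xi>\<in>G. (norm (cosine_coeff L f \<xi>))\<^sup>2 + (norm (sine_coeff L f \<xi>))\<^sup>2)"
    unfolding norm_sq_sum_Basis coeff_inner[OF assms(2)] sum.distrib[symmetric] by (rule sum.swap)
  finally show ?thesis using G by blast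
qed

section \<open>Integration by parts for the curl\<close>

lemma integral_lborel_translate:
  fixes f :: "'a::euclidean_space \<Rightarrow> real"
  assumes [measurable]: "f \<in> borel_measurable borel"
  shows "(LINT x|lborel. f (x + c)) = (LINT x|lborel. f x)"
proof -
  have "(LINT x|lborel. f x) = (LINT x|distr lborel borel ((+) c). f x)" by (simp add: lborel_distr_plus)
  also have "\<dots> = (LINT x|lborel. f (c + x))" by (rule integral_distr) auto
  finally show ?thesis by (simp add: add.commute)
qed

lemma integrable_lborel_bounded_support:
  fixes f :: "'a::euclidean_space \<Rightarrow> 'b::euclidean_space"
  assumes "continuous_on UNIV f" "\<And>x. norm x > R \<Longrightarrow> f x = 0"
  shows "integrable lborel f"
proof -
  have "integrable lborel (\<lambda>x. indicator (cball 0 R) x *\<^sub>R f x)"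
    by (rule borel_integrable_compact) (auto intro: continuous_on_subset[OF assms(1)])
  also have "(\<lambda>x. indicator (cball 0 R) x *\<^sub>R f x) = f"
    using assms(2) by (auto simp: fun_eq_iff indicator_def not_le)
  finally show ?thesis .
qed

lemma bounded_of_bounded_support:
  fixes f :: "'a::euclidean_space \<Rightarrow> 'b::euclidean_space"
  assumes "continuous_on UNIV f" "\<And>x. norm x > R \<Longrightarrow> f x = 0"
  shows "\<exists>C\<ge>0. \<forall>x. norm (f x) \<le> C"
proof -
  have "bounded (f ` cball 0 R)"
    by (intro compact_imp_bounded compact_continuous_image continuous_on_subset[OF assms(1)]) auto
  then obtain C where C: "\<And>x. x \<in> cball 0 R \<Longrightarrow> norm (f x) \<le> C" unfolding bounded_iff by blast
  have "norm (f x) \<le> max C 0" for x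
    using C[of x] assms(2)[of x] by (cases "norm x > R") auto
  then show ?thesis by (intro exI[of _ "max C 0"]) auto
qed

lemma has_derivative_zero_on_open:
  assumes "open U" "x \<in> U" "\<And>y. y \<in> U \<Longrightarrow> f y = 0" "(f has_derivative f') (at x)"
  shows "f' h = 0"
proof -
  have "((\<lambda>_. 0) has_derivative f') (at x)"
    by (rule has_derivative_transform_within_open[OF assms(4,1,2)]) (simp add: assms(3))
  then have "f' = (\<lambda>_. 0)" using has_derivative_unique[OF _ has_derivative_const] by blast
  then show ?thesis by simp
qed

lemma open_norm_greater: "open {x::'a::real_normed_vector. norm x > R}"
  by (intro open_Collect_less continuous_intros)

text \<open>
  By translation invariance the difference quotients of \<open>F\<close> have integral zero, and they converge to
  the directional derivative with a common bound on a common bounded support.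
\<close>

lemma integral_directional_derivative_zero:
  fixes F :: "'a::euclidean_space \<Rightarrow> real"
  assumes der: "\<And>x. (F has_derivative F' x) (at x)"
    and cont: "continuous_on UNIV (\<lambda>x. F' x v)"
    and supp: "\<And>x. norm x > R \<Longrightarrow> F x = 0"
  shows "(LINT x|lborel. F' x v) = 0"
proof -
  have contF: "continuous_on UNIV F"
    by (rule has_derivative_continuous_on[OF has_derivative_at_withinI[OF der]])
  have F'0: "F' x v = 0" if "norm x > R" for x
    using has_derivative_zero_on_open[OF open_norm_greater _ _ der, of x R] that supp by blast
  obtain C where C: "C \<ge> 0" "\<And>x. \<bar>F' x v\<bar> \<le> C"
    using bounded_of_bounded_support[OF cont F'0] by auto
  define q where "q n x = real (Suc n) * (F (x + (1 / real (Suc n)) *\<^sub>R v) - F x)" for n x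
  have meas: "F \<in> borel_measurable borel" by (rule borel_measurable_continuous_onI[OF contF])
  have shift: "continuous_on UNIV (\<lambda>x. F (x + c))" for c
    by (rule continuous_on_compose2[OF contF]) (auto intro: continuous_intros)
  have [measurable]: "q n \<in> borel_measurable borel" for n
  proof -
    have "continuous_on UNIV (q n)" unfolding q_def by (intro continuous_intros shift contF)
    then show ?thesis by (rule borel_measurable_continuous_onI)
  qed
  have intq: "(LINT x|lborel. q n x) = 0" for n
  proof -
    have i: "integrable lborel (\<lambda>x. F (x + (1 / real (Suc n)) *\<^sub>R v))"
    proof (rule integrable_lborel_bounded_support)
      fix x :: 'a assume "norm x > R + norm v"
      moreover have "norm ((1 / real (Suc n)) *\<^sub>R v) \<le> norm v"
        using mult_left_le_one_le[of "norm v" "1 / real (Suc n)"] by simp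
      ultimately have "norm (x + (1 / real (Suc n)) *\<^sub>R v) > R"
        using norm_diff_ineq[of x "(1 / real (Suc n)) *\<^sub>R v"] by linarith
      then show "F (x + (1 / real (Suc n)) *\<^sub>R v) = 0" by (rule supp)
    qed (rule shift)
    have "(LINT x|lborel. q n x) = real (Suc n) * ((LINT x|lborel. F (x + (1 / real (Suc n)) *\<^sub>R v)) - (LINT x|lborel. F x))"
      unfolding q_def using i integrable_lborel_bounded_support[OF contF supp] by simp
    then show ?thesis by (simp add: integral_lborel_translate[OF meas])
  qed
  have "(\<lambda>n. LINT x|lborel. q n x) \<longlonglongrightarrow> (LINT x|lborel. F' x v)"
  proof (rule integral_dominated_convergence)
    show "(\<lambda>x. F' x v) \<in> borel_measurable lborel" using borel_measurable_continuous_onI[OF cont] by simp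
    show "integrable lborel (\<lambda>x. indicator (cball 0 (R + norm v)) x *\<^sub>R C)"
      by (rule borel_integrable_compact) auto
    show "AE x in lborel. (\<lambda>n. q n x) \<longlonglongrightarrow> F' x v"
    proof (rule AE_I2)
      fix x
      have "((\<lambda>t. F (x + t *\<^sub>R v)) has_derivative (\<lambda>t. F' x (t *\<^sub>R v))) (at 0)"
        by (rule has_derivative_compose[of "\<lambda>t. x + t *\<^sub>R v" _ 0 UNIV F]) (auto intro!: derivative_eq_intros der)
      moreover have "(\<lambda>t. F' x (t *\<^sub>R v)) = (\<lambda>t. t * F' x v)"
        using has_derivative_linear[OF der[of x]] by (auto simp: linear_cmul)
      ultimately have "((\<lambda>t. F (x + t *\<^sub>R v)) has_field_derivative F' x v) (at 0)"
        by (simp add: has_field_derivative_def mult.commute[of _ "F' x v"])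
      then have "((\<lambda>t. (F (x + t *\<^sub>R v) - F x) / t) \<longlongrightarrow> F' x v) (at 0)"
        by (simp add: DERIV_def)
      moreover have "filterlim (\<lambda>n. 1 / real (Suc n)) (at 0) sequentially"
        using LIMSEQ_Suc[OF lim_1_over_n[where 'a=real]] by (auto simp: filterlim_at simp del: of_nat_Suc)
      ultimately have "((\<lambda>n. (F (x + (1 / real (Suc n)) *\<^sub>R v) - F x) / (1 / real (Suc n))) \<longlongrightarrow> F' x v) sequentially"
        by (rule filterlim_compose)
      then show "(\<lambda>n. q n x) \<longlonglongrightarrow> F' x v" by (simp add: q_def mult.commute)
    qed
    show "AE x in lborel. norm (q n x) \<le> indicator (cball 0 (R + norm v)) x *\<^sub>R C" for n
    proof (rule AE_I2)
      fix x
      define h where "h = 1 / real (Suc n)"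
      have h: "h > 0" "h \<le> 1" by (auto simp: h_def)
      show "norm (q n x) \<le> indicator (cball 0 (R + norm v)) x *\<^sub>R C"
      proof (cases "norm x > R + norm v")
        case True
        have "norm (h *\<^sub>R v) \<le> norm v" using h by (simp add: mult_left_le_one_le)
        with True norm_diff_ineq[of x "h *\<^sub>R v"] have "norm (x + h *\<^sub>R v) > R" by linarith
        moreover have "norm x > R" using True norm_ge_zero[of v] by linarith
        ultimately show ?thesis using supp True by (simp add: q_def h_def)
      next
        case False
        have "\<exists>t\<in>{0<..<h}. F (x + h *\<^sub>R v) - F (x + 0 *\<^sub>R v) = F' (x + t *\<^sub>R v) ((h - 0) *\<^sub>R v)"
        proof (rule mvt_simple[OF h(1)])
          show "((\<lambda>t. F (x + t *\<^sub>R v)) has_derivative (\<lambda>s. F' (x + t *\<^sub>R v) (s *\<^sub>R v))) (at t within {0..h})" for t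
            by (rule has_derivative_compose[of "\<lambda>t. x + t *\<^sub>R v" _ t "{0..h}" F]) (auto intro!: derivative_eq_intros der)
        qed
        then obtain t where "F (x + h *\<^sub>R v) - F x = F' (x + t *\<^sub>R v) (h *\<^sub>R v)" by auto
        also have "\<dots> = h * F' (x + t *\<^sub>R v) v"
          using has_derivative_linear[OF der] by (simp add: linear_cmul)
        finally have "q n x = F' (x + t *\<^sub>R v) v" by (simp add: q_def h_def)
        then show ?thesis using C(2) False by simp
      qed
    qed
  qed simp
  then show ?thesis by (simp add: intq LIMSEQ_const_iff)
qed

definition C1_field :: "(real^3 \<Rightarrow> real^3) \<Rightarrow> bool" where
  "C1_field \<phi> \<longleftrightarrow> (\<forall>x. \<phi> differentiable (at x)) \<and> (\<forall>v. continuous_on UNIV (\<lambda>x. frechet_derivative \<phi> (at x) v))"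

lemma C1_field_derivative:
  "C1_field \<phi> \<Longrightarrow> (\<phi> has_derivative frechet_derivative \<phi> (at x)) (at x)"
  unfolding C1_field_def using frechet_derivative_works by blast

lemma C1_field_continuous: "C1_field \<phi> \<Longrightarrow> continuous_on UNIV \<phi>"
  unfolding C1_field_def by (auto intro!: differentiable_imp_continuous_on simp: differentiable_on_def differentiable_at_imp_differentiable_on)

lemma continuous_on_partial: "C1_field \<phi> \<Longrightarrow> continuous_on UNIV (partial i \<phi>)"
  unfolding C1_field_def partial_def by blast

lemma continuous_on_classical_curl: "C1_field \<phi> \<Longrightarrow> continuous_on UNIV (classical_curl \<phi>)"
proof -
  assume \<phi>: "C1_field \<phi>"
  have "continuous_on UNIV (\<lambda>x. classical_curl \<phi> x $ i)" for i
    using exhaust_3[of i]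
    by (elim disjE; simp add: classical_curl_def; intro continuous_intros continuous_on_partial \<phi>)
  then have "continuous_on UNIV (\<lambda>x. \<chi> i. classical_curl \<phi> x $ i)"
    by (rule continuous_on_vec_lambda)
  then show ?thesis by simp
qed

lemma classical_curl_zero_on_open:
  assumes "open U" "x \<in> U" "\<And>y. y \<in> U \<Longrightarrow> \<phi> y = 0" "C1_field \<phi>"
  shows "classical_curl \<phi> x = 0"
  using has_derivative_zero_on_open[OF assms(1-3) C1_field_derivative[OF assms(4)]]
  by (simp add: classical_curl_def partial_def vec_eq_iff forall_3)

text \<open>
  The difference of the two integrands is the divergence of the cross product of the two fields. The
  auxiliary \<open>G i j\<close> in the proof is the derivative of a component of that cross product.
\<close>

lemma integral_classical_curl_by_parts:
  assumes \<phi>: "C1_field \<phi>" and \<psi>: "C1_field \<psi>" and supp: "\<And>x. norm x > R \<Longrightarrow> \<phi> x = 0"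
  shows "(LINT x|lborel. classical_curl \<phi> x \<bullet> \<psi> x) = (LINT x|lborel. \<phi> x \<bullet> classical_curl \<psi> x)"
proof -
  let ?D = "\<lambda>f x. frechet_derivative f (at x)"
  define G where "G i j x h = (?D \<phi> x h $ i * \<psi> x $ j + \<phi> x $ i * ?D \<psi> x h $ j)
     - (?D \<phi> x h $ j * \<psi> x $ i + \<phi> x $ j * ?D \<psi> x h $ i)" for i j x h
  have comp: "((\<lambda>x. f x $ i) has_derivative (\<lambda>h. ?D f x h $ i)) (at x)" if "C1_field f" for f x i
    using bounded_linear.has_derivative[OF bounded_linear_vec_nth C1_field_derivative[OF that]] .
  have der: "((\<lambda>x. \<phi> x $ i * \<psi> x $ j - \<phi> x $ j * \<psi> x $ i) has_derivative G i j x) (at x)" for i j x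
    unfolding G_def
    by (rule derivative_eq_intros comp \<phi> \<psi> refl)+ (simp add: fun_eq_iff algebra_simps)
  have contD: "continuous_on UNIV (\<lambda>x. ?D f x v)" if "C1_field f" for f v
    using that by (simp add: C1_field_def)
  have contG: "continuous_on UNIV (\<lambda>x. G i j x v)" for i j v
    unfolding G_def by (intro continuous_intros contD C1_field_continuous \<phi> \<psi>)
  have z: "(LINT x|lborel. G i j x v) = 0" for i j v
    by (rule integral_directional_derivative_zero[OF der contG, of R]) (simp add: supp)
  have D0: "?D \<phi> x v = 0" if "norm x > R" for x v
    using has_derivative_zero_on_open[OF open_norm_greater _ _ C1_field_derivative[OF \<phi>], of x R] that supp by blast
  have G0: "G i j x v = 0" if "norm x > R" for i j x v
    using that by (simp add: G_def supp D0)
  have iG: "integrable lborel (\<lambda>x. G i j x v)" for i j v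
    by (rule integrable_lborel_bounded_support[OF contG G0])
  have curl0: "classical_curl \<phi> x = 0" if "norm x > R" for x
    using classical_curl_zero_on_open[OF open_norm_greater _ _ \<phi>, of x R] that supp by blast
  note cont = C1_field_continuous[OF \<phi>] C1_field_continuous[OF \<psi>]
    continuous_on_classical_curl[OF \<phi>] continuous_on_classical_curl[OF \<psi>]
  from curl0 have i1: "integrable lborel (\<lambda>x. classical_curl \<phi> x \<bullet> \<psi> x)"
    by (intro integrable_lborel_bounded_support[of _ R] continuous_intros cont) simp
  have i2: "integrable lborel (\<lambda>x. \<phi> x \<bullet> classical_curl \<psi> x)"
    by (intro integrable_lborel_bounded_support[of _ R] continuous_intros cont) (simp add: supp)
  have pt: "classical_curl \<phi> x \<bullet> \<psi> x - \<phi> x \<bullet> classical_curl \<psi> x =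
     G 2 3 x (axis 1 1) + G 3 1 x (axis 2 1) + G 1 2 x (axis 3 1)" for x
    by (simp add: classical_curl_def partial_def G_def inner_vec_def sum_3 algebra_simps)
  have "(LINT x|lborel. classical_curl \<phi> x \<bullet> \<psi> x) - (LINT x|lborel. \<phi> x \<bullet> classical_curl \<psi> x) =
    (LINT x|lborel. G 2 3 x (axis 1 1) + G 3 1 x (axis 2 1) + G 1 2 x (axis 3 1))"
    using i1 i2 by (simp flip: pt)
  also have "\<dots> = 0" by (simp add: iG z)
  finally show ?thesis by simp
qed

section \<open>The curl in terms of Fourier coefficients\<close>

definition cross_rows :: "real^3 \<Rightarrow> real^3^3 \<Rightarrow> real^3^3" where
  "cross_rows \<xi> A = (\<chi> i. cross3 \<xi> (A $ i))"

lemma norm_sq_rows: "(norm (A::real^'n^'m))\<^sup>2 = (\<Sum>i\<in>UNIV. (norm (A $ i))\<^sup>2)"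
  unfolding power2_norm_eq_inner inner_vec_def[of A A] ..

lemma norm_sq_matrix3:
  "(norm (A::real^3^3))\<^sup>2 = (A$1$1)\<^sup>2 + (A$1$2)\<^sup>2 + (A$1$3)\<^sup>2 + (A$2$1)\<^sup>2 + (A$2$2)\<^sup>2 + (A$2$3)\<^sup>2 + (A$3$1)\<^sup>2 + (A$3$2)\<^sup>2 + (A$3$3)\<^sup>2"
  unfolding power2_norm_eq_inner inner_vec_def sum_3 by (simp add: power2_eq_square)

lemma linear_sym_part: "linear sym_part"
  by (rule linearI) (simp_all add: sym_part_def transpose_def vec_eq_iff algebra_simps)

lemma linear_cross_rows: "linear (cross_rows \<xi>)"
  by (rule linearI) (simp_all add: cross_rows_def vec_eq_iff cross_add_right cross_mult_right)

lemma norm_cross_rows_le: "(norm (cross_rows \<xi> A))\<^sup>2 \<le> (norm \<xi>)\<^sup>2 * (norm A)\<^sup>2"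
proof -
  have "(norm (cross3 \<xi> v))\<^sup>2 \<le> (norm \<xi>)\<^sup>2 * (norm v)\<^sup>2" for v
    using norm_cross_dot[of \<xi> v] zero_le_power2[of "\<xi> \<bullet> v"] unfolding power_mult_distrib by linarith
  then show ?thesis unfolding norm_sq_rows sum_distrib_left
    by (intro sum_mono) (simp add: cross_rows_def)
qed

text \<open>
  In terms of the axial vector \<open>w\<close> of \<open>W\<close> one has \<open>\<bar>W\<bar>\<^sup>2 = 2 \<bar>w\<bar>\<^sup>2\<close>, and
  \<open>\<bar>\<xi> \<times> W\<bar>\<^sup>2 = \<bar>\<xi>\<bar>\<^sup>2 \<bar>w\<bar>\<^sup>2 + (\<xi> \<bullet> w)\<^sup>2\<close>.
\<close>

lemma norm_skew_le_cross_rows: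
  fixes W :: "real^3^3"
  assumes "transpose W = - W"
  shows "(norm \<xi>)\<^sup>2 * (norm W)\<^sup>2 \<le> 2 * (norm (cross_rows \<xi> W))\<^sup>2"
proof -
  have "W $ i $ j = - W $ j $ i" for i j
    using arg_cong[OF assms, of "\<lambda>M. M $ j $ i"] by (simp add: transpose_def)
  note W = this[of 2 1] this[of 3 1] this[of 3 2] this[of 1 1] this[of 2 2] this[of 3 3]
  have d: "W$1$1 = 0" "W$2$2 = 0" "W$3$3 = 0" using W by simp_all
  \<comment> \<open>Up to sign and order these are the components of the axial vector.\<close>
  define a b c where "a = W$1$2" and "b = W$1$3" and "c = W$2$3"
  have "2 * (norm (cross_rows \<xi> W))\<^sup>2 - (norm \<xi>)\<^sup>2 * (norm W)\<^sup>2 = 2 * (c * \<xi>$1 - b * \<xi>$2 + a * \<xi>$3)\<^sup>2"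
    unfolding norm_sq_matrix3 power2_norm_eq_inner[of \<xi>] inner_vec_def sum_3
    by (simp add: cross_rows_def cross_components W(1-3) d a_def[symmetric] b_def[symmetric] c_def[symmetric])
       (simp add: power2_eq_square algebra_simps)
  then show ?thesis by (smt (verit) zero_le_power2)
qed

text \<open>
  The algebraic core of the estimate. Symmetric and skew part are orthogonal, and the skew part is
  controlled by its cross product with \<open>\<xi>\<close>, which differs from that of \<open>A\<close> by a term bounded by the
  symmetric part.
\<close>

lemma norm_le_sym_part_cross_rows:
  "(norm \<xi>)\<^sup>2 * (norm A)\<^sup>2 \<le> 5 * ((norm \<xi>)\<^sup>2 * (norm (sym_part A))\<^sup>2) + 4 * (norm (cross_rows \<xi> A))\<^sup>2"
proof -
  define S W where "S = sym_part A" and "W = A - sym_part A"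
  have W: "transpose W = - W"
    by (simp add: W_def sym_part_def transpose_def vec_eq_iff field_simps)
  have A: "(norm A)\<^sup>2 = (norm S)\<^sup>2 + (norm W)\<^sup>2"
    unfolding norm_sq_matrix3 S_def W_def
    by (simp add: sym_part_def transpose_def) (simp add: power2_eq_square field_simps)
  have "cross_rows \<xi> W = cross_rows \<xi> A - cross_rows \<xi> S"
    unfolding W_def S_def by (rule linear_diff[OF linear_cross_rows])
  then have "(norm (cross_rows \<xi> W))\<^sup>2 \<le> 2 * (norm (cross_rows \<xi> A))\<^sup>2 + 2 * (norm (cross_rows \<xi> S))\<^sup>2"
    using norm_triangle_ineq4[of "cross_rows \<xi> A" "cross_rows \<xi> S"]
      sum_squares_ge_zero sum_squares_bound[of "norm (cross_rows \<xi> A)" "norm (cross_rows \<xi> S)"]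
      power_mono[of "norm (cross_rows \<xi> W)" "norm (cross_rows \<xi> A) + norm (cross_rows \<xi> S)" 2]
    by (simp add: power2_sum)
  with norm_skew_le_cross_rows[OF W, of \<xi>] norm_cross_rows_le[of \<xi> S]
  show ?thesis unfolding A S_def[symmetric] by (simp add: algebra_simps)
qed

lemma cball_subset_cube: "pi * L > R \<Longrightarrow> norm x \<le> R \<Longrightarrow> x \<in> interior (cube L)"
proof -
  assume R: "pi * L > R" "norm x \<le> R"
  have "ball 0 (pi * L) \<subseteq> cube L"
    by (auto simp: cube_def intro: order.trans[OF Basis_le_norm])
  then have "ball 0 (pi * L) \<subseteq> interior (cube L)" by (rule interior_maximal) simp
  then show ?thesis using R by auto
qed

lemma coeff_eq_lborel:
  fixes f :: "'a::euclidean_space \<Rightarrow> 'b::euclidean_space"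
  assumes "continuous_on UNIV f" "\<forall>x. norm x > R \<longrightarrow> f x = 0" "pi * L > R"
  shows "cosine_coeff L f \<xi> = (LINT x|lborel. cos (\<xi> \<bullet> x) *\<^sub>R f x)"
    and "sine_coeff L f \<xi> = (LINT x|lborel. sin (\<xi> \<bullet> x) *\<^sub>R f x)"
    and "integrable lborel (\<lambda>x. cos (\<xi> \<bullet> x) *\<^sub>R f x)"
    and "integrable lborel (\<lambda>x. sin (\<xi> \<bullet> x) *\<^sub>R f x)"
proof -
  have z: "f x = 0" if "x \<notin> cube L" for x
    using cball_subset_cube[OF assms(3), of x] that assms(2) interior_subset[of "cube L"] by (meson linorder_not_le subsetD)
  show "cosine_coeff L f \<xi> = (LINT x|lborel. cos (\<xi> \<bullet> x) *\<^sub>R f x)"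
    "sine_coeff L f \<xi> = (LINT x|lborel. sin (\<xi> \<bullet> x) *\<^sub>R f x)"
    unfolding cosine_coeff_def sine_coeff_def
    by (rule lebesgue_on_eq_lborel; (intro cube_sets borel_measurable_continuous_onI continuous_intros assms)?; simp add: z)+
  show "integrable lborel (\<lambda>x. cos (\<xi> \<bullet> x) *\<^sub>R f x)" "integrable lborel (\<lambda>x. sin (\<xi> \<bullet> x) *\<^sub>R f x)"
    by (rule integrable_lborel_bounded_support[of _ R]; (intro continuous_intros assms)?; simp add: assms)+
qed

text \<open>
  Stated for a scalar function with gradient \<open>g' x *\<^sub>R \<xi>\<close>, in order to cover both cosine and sine
  waves.
\<close>

lemma C1_field_scalar_derivative:
  fixes g :: "real^3 \<Rightarrow> real"
  assumes "\<And>x. (g has_derivative (\<lambda>h. g' x * (\<xi> \<bullet> h))) (at x)" "continuous_on UNIV g'"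
  shows "C1_field (\<lambda>x. g x *\<^sub>R c)" "classical_curl (\<lambda>x. g x *\<^sub>R c) x = g' x *\<^sub>R (cross3 \<xi> c)"
proof -
  have d: "((\<lambda>x. g x *\<^sub>R c) has_derivative (\<lambda>h. (g' x * (\<xi> \<bullet> h)) *\<^sub>R c)) (at x)" for x
    using has_derivative_scaleR_left[OF assms(1)] .
  have fd: "frechet_derivative (\<lambda>x. g x *\<^sub>R c) (at x) = (\<lambda>h. (g' x * (\<xi> \<bullet> h)) *\<^sub>R c)" for x
    using frechet_derivative_at[OF d] by simp
  show "C1_field (\<lambda>x. g x *\<^sub>R c)"
    unfolding C1_field_def fd using d differentiable_def
    by (auto intro!: continuous_intros assms)
  show "classical_curl (\<lambda>x. g x *\<^sub>R c) x = g' x *\<^sub>R (cross3 \<xi> c)"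
    by (simp add: classical_curl_def partial_def fd vec_eq_iff forall_3 cross_components inner_axis algebra_simps)
qed

text \<open>
  Integration by parts moves the curl onto the wave; this uses that the field vanishes
  near the faces of the cube, so that no boundary term appears.
\<close>

lemma coeff_classical_curl:
  assumes \<phi>: "C1_field \<phi>" "\<forall>x. norm x > R \<longrightarrow> \<phi> x = 0" "pi * L > R"
  shows "cosine_coeff L (classical_curl \<phi>) \<xi> = cross3 \<xi> (sine_coeff L \<phi> \<xi>)"
    and "sine_coeff L (classical_curl \<phi>) \<xi> = - cross3 \<xi> (cosine_coeff L \<phi> \<xi>)"
proof -
  have curl0: "\<forall>x. norm x > R \<longrightarrow> classical_curl \<phi> x = 0"
    using classical_curl_zero_on_open[OF open_norm_greater _ _ \<phi>(1), of _ R] \<phi>(2) by blast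
  note e1 = coeff_eq_lborel[where L=L and \<xi>=\<xi>, OF C1_field_continuous[OF \<phi>(1)] \<phi>(2,3)]
  note e2 = coeff_eq_lborel[where L=L and \<xi>=\<xi>, OF continuous_on_classical_curl[OF \<phi>(1)] curl0 \<phi>(3)]
  have dcos: "((\<lambda>x::real^3. cos (\<xi> \<bullet> x)) has_derivative (\<lambda>h. - sin (\<xi> \<bullet> x) * (\<xi> \<bullet> h))) (at x)"
   and dsin: "((\<lambda>x::real^3. sin (\<xi> \<bullet> x)) has_derivative (\<lambda>h. cos (\<xi> \<bullet> x) * (\<xi> \<bullet> h))) (at x)" for x
    by (auto intro!: derivative_eq_intros)
  have ccos: "continuous_on UNIV (\<lambda>x::real^3. - sin (\<xi> \<bullet> x))" and csin: "continuous_on UNIV (\<lambda>x::real^3. cos (\<xi> \<bullet> x))"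
    by (intro continuous_intros)+
  note ct = C1_field_scalar_derivative[of "\<lambda>x. cos (\<xi> \<bullet> x)" "\<lambda>x. - sin (\<xi> \<bullet> x)", OF dcos ccos]
  note st = C1_field_scalar_derivative[of "\<lambda>x. sin (\<xi> \<bullet> x)" "\<lambda>x. cos (\<xi> \<bullet> x)", OF dsin csin]
  have tri: "v \<bullet> cross3 \<xi> c = - (cross3 \<xi> v \<bullet> c)" for v c :: "real^3"
    by (simp add: cross3_simps)
  have "cosine_coeff L (classical_curl \<phi>) \<xi> \<bullet> c = cross3 \<xi> (sine_coeff L \<phi> \<xi>) \<bullet> c" for c
  proof -
    have "cosine_coeff L (classical_curl \<phi>) \<xi> \<bullet> c = (LINT x|lborel. classical_curl \<phi> x \<bullet> (cos (\<xi> \<bullet> x) *\<^sub>R c))"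
      unfolding e2(1) by (subst integral_inner_left[symmetric]) (simp_all add: e2(3))
    also have "\<dots> = (LINT x|lborel. \<phi> x \<bullet> (- sin (\<xi> \<bullet> x) *\<^sub>R cross3 \<xi> c))"
      by (subst integral_classical_curl_by_parts[OF \<phi>(1) ct(1), of R]) (simp_all add: ct(2) \<phi>(2))
    also have "\<dots> = - (sine_coeff L \<phi> \<xi> \<bullet> cross3 \<xi> c)"
      unfolding e1(2) by (subst integral_inner_left[symmetric]) (simp_all add: e1(4))
    finally show ?thesis by (simp add: tri)
  qed
  then show "cosine_coeff L (classical_curl \<phi>) \<xi> = cross3 \<xi> (sine_coeff L \<phi> \<xi>)"
    using vector_eq_rdot by blast
  have "sine_coeff L (classical_curl \<phi>) \<xi> \<bullet> c = - cross3 \<xi> (cosine_coeff L \<phi> \<xi>) \<bullet> c" for c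
  proof -
    have "sine_coeff L (classical_curl \<phi>) \<xi> \<bullet> c = (LINT x|lborel. classical_curl \<phi> x \<bullet> (sin (\<xi> \<bullet> x) *\<^sub>R c))"
      unfolding e2(2) by (subst integral_inner_left[symmetric]) (simp_all add: e2(4))
    also have "\<dots> = (LINT x|lborel. \<phi> x \<bullet> (cos (\<xi> \<bullet> x) *\<^sub>R cross3 \<xi> c))"
      by (subst integral_classical_curl_by_parts[OF \<phi>(1) st(1), of R]) (simp_all add: st(2) \<phi>(2))
    also have "\<dots> = cosine_coeff L \<phi> \<xi> \<bullet> cross3 \<xi> c"
      unfolding e1(1) by (subst integral_inner_left[symmetric]) (simp_all add: e1(3))
    finally show ?thesis by (simp add: tri)
  qed
  then show "sine_coeff L (classical_curl \<phi>) \<xi> = - cross3 \<xi> (cosine_coeff L \<phi> \<xi>)"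
    using vector_eq_rdot by blast
qed

text \<open>
  A nonzero frequency has a component that is a nonzero integer multiple of \<open>1 / L\<close>.
\<close>

lemma frequency_norm_ge:
  fixes \<xi> :: "'a::euclidean_space"
  assumes "L > 0" "\<xi> \<in> frequencies L" "\<xi> \<noteq> 0"
  shows "1 \<le> L\<^sup>2 * (norm \<xi>)\<^sup>2"
proof -
  from assms(3) obtain b where b: "b \<in> Basis" "\<xi> \<bullet> b \<noteq> 0" by (metis euclidean_all_zero_iff)
  then obtain m where m: "L * (\<xi> \<bullet> b) = of_int m" using assms(2) by (auto simp: frequencies_def elim: Ints_cases)
  then have "m \<noteq> 0" using b assms(1) by auto
  then have "1 \<le> \<bar>of_int m :: real\<bar>" by linarith
  also have "\<dots> \<le> L * norm \<xi>" using m Basis_le_norm[OF b(1), of \<xi>] assms(1)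
    by (metis abs_mult abs_of_pos mult_left_mono less_imp_le)
  finally show ?thesis using power_mono[of 1 "L * norm \<xi>" 2] by (simp add: power_mult_distrib)
qed

section \<open>The estimate for continuously differentiable tensor fields\<close>

text \<open>
  Cauchy-Schwarz against the constant function one. It bounds the mean of a field by its mean square
  and the volume of its support.
\<close>

lemma norm_integral_squared_le:
  fixes f :: "'a \<Rightarrow> 'b::euclidean_space"
  assumes "finite_measure M" "integrable M f" "integrable M (\<lambda>x. (norm (f x))\<^sup>2)"
  shows "(norm (LINT x|M. f x))\<^sup>2 \<le> measure M (space M) * (LINT x|M. (norm (f x))\<^sup>2)"
proof -
  interpret finite_measure M by fact
  let ?V = "measure M (space M)" and ?B = "LINT x|M. (norm (f x))\<^sup>2" and ?a = "LINT x|M. norm (f x)"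
  have q: "2 * t * ?a \<le> t\<^sup>2 * ?V + ?B" for t :: real
  proof -
    have "(LINT x|M. 2 * t * norm (f x)) \<le> (LINT x|M. t\<^sup>2 + (norm (f x))\<^sup>2)"
      by (rule integral_mono) (use assms(2,3) in \<open>auto simp only: sum_squares_bound intro!: integrable_mult_right
        Bochner_Integration.integrable_add integrable_norm integrable_const\<close>)
    then show ?thesis using assms(2,3) by (simp add: algebra_simps)
  qed
  have "?a\<^sup>2 \<le> ?V * ?B"
  proof (cases "?V = 0")
    case True
    have "?a = 0"
    proof (rule ccontr)
      assume "?a \<noteq> 0"
      \<comment> \<open>On a null space the quadratic bound is linear in \<open>t\<close> with a nonzero slope, so it fails for a suitable \<open>t\<close>.\<close>
      then show False using q[of "(?B + 1) / (2 * ?a)"] by (simp add: True)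
    qed
    then show ?thesis by (simp add: True)
  next
    case False
    then have V: "?V > 0" using measure_nonneg[of M "space M"] by linarith
    have "2 * ?a\<^sup>2 / ?V \<le> ?a\<^sup>2 / ?V + ?B"
      using q[of "?a / ?V"] V by (simp add: power2_eq_square field_simps)
    then show ?thesis using V by (simp add: field_simps)
  qed
  moreover have "(norm (LINT x|M. f x))\<^sup>2 \<le> ?a\<^sup>2"
    by (intro power_mono integral_norm_bound) auto
  ultimately show ?thesis by linarith
qed

lemma integrable_lebesgue_on_bounded_support:
  fixes f :: "'a::euclidean_space \<Rightarrow> 'b::euclidean_space"
  assumes "continuous_on UNIV f" "\<forall>x. norm x > R \<longrightarrow> f x = 0" "S \<in> sets lebesgue"
  shows "integrable (lebesgue_on S) f"
proof -
  have "integrable lebesgue f"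
    using integrable_lborel_bounded_support[OF assms(1), of R] assms(2)
    by (simp add: integrable_completion borel_measurable_continuous_onI[OF assms(1)])
  then show ?thesis
    using assms(3) by (simp add: integrable_restrict_space integrable_mult_indicator)
qed

definition classical_Curl :: "(real^3 \<Rightarrow> real^3^3) \<Rightarrow> real^3 \<Rightarrow> real^3^3" where
  "classical_Curl P x = (\<chi> i. classical_curl (\<lambda>y. row i (P y)) x)"

lemma row_eq_nth: "row i A = A $ i"
  by (simp add: row_def vec_eq_iff)

lemma bounded_linear_sym_part: "bounded_linear sym_part"
  using linear_sym_part by (rule linear_conv_bounded_linear[THEN iffD1])

lemma continuous_on_rows:
  assumes "\<And>i. C1_field (\<lambda>x. row i (P x))" shows "continuous_on UNIV P"
proof -
  have "continuous_on UNIV (\<lambda>x. P x $ i)" for i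
    using C1_field_continuous[OF assms[of i]] by (simp add: row_eq_nth)
  then have "continuous_on UNIV (\<lambda>x. \<chi> i. P x $ i)" by (rule continuous_on_vec_lambda)
  then show ?thesis by simp
qed

lemma continuous_on_classical_Curl:
  assumes "\<And>i. C1_field (\<lambda>x. row i (P x))" shows "continuous_on UNIV (classical_Curl P)"
  unfolding classical_Curl_def[abs_def]
  by (intro continuous_on_vec_lambda continuous_on_classical_curl assms)

lemma coeff_bounded_linear:
  fixes f :: "'a::euclidean_space \<Rightarrow> 'b::euclidean_space" and T :: "'b \<Rightarrow> 'c::euclidean_space"
  assumes "continuous_on (cube L) f" "bounded_linear T"
  shows "cosine_coeff L (\<lambda>x. T (f x)) \<xi> = T (cosine_coeff L f \<xi>)"
    "sine_coeff L (\<lambda>x. T (f x)) \<xi> = T (sine_coeff L f \<xi>)"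
proof -
  have i: "integrable (lebesgue_on (cube L)) (\<lambda>x. cos (\<xi> \<bullet> x) *\<^sub>R f x)"
     "integrable (lebesgue_on (cube L)) (\<lambda>x. sin (\<xi> \<bullet> x) *\<^sub>R f x)"
    by (intro integrable_on_cube continuous_intros assms)+
  show "cosine_coeff L (\<lambda>x. T (f x)) \<xi> = T (cosine_coeff L f \<xi>)"
    "sine_coeff L (\<lambda>x. T (f x)) \<xi> = T (sine_coeff L f \<xi>)"
    unfolding cosine_coeff_def sine_coeff_def
    using integral_bounded_linear[OF assms(2) i(1)] integral_bounded_linear[OF assms(2) i(2)]
    by (simp_all add: linear_cmul[OF bounded_linear.linear[OF assms(2)]])
qed

lemma coeff_classical_Curl:
  assumes P: "\<And>i. C1_field (\<lambda>x. row i (P x))" "\<forall>x. norm x > R \<longrightarrow> P x = 0" "pi * L > R"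
  shows "cosine_coeff L (classical_Curl P) \<xi> = cross_rows \<xi> (sine_coeff L P \<xi>)"
    and "sine_coeff L (classical_Curl P) \<xi> = - cross_rows \<xi> (cosine_coeff L P \<xi>)"
proof -
  note comp = coeff_bounded_linear[OF continuous_on_subset[OF _ subset_UNIV] bounded_linear_vec_nth]
  have z: "\<forall>x. norm x > R \<longrightarrow> row i (P x) = 0" for i using P(2) by (simp add: row_eq_nth)
  note c = coeff_classical_curl[OF P(1) z P(3), of _ \<xi>, unfolded row_eq_nth]
  note cP = comp[OF continuous_on_rows[OF P(1)]]
  have Ci: "classical_Curl P x $ i = classical_curl (\<lambda>y. row i (P y)) x" for x i
    by (simp add: classical_Curl_def)
  have "cosine_coeff L (classical_Curl P) \<xi> $ i = cross_rows \<xi> (sine_coeff L P \<xi>) $ i"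
    "sine_coeff L (classical_Curl P) \<xi> $ i = (- cross_rows \<xi> (cosine_coeff L P \<xi>)) $ i" for i
    by (simp_all only: comp[OF continuous_on_classical_Curl[OF P(1)], symmetric] Ci c
         cross_rows_def vec_lambda_beta cP row_eq_nth vector_uminus_component)
  then show "cosine_coeff L (classical_Curl P) \<xi> = cross_rows \<xi> (sine_coeff L P \<xi>)"
    "sine_coeff L (classical_Curl P) \<xi> = - cross_rows \<xi> (cosine_coeff L P \<xi>)"
    by (metis vec_eq_iff)+
qed

text \<open>
  The estimate \<open>norm_le_sym_part_cross_rows\<close> at each nonzero frequency, summed by Parseval's identity,
  together with the absorption of the mean, for which the volume assumption is made.
\<close>

lemma sym_Curl_inequality_C1:
  fixes P :: "real^3 \<Rightarrow> real^3^3"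
  assumes P: "\<And>i. C1_field (\<lambda>x. row i (P x))"
    and S: "S \<in> lmeasurable" "\<And>x. x \<notin> S \<Longrightarrow> P x = 0" "\<And>x. x \<in> S \<Longrightarrow> norm x \<le> R"
    and L: "L > 0" "pi * L > R" "2 * measure lebesgue S \<le> measure lebesgue (cube L :: (real^3) set)"
  shows "(LINT x|lborel. (norm (P x))\<^sup>2) \<le>
     10 * (LINT x|lborel. (norm (sym_part (P x)))\<^sup>2) + 8 * L\<^sup>2 * (LINT x|lborel. (norm (classical_Curl P x))\<^sup>2)"
proof -
  have out: "\<forall>x. norm x > R \<longrightarrow> P x = 0" using S(2,3) by (meson not_le)
  have contP: "continuous_on UNIV P" and contC: "continuous_on UNIV (classical_Curl P)"
    using continuous_on_rows[OF P] continuous_on_classical_Curl[OF P] .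
  have contS: "continuous_on UNIV (\<lambda>x. sym_part (P x))"
    by (rule bounded_linear.continuous_on[OF bounded_linear_sym_part contP])
  note sub = continuous_on_subset[OF _ subset_UNIV]
  let ?V = "measure lebesgue (cube L :: (real^3) set)"
  let ?N = "\<lambda>f::real^3 \<Rightarrow> real^3^3. LINT x|lborel. (norm (f x))\<^sup>2"
  define c where "c f \<xi> = (norm (cosine_coeff L f \<xi>))\<^sup>2 + (norm (sine_coeff L f \<xi>))\<^sup>2" for f :: "real^3 \<Rightarrow> real^3^3" and \<xi>
  have V: "?V > 0" by (rule measure_cube_pos[OF L(1)])
  have N: "(LINT x|lebesgue_on (cube L). (norm (f x))\<^sup>2) = ?N f"
    if "continuous_on UNIV f" "\<forall>x. norm x > R \<longrightarrow> f x = 0" for f :: "real^3 \<Rightarrow> real^3^3"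
  proof (rule lebesgue_on_eq_lborel)
    show "(norm (f x))\<^sup>2 = 0" if "x \<notin> cube L" for x
    proof -
      have "f x = 0"
        using cball_subset_cube[OF L(2), of x] \<open>\<forall>x. norm x > R \<longrightarrow> f x = 0\<close> that interior_subset[of "cube L"]
        by (meson linorder_not_le subsetD)
      then show ?thesis by simp
    qed
  qed (intro cube_sets borel_measurable_continuous_onI continuous_intros that)+
  have outS: "\<forall>x. norm x > R \<longrightarrow> sym_part (P x) = 0"
    using out linear_0[OF linear_sym_part] by simp
  have outC: "\<forall>x. norm x > R \<longrightarrow> classical_Curl P x = 0"
  proof (intro allI impI)
    fix x :: "real^3" assume x: "norm x > R"
    have "classical_curl (\<lambda>y. row i (P y)) x = 0" for i
      by (rule classical_curl_zero_on_open[OF open_norm_greater _ _ P, of x R]) (use x out in \<open>auto simp: row_eq_nth\<close>)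
    then show "classical_Curl P x = 0" by (simp add: classical_Curl_def vec_eq_iff)
  qed
  have zero_freq: "c P 0 \<le> ?V / 2 * ?N P"
  proof -
    have "c P 0 = (norm (LINT x|lebesgue_on (cube L). P x))\<^sup>2"
      by (simp add: c_def cosine_coeff_def sine_coeff_def)
    also have "(LINT x|lebesgue_on (cube L). P x) = (LINT x|lborel. P x)"
    proof (rule lebesgue_on_eq_lborel)
      show "P x = 0" if "x \<notin> cube L" for x
        using cball_subset_cube[OF L(2), of x] out that interior_subset[of "cube L"]
        by (meson linorder_not_le subsetD)
    qed (intro cube_sets borel_measurable_continuous_onI contP)+
    also have "\<dots> = (LINT x|lebesgue_on S. P x)"
      by (rule lebesgue_on_eq_lborel[symmetric]) (use S in \<open>auto intro: borel_measurable_continuous_onI contP\<close>)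
    also have "(norm \<dots>)\<^sup>2 \<le> measure (lebesgue_on S) (space (lebesgue_on S)) * (LINT x|lebesgue_on S. (norm (P x))\<^sup>2)"
    proof (rule norm_integral_squared_le)
      show "finite_measure (lebesgue_on S)" using S(1) by (simp add: finite_measure_lebesgue_on)
      show "integrable (lebesgue_on S) P" "integrable (lebesgue_on S) (\<lambda>x. (norm (P x))\<^sup>2)"
        by (rule integrable_lebesgue_on_bounded_support[of _ R];
            use S(1) contP out in \<open>auto intro!: continuous_intros\<close>)+
    qed
    also have "(LINT x|lebesgue_on S. (norm (P x))\<^sup>2) = ?N P"
      by (rule lebesgue_on_eq_lborel) (use S in \<open>auto intro!: borel_measurable_continuous_onI continuous_intros contP\<close>)
    also have "measure (lebesgue_on S) (space (lebesgue_on S)) = measure lebesgue S"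
      using S(1) by (simp add: measure_restrict_space)
    also have "measure lebesgue S * ?N P \<le> ?V / 2 * ?N P"
      using L(3) by (intro mult_right_mono) auto
    finally show ?thesis .
  qed
  have freq: "c P \<xi> \<le> 5 * c (\<lambda>x. sym_part (P x)) \<xi> + 4 * L\<^sup>2 * c (classical_Curl P) \<xi>"
    if "\<xi> \<in> frequencies L" "\<xi> \<noteq> 0" for \<xi>
  proof -
    have "(norm A)\<^sup>2 \<le> 5 * (norm (sym_part A))\<^sup>2 + 4 * L\<^sup>2 * (norm (cross_rows \<xi> A))\<^sup>2" for A
    proof -
      have p: "(norm \<xi>)\<^sup>2 > 0" using that(2) by simp
      have "1 * (norm (cross_rows \<xi> A))\<^sup>2 \<le> (L\<^sup>2 * (norm \<xi>)\<^sup>2) * (norm (cross_rows \<xi> A))\<^sup>2"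
        by (intro mult_right_mono frequency_norm_ge L that) auto
      with norm_le_sym_part_cross_rows[of \<xi> A]
      have "(norm \<xi>)\<^sup>2 * (norm A)\<^sup>2 \<le> (norm \<xi>)\<^sup>2 * (5 * (norm (sym_part A))\<^sup>2 + 4 * L\<^sup>2 * (norm (cross_rows \<xi> A))\<^sup>2)"
        by (simp add: algebra_simps)
      then show ?thesis using p by (simp only: mult_le_cancel_left_pos)
    qed
    from this[of "cosine_coeff L P \<xi>"] this[of "sine_coeff L P \<xi>"] show ?thesis
      unfolding c_def coeff_bounded_linear[OF sub[OF contP] bounded_linear_sym_part]
        coeff_classical_Curl[OF P out L(2)] norm_minus_cancel by (simp add: algebra_simps)
  qed
  \<comment> \<open>Half of the left-hand side of Parseval's identity pays for the mean.\<close>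
  have "?V / 2 * ?N P \<le> 5 * ?V * ?N (\<lambda>x. sym_part (P x)) + 4 * L\<^sup>2 * ?V * ?N (classical_Curl P)"
  proof (rule field_le_epsilon)
    fix e :: real assume e: "e > 0"
    obtain F where F: "finite F" "F \<subseteq> frequencies L" "?V * ?N P \<le> (\<Sum>\<xi>\<in>F. c P \<xi>) + e"
    proof -
      have "P x = 0" if "x \<notin> interior (cube L)" for x
        using cball_subset_cube[OF L(2), of x] out that by (meson linorder_not_le)
      from Fourier_completeness[OF L(1) sub[OF contP] this e] that show ?thesis
        unfolding c_def N[OF contP out] by blast
    qed
    have B: "(\<Sum>\<xi>\<in>F-{0}. c f \<xi>) \<le> ?V * ?N f" if "continuous_on UNIV f" "\<forall>x. norm x > R \<longrightarrow> f x = 0" for f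
      using Bessel[OF L(1) sub[OF that(1)], of "F - {0}"] F(1,2) unfolding N[OF that] c_def by blast
    have "(\<Sum>\<xi>\<in>F. c P \<xi>) \<le> c P 0 + (\<Sum>\<xi>\<in>F-{0}. c P \<xi>)"
      using F(1) by (cases "0 \<in> F") (simp_all add: sum.remove c_def)
    also have "\<dots> \<le> ?V / 2 * ?N P + (\<Sum>\<xi>\<in>F-{0}. 5 * c (\<lambda>x. sym_part (P x)) \<xi> + 4 * L\<^sup>2 * c (classical_Curl P) \<xi>)"
      using F(2) by (intro add_mono zero_freq sum_mono freq) auto
    also have "\<dots> = ?V / 2 * ?N P + 5 * (\<Sum>\<xi>\<in>F-{0}. c (\<lambda>x. sym_part (P x)) \<xi>) + 4 * L\<^sup>2 * (\<Sum>\<xi>\<in>F-{0}. c (classical_Curl P) \<xi>)"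
      by (simp add: sum.distrib sum_distrib_left)
    also have "\<dots> \<le> ?V / 2 * ?N P + 5 * (?V * ?N (\<lambda>x. sym_part (P x))) + 4 * L\<^sup>2 * (?V * ?N (classical_Curl P))"
      by (intro add_mono mult_left_mono B contS contC outS outC) auto
    finally show "?V / 2 * ?N P \<le> 5 * ?V * ?N (\<lambda>x. sym_part (P x)) + 4 * L\<^sup>2 * ?V * ?N (classical_Curl P) + e"
      using F(3) by simp
  qed
  then have "?V * ?N P \<le> ?V * (10 * ?N (\<lambda>x. sym_part (P x)) + 8 * L\<^sup>2 * ?N (classical_Curl P))"
    by (simp add: algebra_simps)
  then show ?thesis using V by (simp only: mult_le_cancel_left_pos)
qed

section \<open>Smooth functions and the fundamental lemma of the calculus of variations\<close>

text \<open>
  The powers in the denominator make the family closed under differentiation up to linear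
  combinations, so that every member is smooth. All derivatives vanish at zero.
\<close>

definition flat :: "nat \<Rightarrow> real \<Rightarrow> real" where
  "flat k t = (if t > 0 then exp (- 1 / t) / t ^ k else 0)"

lemma flat_nonneg: "flat k t \<ge> 0" by (simp add: flat_def)

lemma flat_pos_iff: "flat k t > 0 \<longleftrightarrow> t > 0" by (simp add: flat_def)

lemma flat_tendsto_0: "(flat k \<longlongrightarrow> 0) (at 0)"
proof -
  have "((\<lambda>u. u ^ k / exp u) \<longlongrightarrow> (0::real)) at_top" by (rule tendsto_power_div_exp_0)
  then have "((\<lambda>t. (inverse t) ^ k / exp (inverse t)) \<longlongrightarrow> (0::real)) (at_right 0)"
    by (rule filterlim_compose[OF _ filterlim_inverse_at_top_right])
  moreover have "eventually (\<lambda>t. (inverse t) ^ k / exp (inverse t) = flat k t) (at_right (0::real))"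
    unfolding eventually_at_filter
    by (rule always_eventually) (auto simp: flat_def exp_minus field_simps)
  ultimately have R: "(flat k \<longlongrightarrow> 0) (at_right 0)" by (rule Lim_transform_eventually)
  have L: "(flat k \<longlongrightarrow> 0) (at_left 0)"
    by (rule Lim_transform_eventually[OF tendsto_const])
       (auto simp: eventually_at_filter flat_def intro: always_eventually)
  show ?thesis using R L by (simp add: filterlim_split_at)
qed

lemma flat_has_field_derivative:
  "(flat k has_field_derivative (- real k * flat (Suc k) t + flat (Suc (Suc k)) t)) (at t)"
proof -
  consider "t > 0" | "t < 0" | "t = 0" by linarith
  then show ?thesis
  proof cases
    case 1
    have "((\<lambda>t. exp (- 1 / t) / t ^ k) has_field_derivative (- real k * flat (Suc k) t + flat (Suc (Suc k)) t)) (at t)"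
      using 1 by (cases k, auto intro!: derivative_eq_intros simp: flat_def field_simps power2_eq_square)
        (metis One_nat_def power_eq_if)
    then show ?thesis
      by (rule has_field_derivative_transform_within_open[of _ _ _ "{0<..}"]) (use 1 in \<open>auto simp: flat_def\<close>)
  next
    case 2
    have "((\<lambda>_. 0) has_field_derivative (- real k * flat (Suc k) t + flat (Suc (Suc k)) t)) (at t)"
      using 2 by (simp add: flat_def)
    then show ?thesis
      by (rule has_field_derivative_transform_within_open[of _ _ _ "{..<0}"]) (use 2 in \<open>auto simp: flat_def\<close>)
  next
    case 3
    have "((\<lambda>h. (flat k (0 + h) - flat k 0) / h) \<longlongrightarrow> 0) (at 0)"
    proof (rule Lim_transform_eventually[OF flat_tendsto_0[of "Suc k"]])
      show "\<forall>\<^sub>F h in at 0. flat (Suc k) h = (flat k (0 + h) - flat k 0) / h"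
        unfolding eventually_at_filter by (rule always_eventually) (auto simp: flat_def field_simps)
    qed
    then show ?thesis by (simp add: DERIV_def 3 flat_def)
  qed
qed

text \<open>
  A class of functions that is closed under directional derivatives, so that smoothness of its members
  needs no separate induction for each function. It contains bump functions around every point and,
  thanks to \<open>exp\<close>, smooth approximations of indicator functions.
\<close>

inductive smooth_expression :: "('a::real_inner \<Rightarrow> real) \<Rightarrow> bool" where
  const: "smooth_expression (\<lambda>x. c)"
| linear: "smooth_expression (\<lambda>x. x \<bullet> a)"
| add: "smooth_expression f \<Longrightarrow> smooth_expression g \<Longrightarrow> smooth_expression (\<lambda>x. f x + g x)"
| mult: "smooth_expression f \<Longrightarrow> smooth_expression g \<Longrightarrow> smooth_expression (\<lambda>x. f x * g x)"
| flat: "smooth_expression f \<Longrightarrow> smooth_expression (\<lambda>x. flat k (f x))"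
| exp: "smooth_expression f \<Longrightarrow> smooth_expression (\<lambda>x. exp (f x))"

text \<open>
  The closure property that the class is made for; the case \<open>flat\<close> is where \<open>flat k\<close> is needed for
  all \<open>k\<close>.
\<close>

lemma smooth_expression_derivative:
  "smooth_expression f \<Longrightarrow>
    \<exists>f'. (\<forall>x. (f has_derivative f' x) (at x)) \<and> (\<forall>v. smooth_expression (\<lambda>x. f' x v))"
proof (induction rule: smooth_expression.induct)
  case (const c)
  show ?case by (intro exI[of _ "\<lambda>x v. 0"]) (auto intro: smooth_expression.const)
next
  case (linear a)
  show ?case by (intro exI[of _ "\<lambda>x v. v \<bullet> a"]) (auto intro!: smooth_expression.const derivative_eq_intros)
next
  case (add f g)
  then obtain f' g' where "\<forall>x. (f has_derivative f' x) (at x)" "\<forall>v. smooth_expression (\<lambda>x. f' x v)"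
    "\<forall>x. (g has_derivative g' x) (at x)" "\<forall>v. smooth_expression (\<lambda>x. g' x v)" by blast
  then show ?case
    by (intro exI[of _ "\<lambda>x v. f' x v + g' x v"]) (auto intro: smooth_expression.add has_derivative_add)
next
  case (mult f g)
  then obtain f' g' where "\<forall>x. (f has_derivative f' x) (at x)" "\<forall>v. smooth_expression (\<lambda>x. f' x v)"
    "\<forall>x. (g has_derivative g' x) (at x)" "\<forall>v. smooth_expression (\<lambda>x. g' x v)" by blast
  then show ?case using mult.hyps
    by (intro exI[of _ "\<lambda>x v. f x * g' x v + f' x v * g x"])
       (auto intro!: smooth_expression.add smooth_expression.mult has_derivative_mult)
next
  case (flat f k)
  then obtain f' where f': "\<forall>x. (f has_derivative f' x) (at x)" "\<forall>v. smooth_expression (\<lambda>x. f' x v)" by blast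
  let ?d = "\<lambda>t. - real k * flat (Suc k) t + flat (Suc (Suc k)) t"
  have "((\<lambda>x. flat k (f x)) has_derivative (\<lambda>v. ?d (f x) * f' x v)) (at x)" for x
    using has_derivative_compose[OF f'(1)[rule_format] flat_has_field_derivative[unfolded has_field_derivative_def]] .
  moreover have "smooth_expression (\<lambda>x. ?d (f x) * f' x v)" for v
    using f'(2) flat.hyps
    by (intro smooth_expression.mult smooth_expression.add smooth_expression.const smooth_expression.flat) auto
  ultimately show ?case by (intro exI[of _ "\<lambda>x v. ?d (f x) * f' x v"]) auto
next
  case (exp f)
  then obtain f' where f': "\<forall>x. (f has_derivative f' x) (at x)" "\<forall>v. smooth_expression (\<lambda>x. f' x v)" by blast
  then show ?case using exp.hyps
    by (intro exI[of _ "\<lambda>x v. f' x v * exp (f x)"])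
       (auto intro!: derivative_eq_intros smooth_expression.mult smooth_expression.exp)
qed

lemma smooth_expression_sum:
  "finite I \<Longrightarrow> (\<And>i. i \<in> I \<Longrightarrow> smooth_expression (f i)) \<Longrightarrow> smooth_expression (\<lambda>x. \<Sum>i\<in>I. f i x)"
  by (induction I rule: finite_induct) (auto intro: smooth_expression.add smooth_expression.const)

lemma Ck_field_smooth_expression: "smooth_expression f \<Longrightarrow> Ck_field k (\<lambda>x. f x *\<^sub>R c)"
proof (induction k arbitrary: f)
  case 0
  from smooth_expression_derivative[OF this] obtain f' where "\<And>x. (f has_derivative f' x) (at x)" by blast
  then have "continuous_on UNIV f" by (intro has_derivative_continuous_on[OF has_derivative_at_withinI])
  then show ?case by (auto intro: continuous_intros)
next
  case (Suc k)
  from smooth_expression_derivative[OF Suc.prems] obtain f'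
    where f': "\<And>x. (f has_derivative f' x) (at x)" "\<And>v. smooth_expression (\<lambda>x. f' x v)" by blast
  have d: "((\<lambda>x. f x *\<^sub>R c) has_derivative (\<lambda>v. f' x v *\<^sub>R c)) (at x)" for x
    using has_derivative_scaleR_left[OF f'(1)] .
  have "frechet_derivative (\<lambda>x. f x *\<^sub>R c) (at x) = (\<lambda>v. f' x v *\<^sub>R c)" for x
    using frechet_derivative_at[OF d] by simp
  then show ?case using d Suc.IH[OF f'(2)] by (auto simp: differentiable_def)
qed

lemma smooth_expression_bump: "smooth_expression (\<lambda>x. flat 0 (r\<^sup>2 - (dist x c)\<^sup>2))" for c :: "'a::euclidean_space"
proof -
  have eq: "r\<^sup>2 - (dist x c)\<^sup>2 = (r\<^sup>2 - c \<bullet> c) + (x \<bullet> (2 *\<^sub>R c) + (-1) * (\<Sum>b\<in>Basis. (x \<bullet> b) * (x \<bullet> b)))" for x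
    unfolding dist_norm power2_norm_eq_inner
    by (subst euclidean_inner[of x x, symmetric]) (simp add: inner_diff_left inner_diff_right inner_commute)
  show ?thesis unfolding eq
    by (intro smooth_expression.flat smooth_expression.add smooth_expression.mult smooth_expression.const
       smooth_expression.linear smooth_expression_sum) auto
qed

lemma open_countable_Union_balls:
  fixes U :: "'a::euclidean_space set"
  assumes "open U" "U \<noteq> {}"
  shows "\<exists>(c :: nat \<Rightarrow> 'a) r. (\<forall>i. cball (c i) (r i) \<subseteq> U) \<and> (\<Union>i. ball (c i) (r i)) = U"
proof -
  let ?F = "{ball x e |x e. cball x e \<subseteq> U}"
  obtain F where F: "F \<subseteq> ?F" "countable F" "\<Union>F = \<Union>?F"
    by (rule Lindelof_openin[of ?F UNIV]) auto
  have U: "\<Union>?F = U"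
  proof (rule subset_antisym)
    show "U \<subseteq> \<Union>?F"
    proof
      fix x assume "x \<in> U"
      then obtain e where "e > 0" "cball x e \<subseteq> U" using assms(1) open_contains_cball by blast
      then show "x \<in> \<Union>?F" by (intro UnionI[of "ball x e"]) auto
    qed
  qed (auto intro: less_imp_le)
  have "F \<noteq> {}" using F(3) U assms(2) by auto
  have "from_nat_into F i \<in> ?F" for i
    by (rule subsetD[OF F(1) from_nat_into[OF \<open>F \<noteq> {}\<close>]])
  then have "\<forall>i. \<exists>x e. from_nat_into F i = ball x e \<and> cball x e \<subseteq> U" by simp
  then obtain c r where cr: "\<And>i. from_nat_into F i = ball (c i) (r i) \<and> cball (c i) (r i) \<subseteq> U" by metis
  have "(\<Union>i. ball (c i) (r i)) = \<Union>(range (from_nat_into F))" by (simp add: cr)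
  also have "\<dots> = U" using range_from_nat_into[OF \<open>F \<noteq> {}\<close> F(2)] F(3) U by simp
  finally show ?thesis using cr by (intro exI[of _ c] exI[of _ r]) simp
qed

text \<open>
  Cover \<open>U\<close> by countably many balls with bump functions \<open>b i\<close>. The partial sums \<open>s n\<close> of the bumps
  are eventually bounded below by a positive number at each point of \<open>U\<close> and vanish off \<open>U\<close>, so
  \<open>1 - exp (- n * s n)\<close> converges to the indicator function.
\<close>

lemma indicator_open_limit_of_smooth:
  fixes U :: "'a::euclidean_space set"
  assumes "open U"
  shows "\<exists>(f :: nat \<Rightarrow> 'a \<Rightarrow> real) K. \<forall>n. smooth_expression (f n) \<and> (\<forall>x. 0 \<le> f n x \<and> f n x \<le> 1) \<and>
    compact (K n) \<and> K n \<subseteq> U \<and> (\<forall>x. x \<notin> K n \<longrightarrow> f n x = 0) \<and> (\<forall>x. (\<lambda>n. f n x) \<longlonglongrightarrow> indicator U x)"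
proof (cases "U = {}")
  case True
  show ?thesis
    by (intro exI[of _ "\<lambda>n x. 0"] exI[of _ "\<lambda>n. {}"]) (simp add: True smooth_expression.const)
next
  case False
  from open_countable_Union_balls[OF assms False]
  obtain c :: "nat \<Rightarrow> 'a" and r where cr: "\<And>i. cball (c i) (r i) \<subseteq> U" "(\<Union>i. ball (c i) (r i)) = U" by blast
  \<comment> \<open>A ball of negative radius is empty, although \<open>(r i)\<^sup>2\<close> is positive; the factor in front makes its bump vanish.\<close>
  define b where "b i x = (if r i > 0 then 1 else 0) * flat 0 ((r i)\<^sup>2 - (dist x (c i))\<^sup>2)" for i x
  define f where "f n x = 1 + (-1) * exp (- real n * (\<Sum>i<n. b i x))" for n x
  have b0: "b i x \<ge> 0" for i x by (simp add: b_def flat_nonneg)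
  have b_pos: "b i x > 0 \<longleftrightarrow> x \<in> ball (c i) (r i)" for i x
  proof (cases "r i > 0")
    case True
    then have "(dist x (c i))\<^sup>2 < (r i)\<^sup>2 \<longleftrightarrow> dist x (c i) < r i"
      using power_mono_iff[of "r i" "dist x (c i)" 2] by (simp add: linorder_not_le[symmetric])
    then show ?thesis using True by (simp add: b_def flat_pos_iff dist_commute)
  next
    case False
    moreover have "\<not> dist (c i) x < r i" using False zero_le_dist[of "c i" x] by linarith
    ultimately show ?thesis by (simp add: b_def)
  qed
  have s0: "(\<Sum>i<n. b i x) \<ge> 0" for n x by (intro sum_nonneg b0)
  show ?thesis
  proof (intro exI[of _ f] exI[of _ "\<lambda>n. \<Union>i<n. cball (c i) (r i)"] allI conjI impI)
    show "smooth_expression (f n)" for n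
      unfolding f_def b_def
      by (intro smooth_expression.add smooth_expression.mult smooth_expression.const smooth_expression.exp
          smooth_expression_sum smooth_expression_bump) auto
    show "0 \<le> f n x" "f n x \<le> 1" for n x
      using s0[where n=n and x=x] by (simp_all add: f_def)
    show "compact (\<Union>i<n. cball (c i) (r i))" for n by (intro compact_UN) auto
    show "(\<Union>i<n. cball (c i) (r i)) \<subseteq> U" for n using cr(1) by blast
    show "f n x = 0" if "x \<notin> (\<Union>i<n. cball (c i) (r i))" for n x
    proof -
      have "b i x = 0" if "i < n" for i
        using b_pos[of i x] b0[of i x] \<open>x \<notin> _\<close> that ball_subset_cball by fastforce
      then show ?thesis by (simp add: f_def)
    qed
    show "(\<lambda>n. f n x) \<longlonglongrightarrow> indicator U x" for x
    proof (cases "x \<in> U")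
      case True
      then obtain i where i: "b i x > 0" using cr(2) b_pos by blast
      have "filterlim (\<lambda>n. real n * (\<Sum>j<n. b j x)) at_top sequentially"
      proof (rule filterlim_at_top_mono)
        show "filterlim (\<lambda>n. b i x * real n) at_top sequentially"
          by (rule filterlim_tendsto_pos_mult_at_top[OF tendsto_const i filterlim_real_sequentially])
        show "\<forall>\<^sub>F n in sequentially. b i x * real n \<le> real n * (\<Sum>j<n. b j x)"
          using eventually_gt_at_top[of i]
        proof eventually_elim
          case (elim n)
          have "b i x \<le> (\<Sum>j<n. b j x)" using elim b0 by (intro member_le_sum) auto
          then show ?case by (simp add: mult.commute mult_left_mono)
        qed
      qed
      then have "((\<lambda>n. exp (- (real n * (\<Sum>j<n. b j x)))) \<longlongrightarrow> 0) sequentially"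
        by (intro filterlim_compose[OF exp_at_bot] filterlim_compose[OF filterlim_uminus_at_bot_at_top])
      then have "(\<lambda>n. 1 + (-1) * exp (- (real n * (\<Sum>j<n. b j x)))) \<longlonglongrightarrow> 1 + (-1) * 0"
        by (intro tendsto_intros)
      then show ?thesis using True by (simp add: f_def)
    next
      case False
      then have "b i x = 0" for i
        using b_pos[of i x] b0[of i x] cr(2) by (metis UN_I UNIV_I less_eq_real_def)
      then show ?thesis using False by (simp add: f_def)
    qed
  qed
qed

text \<open>
  The set where \<open>g\<close> is positive is, up to a null set, a decreasing limit of open subsets of \<open>\<Omega>\<close>, so
  the integral of \<open>g\<close> over it vanishes. The same holds for \<open>- g\<close>.
\<close>

lemma AE_zero_of_open_integrals_zero:
  fixes g :: "'a::euclidean_space \<Rightarrow> real"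
  assumes \<Omega>: "open \<Omega>" and g: "integrable (lebesgue_on \<Omega>) g"
    and zero: "\<And>U. open U \<Longrightarrow> U \<subseteq> \<Omega> \<Longrightarrow> (LINT x|lebesgue_on \<Omega>. indicator U x * g x) = 0"
  shows "AE x in lebesgue_on \<Omega>. g x = 0"
proof -
  let ?M = "lebesgue_on \<Omega>"
  have \<Omega>s: "\<Omega> \<in> sets lebesgue" using \<Omega> by simp
  have half: "AE x in ?M. h x \<le> 0"
    if h: "integrable ?M h" and zero: "\<And>U. open U \<Longrightarrow> U \<subseteq> \<Omega> \<Longrightarrow> (LINT x|?M. indicator U x * h x) = 0" for h :: "'a \<Rightarrow> real"
  proof -
    have [measurable]: "h \<in> borel_measurable ?M" using h by auto
    define A where "A = {x \<in> space ?M. h x > 0}"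
    have A: "A \<in> sets ?M" unfolding A_def by measurable
    then have "A \<in> sets lebesgue" "A \<subseteq> \<Omega>" using \<Omega>s by (auto simp: sets_restrict_space A_def)
    from lebesgue_set_almost_gdelta[OF this(1)] obtain C T
      where CT: "gdelta C" "T \<in> null_sets lebesgue" "A \<union> T = C" "disjnt A T" by blast
    from CT(1) obtain D :: "nat \<Rightarrow> 'a set" where D: "\<And>n. open (D n)" "C = (\<Inter>n. D n)" by (auto elim: gdelta.cases)
    \<comment> \<open>Intersecting with \<open>\<Omega>\<close> and with the earlier sets gives open subsets of \<open>\<Omega>\<close> that decrease to \<open>C \<inter> \<Omega>\<close>.\<close>
    define H where "H n = \<Omega> \<inter> (\<Inter>k\<le>n. D k)" for n
    have H: "open (H n)" "H n \<subseteq> \<Omega>" for n using \<Omega> D(1) by (auto simp: H_def)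
    have AEC: "AE x in ?M. indicator C x = (indicator A x :: real)"
    proof -
      have "AE x in lebesgue. x \<notin> T" using CT(2) by (rule AE_not_in)
      then have "AE x in ?M. x \<notin> T" using \<Omega>s by (simp add: AE_restrict_space_iff eventually_mono)
      then show ?thesis using CT(3) by (auto simp: indicator_def elim!: eventually_mono)
    qed
    have "(\<lambda>n. LINT x|?M. indicator (H n) x * h x) \<longlonglongrightarrow> (LINT x|?M. indicator A x * h x)"
    proof (rule integral_dominated_convergence)
      show "integrable ?M (\<lambda>x. \<bar>h x\<bar>)" using h by (rule integrable_abs)
      show "(\<lambda>x. indicator A x * h x) \<in> borel_measurable ?M" using A by measurable
      show "(\<lambda>x. indicator (H n) x * h x) \<in> borel_measurable ?M" for n
      proof -
        have "H n \<in> sets ?M" using H \<Omega>s by (auto simp: sets_restrict_space_iff)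
        then show ?thesis by measurable
      qed
      show "AE x in ?M. norm (indicator (H n) x * h x) \<le> \<bar>h x\<bar>" for n
        by (auto simp: indicator_def)
      show "AE x in ?M. (\<lambda>n. indicator (H n) x * h x) \<longlonglongrightarrow> indicator A x * h x"
        using AEC AE_space
      proof eventually_elim
        case (elim x)
        have "(\<lambda>n. indicator (H n) x * h x) \<longlonglongrightarrow> indicator C x * h x"
        proof (cases "x \<in> C")
          case True
          then have "x \<in> H n" for n using elim(2) by (auto simp: H_def D(2))
          then show ?thesis using True by simp
        next
          case False
          then obtain k where k: "x \<notin> D k" by (auto simp: D(2))
          have "\<forall>\<^sub>F n in sequentially. indicator (H n) x * h x = indicator C x * h x"
            using eventually_ge_at_top[of k]
            by eventually_elim (use k False in \<open>auto simp: H_def indicator_def\<close>)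
          then show ?thesis by (rule tendsto_eventually)
        qed
        then show ?case using elim(1) by simp
      qed
    qed
    then have "(LINT x|?M. indicator A x * h x) = 0"
      using zero[OF H] by (simp add: LIMSEQ_const_iff)
    moreover have "integrable ?M (\<lambda>x. indicator A x * h x)"
      using integrable_mult_indicator[OF A h] by simp
    moreover have "AE x in ?M. 0 \<le> indicator A x * h x" by (auto simp: A_def indicator_def)
    ultimately have "AE x in ?M. indicator A x * h x = 0"
      using integral_nonneg_eq_0_iff_AE by blast
    then show ?thesis using AE_space by eventually_elim (auto simp: A_def indicator_def split: if_splits)
  qed
  have "AE x in ?M. g x \<le> 0" by (rule half[OF g zero])
  moreover have "AE x in ?M. - g x \<le> 0"
    by (rule half) (use g zero in auto)
  ultimately show ?thesis by eventually_elim auto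
qed

lemma test_field_smooth_expression:
  assumes "smooth_expression f" "compact K" "K \<subseteq> \<Omega>" "\<And>x. x \<notin> K \<Longrightarrow> f x = 0"
  shows "(\<lambda>x. f x *\<^sub>R c) \<in> test_fields \<Omega>"
proof -
  have "support_on UNIV (\<lambda>x. f x *\<^sub>R c) \<subseteq> K" using assms(4) by (auto simp: support_on_def)
  then have s: "closure (support_on UNIV (\<lambda>x. f x *\<^sub>R c)) \<subseteq> K"
    using assms(2) by (simp add: closure_minimal compact_imp_closed)
  then have "compact (closure (support_on UNIV (\<lambda>x. f x *\<^sub>R c)))"
    using assms(2) by (meson bounded_subset compact_eq_bounded_closed closed_closure)
  then show ?thesis
    using s assms(3) Ck_field_smooth_expression[OF assms(1)] by (auto simp: test_fields_def)
qed

text \<open>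
  Testing with smooth approximations of the indicator function of an open set, times a constant
  vector, shows that the integral over each open subset vanishes.
\<close>

lemma fundamental_lemma_test_fields:
  fixes w :: "real^3 \<Rightarrow> real^3"
  assumes \<Omega>: "open \<Omega>" and w: "integrable (lebesgue_on \<Omega>) w"
    and zero: "\<And>\<phi>. \<phi> \<in> test_fields \<Omega> \<Longrightarrow> (LINT x|lebesgue_on \<Omega>. w x \<bullet> \<phi> x) = 0"
  shows "AE x in lebesgue_on \<Omega>. w x = 0"
proof -
  let ?M = "lebesgue_on \<Omega>"
  have \<Omega>s: "\<Omega> \<in> sets lebesgue" using \<Omega> by simp
  have "AE x in ?M. w x \<bullet> c = 0" for c
  proof (rule AE_zero_of_open_integrals_zero[OF \<Omega>])
    have iw: "integrable ?M (\<lambda>x. w x \<bullet> c)" using w by simp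
    then show "integrable ?M (\<lambda>x. w x \<bullet> c)" .
    fix U :: "(real^3) set" assume U: "open U" "U \<subseteq> \<Omega>"
    from indicator_open_limit_of_smooth[OF U(1)] obtain f :: "nat \<Rightarrow> real^3 \<Rightarrow> real" and K :: "nat \<Rightarrow> (real^3) set" where
      f: "\<And>n. smooth_expression (f n)" "\<And>n x. 0 \<le> f n x \<and> f n x \<le> 1" "\<And>n. compact (K n)" "\<And>n. K n \<subseteq> U"
        "\<And>n x. x \<notin> K n \<Longrightarrow> f n x = 0" "\<And>x. (\<lambda>n. f n x) \<longlonglongrightarrow> indicator U x"
      by blast
    have [measurable]: "f n \<in> borel_measurable ?M" for n
    proof -
      from smooth_expression_derivative[OF f(1)] obtain f' where "\<And>x. (f n has_derivative f' x) (at x)" by blast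
      then have "continuous_on UNIV (f n)" by (intro has_derivative_continuous_on[OF has_derivative_at_withinI])
      then show ?thesis
        by (intro measurable_restrict_space1 measurable_completion) (simp add: borel_measurable_continuous_onI)
    qed
    have [measurable]: "w \<in> borel_measurable ?M" using w by auto
    have Us: "U \<in> sets ?M" using U \<Omega>s by (auto simp: sets_restrict_space_iff)
    have "(\<lambda>n. LINT x|?M. f n x * (w x \<bullet> c)) \<longlonglongrightarrow> (LINT x|?M. indicator U x * (w x \<bullet> c))"
    proof (rule integral_dominated_convergence)
      show "integrable ?M (\<lambda>x. \<bar>w x \<bullet> c\<bar>)" using iw by (rule integrable_abs)
      show "(\<lambda>x. indicator U x * (w x \<bullet> c)) \<in> borel_measurable ?M" using Us by measurable
      show "(\<lambda>x. f n x * (w x \<bullet> c)) \<in> borel_measurable ?M" for n by measurable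
      show "AE x in ?M. norm (f n x * (w x \<bullet> c)) \<le> \<bar>w x \<bullet> c\<bar>" for n
        using f(2) by (auto simp: abs_mult mult_left_le_one_le)
      show "AE x in ?M. (\<lambda>n. f n x * (w x \<bullet> c)) \<longlonglongrightarrow> indicator U x * (w x \<bullet> c)"
        by (intro AE_I2 tendsto_mult[OF f(6) tendsto_const])
    qed
    moreover have "(LINT x|?M. f n x * (w x \<bullet> c)) = 0" for n
    proof -
      have "(\<lambda>x. f n x *\<^sub>R c) \<in> test_fields \<Omega>"
        using f(4) U(2) by (intro test_field_smooth_expression[OF f(1) f(3) _ f(5)]) auto
      from zero[OF this] show ?thesis by simp
    qed
    ultimately show "(LINT x|?M. indicator U x * (w x \<bullet> c)) = 0" by (simp add: LIMSEQ_const_iff)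
  qed
  then have "AE x in ?M. \<forall>i. w x \<bullet> axis i 1 = 0" by (simp add: AE_all_countable)
  then show ?thesis by eventually_elim (simp add: inner_axis vec_eq_iff)
qed

section \<open>Square integrable fields\<close>

lemma L2_spaceD:
  assumes "f \<in> L2_space \<Omega>"
  shows "f \<in> borel_measurable (lebesgue_on \<Omega>)" "integrable (lebesgue_on \<Omega>) (\<lambda>x. (norm (f x))\<^sup>2)"
  using assms by (auto simp: L2_space_def)

lemma L2_spaceI:
  fixes f :: "real^3 \<Rightarrow> 'b::euclidean_space"
  assumes "f \<in> borel_measurable (lebesgue_on \<Omega>)" "integrable (lebesgue_on \<Omega>) g"
    "\<And>x. (norm (f x))\<^sup>2 \<le> g x"
  shows "f \<in> L2_space \<Omega>"
proof -
  have "integrable (lebesgue_on \<Omega>) (\<lambda>x. (norm (f x))\<^sup>2)"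
    by (rule Bochner_Integration.integrable_bound[OF assms(2)])
       (use assms(1,3) in \<open>auto intro!: always_eventually simp: abs_of_nonneg order.trans[OF _ assms(3)] order.trans[OF _ abs_ge_self]\<close>)
  with assms(1) show ?thesis by (simp add: L2_space_def)
qed

lemma norm_sum_sq_le: "(norm (a + b))\<^sup>2 \<le> 2 * (norm a)\<^sup>2 + 2 * (norm (b::'b::real_normed_vector))\<^sup>2"
proof -
  have "(norm (a + b))\<^sup>2 \<le> (norm a + norm b)\<^sup>2" by (intro power_mono norm_triangle_ineq) auto
  also have "\<dots> \<le> 2 * (norm a)\<^sup>2 + 2 * (norm b)\<^sup>2"
    using sum_squares_bound[of "norm a" "norm b"] by (simp add: power2_sum)
  finally show ?thesis .
qed

lemma L2_space_add:
  assumes "f \<in> L2_space \<Omega>" "g \<in> L2_space \<Omega>" shows "(\<lambda>x. f x + g x) \<in> L2_space \<Omega>"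
proof (rule L2_spaceI)
  show "(\<lambda>x. f x + g x) \<in> borel_measurable (lebesgue_on \<Omega>)"
    using L2_spaceD(1)[OF assms(1)] L2_spaceD(1)[OF assms(2)] by measurable
  show "integrable (lebesgue_on \<Omega>) (\<lambda>x. 2 * (norm (f x))\<^sup>2 + 2 * (norm (g x))\<^sup>2)"
    using L2_spaceD(2)[OF assms(1)] L2_spaceD(2)[OF assms(2)] by simp
qed (rule norm_sum_sq_le)

lemma L2_space_bounded_linear:
  assumes "bounded_linear T" "f \<in> L2_space \<Omega>" shows "(\<lambda>x. T (f x)) \<in> L2_space \<Omega>"
proof -
  obtain B where B: "\<And>v. norm (T v) \<le> B * norm v"
    using bounded_linear.bounded[OF assms(1)] by (auto simp: mult.commute)
  show ?thesis
  proof (rule L2_spaceI)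
    show "(\<lambda>x. T (f x)) \<in> borel_measurable (lebesgue_on \<Omega>)"
      by (rule borel_measurable_continuous_on[OF _ L2_spaceD(1)[OF assms(2)]])
         (rule linear_continuous_on[OF assms(1)])
    show "integrable (lebesgue_on \<Omega>) (\<lambda>x. B\<^sup>2 * (norm (f x))\<^sup>2)"
      using L2_spaceD(2)[OF assms(2)] by simp
    show "(norm (T (f x)))\<^sup>2 \<le> B\<^sup>2 * (norm (f x))\<^sup>2" for x
      using power_mono[OF B[of "f x"], of 2] by (simp add: power_mult_distrib)
  qed
qed

lemma L2_space_scaleR: "f \<in> L2_space \<Omega> \<Longrightarrow> (\<lambda>x. a *\<^sub>R f x) \<in> L2_space \<Omega>"
  by (rule L2_space_bounded_linear[OF bounded_linear_scaleR_right])

lemma L2_space_Pair: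
  assumes "f \<in> L2_space \<Omega>" "g \<in> L2_space \<Omega>" shows "(\<lambda>x. (f x, g x)) \<in> L2_space \<Omega>"
  using assms by (auto simp: L2_space_def norm_Pair)

lemma L2_space_vec:
  fixes f :: "real^3 \<Rightarrow> 'b::euclidean_space^'n"
  assumes "\<And>i. (\<lambda>x. f x $ i) \<in> L2_space \<Omega>" shows "f \<in> L2_space \<Omega>"
proof -
  have "f \<in> borel_measurable (lebesgue_on \<Omega>)"
  proof (rule borel_measurable_euclidean_space[THEN iffD2], rule ballI)
    fix b :: "'b^'n" assume "b \<in> Basis"
    then obtain i c where "b = axis i c" by (auto simp: Basis_vec_def)
    then show "(\<lambda>x. f x \<bullet> b) \<in> borel_measurable (lebesgue_on \<Omega>)"
      using L2_spaceD(1)[OF assms[of i]] by (simp add: inner_axis)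
  qed
  moreover have "(norm (f x))\<^sup>2 = (\<Sum>i\<in>UNIV. (norm (f x $ i))\<^sup>2)" for x
    unfolding power2_norm_eq_inner inner_vec_def ..
  ultimately show ?thesis using L2_spaceD(2)[OF assms] by (simp add: L2_space_def)
qed

lemma norm_L2_nonneg: "norm_L2 \<Omega> f \<ge> 0" by (simp add: norm_L2_def)

lemma norm_L2_squared: "(norm_L2 \<Omega> f)\<^sup>2 = (LINT x|lebesgue_on \<Omega>. (norm (f x))\<^sup>2)"
  by (simp add: norm_L2_def)

lemma norm_L2_scaleR: "norm_L2 \<Omega> (\<lambda>x. a *\<^sub>R f x) = \<bar>a\<bar> * norm_L2 \<Omega> f"
  by (simp add: norm_L2_def power_mult_distrib real_sqrt_mult)

lemma norm_L2_Pair: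
  assumes "f \<in> L2_space \<Omega>" "g \<in> L2_space \<Omega>"
  shows "norm_L2 \<Omega> (\<lambda>x. (f x, g x)) = sqrt ((norm_L2 \<Omega> f)\<^sup>2 + (norm_L2 \<Omega> g)\<^sup>2)"
  unfolding norm_L2_squared using L2_spaceD(2)[OF assms(1)] L2_spaceD(2)[OF assms(2)]
  by (simp add: norm_L2_def norm_Pair)

lemma norm_L2_vec_squared:
  fixes f :: "real^3 \<Rightarrow> 'b::euclidean_space^'n"
  assumes "\<And>i. (\<lambda>x. f x $ i) \<in> L2_space \<Omega>"
  shows "(norm_L2 \<Omega> f)\<^sup>2 = (\<Sum>i\<in>UNIV. (norm_L2 \<Omega> (\<lambda>x. f x $ i))\<^sup>2)"
proof -
  have "(norm (f x))\<^sup>2 = (\<Sum>i\<in>UNIV. (norm (f x $ i))\<^sup>2)" for x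
    unfolding power2_norm_eq_inner inner_vec_def ..
  then show ?thesis unfolding norm_L2_squared using L2_spaceD(2)[OF assms] by simp
qed

lemma norm_L2_eq_0_iff:
  assumes "f \<in> L2_space \<Omega>"
  shows "norm_L2 \<Omega> f = 0 \<longleftrightarrow> (AE x in lebesgue_on \<Omega>. f x = 0)"
  unfolding norm_L2_def using integral_nonneg_eq_0_iff_AE[OF L2_spaceD(2)[OF assms]] by simp

lemma norm_L2_cong_AE:
  assumes "AE x in lebesgue_on \<Omega>. f x = g x" "f \<in> L2_space \<Omega>" "g \<in> L2_space \<Omega>"
  shows "norm_L2 \<Omega> f = norm_L2 \<Omega> g"
proof -
  have "(LINT x|lebesgue_on \<Omega>. (norm (f x))\<^sup>2) = (LINT x|lebesgue_on \<Omega>. (norm (g x))\<^sup>2)"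
    using L2_spaceD(2)[OF assms(2)] L2_spaceD(2)[OF assms(3)] assms(1)
    by (intro integral_cong_AE) (auto elim!: eventually_mono)
  then show ?thesis by (simp add: norm_L2_def)
qed

text \<open>
  Minkowski's inequality. Integrating the pointwise bound
  \<open>\<bar>f + g\<bar>\<^sup>2 \<le> (1 + t) \<bar>f\<bar>\<^sup>2 + (1 + 1 / t) \<bar>g\<bar>\<^sup>2\<close> with \<open>t\<close> the ratio of the two norms gives the
  square of their sum.
\<close>

lemma norm_L2_triangle:
  assumes "f \<in> L2_space \<Omega>" "g \<in> L2_space \<Omega>"
  shows "norm_L2 \<Omega> (\<lambda>x. f x + g x) \<le> norm_L2 \<Omega> f + norm_L2 \<Omega> g"
proof -
  let ?M = "lebesgue_on \<Omega>"
  define a b where "a = norm_L2 \<Omega> f" and "b = norm_L2 \<Omega> g"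
  have ab: "a \<ge> 0" "b \<ge> 0" by (simp_all add: a_def b_def norm_L2_nonneg)
  note fg = L2_space_add[OF assms]
  consider "a = 0" | "b = 0" | "a > 0" "b > 0" using ab by linarith
  then show ?thesis
  proof cases
    case 1
    then have "AE x in ?M. f x = 0" using norm_L2_eq_0_iff[OF assms(1)] by (simp add: a_def)
    then have "AE x in ?M. f x + g x = g x" by eventually_elim simp
    from norm_L2_cong_AE[OF this fg assms(2)] show ?thesis by (simp add: norm_L2_nonneg)
  next
    case 2
    then have "AE x in ?M. g x = 0" using norm_L2_eq_0_iff[OF assms(2)] by (simp add: b_def)
    then have "AE x in ?M. f x + g x = f x" by eventually_elim simp
    from norm_L2_cong_AE[OF this fg assms(1)] show ?thesis by (simp add: norm_L2_nonneg)
  next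
    case 3
    have pt: "(norm (f x + g x))\<^sup>2 \<le> (1 + b / a) * (norm (f x))\<^sup>2 + (1 + a / b) * (norm (g x))\<^sup>2" for x
    proof -
      let ?u = "norm (f x)" and ?v = "norm (g x)"
      have "(norm (f x + g x))\<^sup>2 \<le> (?u + ?v)\<^sup>2" by (intro power_mono norm_triangle_ineq) auto
      also have "\<dots> \<le> (1 + b / a) * ?u\<^sup>2 + (1 + a / b) * ?v\<^sup>2"
      proof -
        \<comment> \<open>The mixed term is bounded by weighting the two norms with the ratio \<open>b / a\<close>.\<close>
        have "0 \<le> (b * ?u - a * ?v)\<^sup>2 / (a * b)" using 3 by simp
        also have "\<dots> = b / a * ?u\<^sup>2 + a / b * ?v\<^sup>2 - 2 * ?u * ?v"
          using 3 by (simp add: field_simps power2_eq_square)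
        finally show ?thesis by (simp add: power2_sum algebra_simps)
      qed
      finally show ?thesis .
    qed
    have "(norm_L2 \<Omega> (\<lambda>x. f x + g x))\<^sup>2 \<le> (LINT x|?M. (1 + b / a) * (norm (f x))\<^sup>2 + (1 + a / b) * (norm (g x))\<^sup>2)"
      unfolding norm_L2_squared using L2_spaceD(2)[OF assms(1)] L2_spaceD(2)[OF assms(2)] L2_spaceD(2)[OF fg] pt
      by (intro integral_mono) auto
    also have "\<dots> = (1 + b / a) * a\<^sup>2 + (1 + a / b) * b\<^sup>2"
      unfolding a_def b_def norm_L2_squared using L2_spaceD(2)[OF assms(1)] L2_spaceD(2)[OF assms(2)] by simp
    also have "\<dots> = (a + b)\<^sup>2" using 3 by (simp add: field_simps power2_eq_square)
    finally have "norm_L2 \<Omega> (\<lambda>x. f x + g x) \<le> a + b" by (rule power2_le_imp_le) (use ab in simp)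
    then show ?thesis by (simp add: a_def b_def)
  qed
qed

lemma L2_inner_integrable:
  assumes "f \<in> L2_space \<Omega>" "g \<in> L2_space \<Omega>"
  shows "integrable (lebesgue_on \<Omega>) (\<lambda>x. f x \<bullet> g x)"
proof (rule Bochner_Integration.integrable_bound)
  show "integrable (lebesgue_on \<Omega>) (\<lambda>x. (norm (f x))\<^sup>2 + (norm (g x))\<^sup>2)"
    using L2_spaceD(2)[OF assms(1)] L2_spaceD(2)[OF assms(2)] by simp
  show "(\<lambda>x. f x \<bullet> g x) \<in> borel_measurable (lebesgue_on \<Omega>)"
    using L2_spaceD(1)[OF assms(1)] L2_spaceD(1)[OF assms(2)] by measurable
  show "AE x in lebesgue_on \<Omega>. norm (f x \<bullet> g x) \<le> norm ((norm (f x))\<^sup>2 + (norm (g x))\<^sup>2)"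
  proof (rule AE_I2)
    fix x
    have "\<bar>f x \<bullet> g x\<bar> \<le> norm (f x) * norm (g x)" by (rule Cauchy_Schwarz_ineq2)
    also have "\<dots> \<le> (norm (f x))\<^sup>2 + (norm (g x))\<^sup>2"
      using sum_squares_bound[of "norm (f x)" "norm (g x)"]
        mult_nonneg_nonneg[OF norm_ge_zero norm_ge_zero, of "f x" "g x"] by linarith
    finally show "norm (f x \<bullet> g x) \<le> norm ((norm (f x))\<^sup>2 + (norm (g x))\<^sup>2)" by simp
  qed
qed

text \<open>
  Completeness of the Lebesgue measure: a function that agrees almost everywhere with a measurable one
  is itself measurable.
\<close>

lemma L2_cong_AE:
  fixes f g :: "real^3 \<Rightarrow> 'b::euclidean_space"
  assumes "\<Omega> \<in> sets lebesgue" "AE x in lebesgue_on \<Omega>. f x = g x" "f \<in> L2_space \<Omega>"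
  shows "g \<in> L2_space \<Omega>"
proof -
  have \<Omega>: "\<Omega> \<inter> space lebesgue \<in> sets lebesgue" using assms(1) by simp
  have "(\<lambda>x. indicator \<Omega> x *\<^sub>R f x) \<in> borel_measurable lebesgue"
    using L2_spaceD(1)[OF assms(3)] by (simp add: borel_measurable_restrict_space_iff[OF \<Omega>])
  moreover have "AE x in lebesgue. indicator \<Omega> x *\<^sub>R f x = indicator \<Omega> x *\<^sub>R g x"
    using assms(2) unfolding AE_restrict_space_iff[OF \<Omega>] by (auto elim!: eventually_mono simp: indicator_def)
  ultimately have "(\<lambda>x. indicator \<Omega> x *\<^sub>R g x) \<in> borel_measurable lebesgue"
    by (rule borel_measurable_AE)
  then have g: "g \<in> borel_measurable (lebesgue_on \<Omega>)"
    by (simp add: borel_measurable_restrict_space_iff[OF \<Omega>])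
  have "integrable (lebesgue_on \<Omega>) (\<lambda>x. (norm (g x))\<^sup>2)"
    by (rule integrable_cong_AE_imp[OF L2_spaceD(2)[OF assms(3)]])
       (use g assms(2) in \<open>auto elim!: eventually_mono\<close>)
  with g show ?thesis by (simp add: L2_space_def)
qed

lemma L2_imp_integrable:
  fixes f :: "real^3 \<Rightarrow> 'b::euclidean_space"
  assumes "\<Omega> \<in> lmeasurable" "f \<in> L2_space \<Omega>"
  shows "integrable (lebesgue_on \<Omega>) f"
proof (rule Bochner_Integration.integrable_bound)
  interpret finite_measure "lebesgue_on \<Omega>" using assms(1) by (rule finite_measure_lebesgue_on)
  show "integrable (lebesgue_on \<Omega>) (\<lambda>x. 1 + (norm (f x))\<^sup>2)"
    using L2_spaceD(2)[OF assms(2)] by simp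
  show "AE x in lebesgue_on \<Omega>. norm (f x) \<le> norm (1 + (norm (f x))\<^sup>2)"
  proof (rule AE_I2)
    fix x
    have "2 * norm (f x) \<le> 1 + (norm (f x))\<^sup>2" using sum_squares_bound[of 1 "norm (f x)"] by simp
    then show "norm (f x) \<le> norm (1 + (norm (f x))\<^sup>2)" using norm_ge_zero[of "f x"] by (simp only: real_norm_def)
  qed
qed (rule L2_spaceD(1)[OF assms(2)])

section \<open>The weak curl\<close>

lemma frechet_derivative_lincomb:
  assumes "f differentiable (at x)" "g differentiable (at x)"
  shows "(\<lambda>x. f x + a *\<^sub>R g x) differentiable (at x)"
    "frechet_derivative (\<lambda>x. f x + a *\<^sub>R g x) (at x) = (\<lambda>v. frechet_derivative f (at x) v + a *\<^sub>R frechet_derivative g (at x) v)"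
proof -
  have d: "((\<lambda>x. f x + a *\<^sub>R g x) has_derivative (\<lambda>v. frechet_derivative f (at x) v + a *\<^sub>R frechet_derivative g (at x) v)) (at x)"
    using assms[unfolded frechet_derivative_works] by (intro has_derivative_add has_derivative_scaleR_right)
  then show "(\<lambda>x. f x + a *\<^sub>R g x) differentiable (at x)" by (auto simp: differentiable_def)
  show "frechet_derivative (\<lambda>x. f x + a *\<^sub>R g x) (at x) = (\<lambda>v. frechet_derivative f (at x) v + a *\<^sub>R frechet_derivative g (at x) v)"
    using frechet_derivative_at[OF d] by simp
qed

lemma Ck_field_lincomb: "Ck_field k f \<Longrightarrow> Ck_field k g \<Longrightarrow> Ck_field k (\<lambda>x. f x + a *\<^sub>R g x)"
  by (induction k arbitrary: f g) (auto intro!: continuous_intros simp: frechet_derivative_lincomb)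

lemma test_fields_lincomb:
  assumes "\<phi> \<in> test_fields \<Omega>" "\<psi> \<in> test_fields \<Omega>"
  shows "(\<lambda>x. \<phi> x + a *\<^sub>R \<psi> x) \<in> test_fields \<Omega>"
proof -
  let ?K = "closure (support_on UNIV \<phi>) \<union> closure (support_on UNIV \<psi>)"
  have K: "compact ?K" "?K \<subseteq> \<Omega>" using assms by (auto simp: test_fields_def)
  have "support_on UNIV (\<lambda>x. \<phi> x + a *\<^sub>R \<psi> x) \<subseteq> support_on UNIV \<phi> \<union> support_on UNIV \<psi>"
    by (auto simp: support_on_def)
  also have "\<dots> \<subseteq> ?K" using closure_subset by blast
  finally have s: "closure (support_on UNIV (\<lambda>x. \<phi> x + a *\<^sub>R \<psi> x)) \<subseteq> ?K"
    using K(1) by (simp add: closure_minimal compact_imp_closed)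
  then have "compact (closure (support_on UNIV (\<lambda>x. \<phi> x + a *\<^sub>R \<psi> x)))"
    using K(1) by (meson bounded_subset compact_eq_bounded_closed closed_closure)
  then show ?thesis using s K(2) assms by (auto simp: test_fields_def intro!: Ck_field_lincomb)
qed

lemma test_fields_zero: "(\<lambda>x. 0) \<in> test_fields \<Omega>"
  using test_field_smooth_expression[OF smooth_expression.const[of 0], of "{}" \<Omega> 0] by simp

lemma test_fields_C1_field:
  assumes "\<phi> \<in> test_fields \<Omega>" shows "C1_field \<phi>"
proof -
  have "Ck_field (Suc 0) \<phi>" using assms unfolding test_fields_def by blast
  then show ?thesis by (simp add: C1_field_def)
qed

lemma test_fields_zero_outside:
  assumes "\<phi> \<in> test_fields \<Omega>" "x \<notin> \<Omega>" shows "\<phi> x = 0" "classical_curl \<phi> x = 0"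
proof -
  let ?U = "- closure (support_on UNIV \<phi>)"
  have U: "x \<in> ?U" using assms by (auto simp: test_fields_def)
  have z: "\<phi> y = 0" if "y \<in> ?U" for y
    using that closure_subset[of "support_on UNIV \<phi>"] by (auto simp: support_on_def)
  show "\<phi> x = 0" using z U by blast
  show "classical_curl \<phi> x = 0"
    by (rule classical_curl_zero_on_open[OF _ U z test_fields_C1_field[OF assms(1)]]) auto
qed

text \<open>
  Boundedness makes square integrable fields integrable and puts \<open>\<Omega>\<close> into a cube; openness gives
  enough test fields.
\<close>

locale bounded_open_set =
  fixes \<Omega> :: "(real^3) set"
  assumes open_set: "open \<Omega>" and bounded_set: "bounded \<Omega>"
begin

lemma lmeasurable: "\<Omega> \<in> lmeasurable"
  using open_set bounded_set by (rule lmeasurable_open[rotated])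

lemma sets_lebesgue: "\<Omega> \<in> sets lebesgue"
  using open_set by simp

lemma radius: obtains R where "\<And>x. x \<in> \<Omega> \<Longrightarrow> norm x \<le> R"
  using bounded_set by (auto simp: bounded_iff)

lemma L2_continuous_zero_outside:
  fixes f :: "real^3 \<Rightarrow> 'b::euclidean_space"
  assumes "continuous_on UNIV f" "\<And>x. x \<notin> \<Omega> \<Longrightarrow> f x = 0"
  shows "f \<in> L2_space \<Omega>" "(norm_L2 \<Omega> f)\<^sup>2 = (LINT x|lborel. (norm (f x))\<^sup>2)"
proof -
  obtain R where R: "\<And>x. x \<in> \<Omega> \<Longrightarrow> norm x \<le> R" using radius by blast
  then have z: "\<forall>x. norm x > R \<longrightarrow> f x = 0" using assms(2) by (meson not_le)
  have "f \<in> borel_measurable (lebesgue_on \<Omega>)"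
    using integrable_lebesgue_on_bounded_support[OF assms(1) z sets_lebesgue] by auto
  moreover have "integrable (lebesgue_on \<Omega>) (\<lambda>x. (norm (f x))\<^sup>2)"
    by (rule integrable_lebesgue_on_bounded_support[of _ R]) (use z sets_lebesgue in \<open>auto intro!: continuous_intros assms(1)\<close>)
  ultimately show "f \<in> L2_space \<Omega>" by (simp add: L2_space_def)
  show "(norm_L2 \<Omega> f)\<^sup>2 = (LINT x|lborel. (norm (f x))\<^sup>2)"
    unfolding norm_L2_squared
    by (rule lebesgue_on_eq_lborel[OF sets_lebesgue])
       (auto intro!: borel_measurable_continuous_onI continuous_intros assms)
qed

lemma test_fields_L2:
  assumes "\<phi> \<in> test_fields \<Omega>" shows "\<phi> \<in> L2_space \<Omega>" "classical_curl \<phi> \<in> L2_space \<Omega>"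
  using assms test_fields_C1_field[OF assms] test_fields_zero_outside[OF assms]
  by (auto intro!: L2_continuous_zero_outside C1_field_continuous continuous_on_classical_curl)

lemma has_weak_curl_test_field:
  assumes "\<phi> \<in> test_fields \<Omega>" shows "has_weak_curl \<Omega> \<phi> (classical_curl \<phi>)"
  unfolding has_weak_curl_def
proof
  fix \<psi> assume \<psi>: "\<psi> \<in> test_fields \<Omega>"
  obtain R where R: "\<And>x. x \<in> \<Omega> \<Longrightarrow> norm x \<le> R" using radius by blast
  note C = test_fields_C1_field[OF assms] test_fields_C1_field[OF \<psi>]
  note cont = C1_field_continuous[OF C(1)] C1_field_continuous[OF C(2)]
     continuous_on_classical_curl[OF C(1)] continuous_on_classical_curl[OF C(2)]
  have "(LINT x|lborel. classical_curl \<phi> x \<bullet> \<psi> x) = (LINT x|lborel. \<phi> x \<bullet> classical_curl \<psi> x)"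
    by (rule integral_classical_curl_by_parts[OF C, of R]) (use R test_fields_zero_outside[OF assms] in \<open>meson not_le\<close>)
  moreover have "(LINT x|lebesgue_on \<Omega>. classical_curl \<phi> x \<bullet> \<psi> x) = (LINT x|lborel. classical_curl \<phi> x \<bullet> \<psi> x)"
    by (rule lebesgue_on_eq_lborel[OF sets_lebesgue])
       (auto intro!: borel_measurable_continuous_onI continuous_intros cont simp: test_fields_zero_outside[OF assms])
  moreover have "(LINT x|lebesgue_on \<Omega>. \<phi> x \<bullet> classical_curl \<psi> x) = (LINT x|lborel. \<phi> x \<bullet> classical_curl \<psi> x)"
    by (rule lebesgue_on_eq_lborel[OF sets_lebesgue])
       (auto intro!: borel_measurable_continuous_onI continuous_intros cont simp: test_fields_zero_outside[OF assms])
  ultimately show "(LINT x|lebesgue_on \<Omega>. classical_curl \<phi> x \<bullet> \<psi> x) = (LINT x|lebesgue_on \<Omega>. \<phi> x \<bullet> classical_curl \<psi> x)"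
    by simp
qed

text \<open>
  The choice made by \<open>weak_curl\<close> is immaterial up to null sets. Linearity of the weak curl, and its
  agreement with the classical curl on test fields, both come from here.
\<close>

lemma has_weak_curl_unique:
  assumes "has_weak_curl \<Omega> v w1" "has_weak_curl \<Omega> v w2" "w1 \<in> L2_space \<Omega>" "w2 \<in> L2_space \<Omega>"
  shows "AE x in lebesgue_on \<Omega>. w1 x = w2 x"
proof -
  have "AE x in lebesgue_on \<Omega>. w1 x - w2 x = 0"
  proof (rule fundamental_lemma_test_fields[OF open_set])
    show "integrable (lebesgue_on \<Omega>) (\<lambda>x. w1 x - w2 x)"
      by (intro Bochner_Integration.integrable_diff L2_imp_integrable[OF lmeasurable] assms(3,4))
    show "(LINT x|lebesgue_on \<Omega>. (w1 x - w2 x) \<bullet> \<phi> x) = 0" if "\<phi> \<in> test_fields \<Omega>" for \<phi>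
      using assms(1,2) that L2_inner_integrable[OF assms(3) test_fields_L2(1)[OF that]]
        L2_inner_integrable[OF assms(4) test_fields_L2(1)[OF that]]
      by (simp add: has_weak_curl_def inner_diff_left)
  qed
  then show ?thesis by simp
qed

lemma weak_curl:
  assumes "v \<in> H_curl \<Omega>" shows "weak_curl \<Omega> v \<in> L2_space \<Omega>" "has_weak_curl \<Omega> v (weak_curl \<Omega> v)"
  using someI_ex[of "\<lambda>w. w \<in> L2_space \<Omega> \<and> has_weak_curl \<Omega> v w"] assms
  unfolding weak_curl_def H_curl_def by auto

lemma H_curl_L2: "v \<in> H_curl \<Omega> \<Longrightarrow> v \<in> L2_space \<Omega>"
  by (simp add: H_curl_def)

lemma H_curlI:
  assumes "v \<in> L2_space \<Omega>" "w \<in> L2_space \<Omega>" "has_weak_curl \<Omega> v w"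
  shows "v \<in> H_curl \<Omega>" "AE x in lebesgue_on \<Omega>. weak_curl \<Omega> v x = w x"
proof -
  show v: "v \<in> H_curl \<Omega>" using assms by (auto simp: H_curl_def)
  show "AE x in lebesgue_on \<Omega>. weak_curl \<Omega> v x = w x"
    by (rule has_weak_curl_unique[OF weak_curl(2)[OF v] assms(3) weak_curl(1)[OF v] assms(2)])
qed

lemma H_curl_test_field:
  assumes "\<phi> \<in> test_fields \<Omega>"
  shows "\<phi> \<in> H_curl \<Omega>" "AE x in lebesgue_on \<Omega>. weak_curl \<Omega> \<phi> x = classical_curl \<phi> x"
  using H_curlI[OF test_fields_L2[OF assms] has_weak_curl_test_field[OF assms]] .

lemma H_curl_lincomb:
  assumes u: "u \<in> H_curl \<Omega>" and v: "v \<in> H_curl \<Omega>"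
  shows "(\<lambda>x. u x + a *\<^sub>R v x) \<in> H_curl \<Omega>"
    "AE x in lebesgue_on \<Omega>. weak_curl \<Omega> (\<lambda>x. u x + a *\<^sub>R v x) x = weak_curl \<Omega> u x + a *\<^sub>R weak_curl \<Omega> v x"
proof -
  note u' = H_curl_L2[OF u] weak_curl[OF u] and v' = H_curl_L2[OF v] weak_curl[OF v]
  have "has_weak_curl \<Omega> (\<lambda>x. u x + a *\<^sub>R v x) (\<lambda>x. weak_curl \<Omega> u x + a *\<^sub>R weak_curl \<Omega> v x)"
    unfolding has_weak_curl_def
  proof
    fix \<phi> assume \<phi>: "\<phi> \<in> test_fields \<Omega>"
    note i = L2_inner_integrable[OF _ test_fields_L2(1)[OF \<phi>]] L2_inner_integrable[OF _ test_fields_L2(2)[OF \<phi>]]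
    show "(LINT x|lebesgue_on \<Omega>. (weak_curl \<Omega> u x + a *\<^sub>R weak_curl \<Omega> v x) \<bullet> \<phi> x) =
       (LINT x|lebesgue_on \<Omega>. (u x + a *\<^sub>R v x) \<bullet> classical_curl \<phi> x)"
      using u'(3) v'(3) \<phi> i(1)[OF u'(2)] i(1)[OF v'(2)] i(2)[OF u'(1)] i(2)[OF v'(1)]
      by (simp add: has_weak_curl_def inner_add_left)
  qed
  from H_curlI[OF L2_space_add[OF u'(1) L2_space_scaleR[OF v'(1)]] L2_space_add[OF u'(2) L2_space_scaleR[OF v'(2)]] this]
  show "(\<lambda>x. u x + a *\<^sub>R v x) \<in> H_curl \<Omega>"
    "AE x in lebesgue_on \<Omega>. weak_curl \<Omega> (\<lambda>x. u x + a *\<^sub>R v x) x = weak_curl \<Omega> u x + a *\<^sub>R weak_curl \<Omega> v x" .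
qed

lemma has_weak_curl_cong_AE:
  assumes "AE x in lebesgue_on \<Omega>. u x = v x" "u \<in> L2_space \<Omega>" "v \<in> L2_space \<Omega>"
  shows "has_weak_curl \<Omega> u w \<longleftrightarrow> has_weak_curl \<Omega> v w"
proof -
  have "(LINT x|lebesgue_on \<Omega>. u x \<bullet> classical_curl \<phi> x) = (LINT x|lebesgue_on \<Omega>. v x \<bullet> classical_curl \<phi> x)"
    if "\<phi> \<in> test_fields \<Omega>" for \<phi>
    using L2_inner_integrable[OF assms(2) test_fields_L2(2)[OF that]]
      L2_inner_integrable[OF assms(3) test_fields_L2(2)[OF that]] assms(1)
    by (intro integral_cong_AE) (auto elim!: eventually_mono)
  then show ?thesis by (simp add: has_weak_curl_def)
qed

text \<open>
  Equality of the weak curls is literal: fields that agree almost everywhere have the same set of weak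
  curls to choose from.
\<close>

lemma weak_curl_cong_AE:
  assumes "AE x in lebesgue_on \<Omega>. u x = v x" "u \<in> H_curl \<Omega>"
  shows "v \<in> H_curl \<Omega>" "weak_curl \<Omega> v = weak_curl \<Omega> u"
proof -
  have v: "v \<in> L2_space \<Omega>" by (rule L2_cong_AE[OF sets_lebesgue assms(1) H_curl_L2[OF assms(2)]])
  note c = has_weak_curl_cong_AE[OF assms(1) H_curl_L2[OF assms(2)] v]
  show "v \<in> H_curl \<Omega>" using assms(2) v c by (auto simp: H_curl_def)
  show "weak_curl \<Omega> v = weak_curl \<Omega> u" by (simp add: weak_curl_def c)
qed

text \<open>
  As the norm of a pair of fields, the graph norm inherits the triangle inequality and
  homogeneity.
\<close>

lemma norm_H_curl_eq_norm_L2: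
  assumes "v \<in> H_curl \<Omega>" shows "norm_H_curl \<Omega> v = norm_L2 \<Omega> (\<lambda>x. (v x, weak_curl \<Omega> v x))"
  unfolding norm_H_curl_def using norm_L2_Pair[OF H_curl_L2[OF assms] weak_curl(1)[OF assms]] by simp

lemma norm_H_curl_lincomb_le:
  assumes u: "u \<in> H_curl \<Omega>" and v: "v \<in> H_curl \<Omega>"
  shows "norm_H_curl \<Omega> (\<lambda>x. u x + a *\<^sub>R v x) \<le> norm_H_curl \<Omega> u + \<bar>a\<bar> * norm_H_curl \<Omega> v"
proof -
  let ?u = "\<lambda>x. (u x, weak_curl \<Omega> u x)" and ?v = "\<lambda>x. (v x, weak_curl \<Omega> v x)"
  note uv = H_curl_lincomb[OF u v, of a]
  have L2: "(\<lambda>x. (z x, weak_curl \<Omega> z x)) \<in> L2_space \<Omega>" if "z \<in> H_curl \<Omega>" for z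
    using that by (intro L2_space_Pair H_curl_L2 weak_curl)
  have L2': "(\<lambda>x. ?u x + a *\<^sub>R ?v x) \<in> L2_space \<Omega>" by (intro L2_space_add L2_space_scaleR L2 u v)
  have "norm_H_curl \<Omega> (\<lambda>x. u x + a *\<^sub>R v x) = norm_L2 \<Omega> (\<lambda>x. ?u x + a *\<^sub>R ?v x)"
    unfolding norm_H_curl_eq_norm_L2[OF uv(1)]
    by (rule norm_L2_cong_AE[OF _ L2[OF uv(1)] L2']) (use uv(2) in \<open>auto elim!: eventually_mono\<close>)
  also have "\<dots> \<le> norm_L2 \<Omega> ?u + \<bar>a\<bar> * norm_L2 \<Omega> ?v"
    using norm_L2_triangle[OF L2[OF u] L2_space_scaleR[OF L2[OF v]], of a] unfolding norm_L2_scaleR .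
  finally show ?thesis by (simp add: norm_H_curl_eq_norm_L2 u v)
qed

lemma H0_curl_H_curl: "v \<in> H0_curl \<Omega> \<Longrightarrow> v \<in> H_curl \<Omega>"
  by (simp add: H0_curl_def)

lemma H0_curl_lincomb:
  assumes u: "u \<in> H0_curl \<Omega>" and v: "v \<in> H0_curl \<Omega>"
  shows "(\<lambda>x. u x + a *\<^sub>R v x) \<in> H0_curl \<Omega>"
proof -
  have "\<exists>\<phi>\<in>test_fields \<Omega>. norm_H_curl \<Omega> (\<lambda>x. (u x + a *\<^sub>R v x) - \<phi> x) < e" if e: "e > 0" for e
  proof -
    define d where "d = e / (2 * (1 + \<bar>a\<bar>))"
    have d: "d > 0" using e by (simp add: d_def)
    obtain \<phi> \<psi> where \<phi>: "\<phi> \<in> test_fields \<Omega>" "norm_H_curl \<Omega> (\<lambda>x. u x - \<phi> x) < d"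
      and \<psi>: "\<psi> \<in> test_fields \<Omega>" "norm_H_curl \<Omega> (\<lambda>x. v x - \<psi> x) < d"
      using u v d unfolding H0_curl_def by blast
    have mem: "(\<lambda>x. u x - \<phi> x) \<in> H_curl \<Omega>" "(\<lambda>x. v x - \<psi> x) \<in> H_curl \<Omega>"
      using H_curl_lincomb(1)[OF H0_curl_H_curl[OF u] H_curl_test_field(1)[OF \<phi>(1)], of "-1"]
        H_curl_lincomb(1)[OF H0_curl_H_curl[OF v] H_curl_test_field(1)[OF \<psi>(1)], of "-1"] by simp_all
    have "norm_H_curl \<Omega> (\<lambda>x. (u x - \<phi> x) + a *\<^sub>R (v x - \<psi> x)) \<le> d + \<bar>a\<bar> * d"
      using norm_H_curl_lincomb_le[OF mem, of a] \<phi>(2) \<psi>(2) mult_left_mono[OF less_imp_le[OF \<psi>(2)], of "\<bar>a\<bar>"] by linarith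
    also have "\<dots> = d * (1 + \<bar>a\<bar>)" by (simp add: algebra_simps)
    also have "\<dots> = e / 2"
    proof -
      have "1 + \<bar>a\<bar> \<noteq> 0" using abs_ge_zero[of a] by linarith
      then show ?thesis unfolding d_def by (metis divide_divide_eq_left nonzero_eq_divide_eq)
    qed
    also have "\<dots> < e" using e by simp
    also have "(\<lambda>x. (u x - \<phi> x) + a *\<^sub>R (v x - \<psi> x)) = (\<lambda>x. (u x + a *\<^sub>R v x) - (\<phi> x + a *\<^sub>R \<psi> x))"
      by (simp add: algebra_simps)
    finally show ?thesis by (rule bexI[OF _ test_fields_lincomb[OF \<phi>(1) \<psi>(1)]])
  qed
  then show ?thesis using H_curl_lincomb(1)[OF H0_curl_H_curl[OF u] H0_curl_H_curl[OF v]] by (simp add: H0_curl_def)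
qed

lemma norm_H_curl_zero: "norm_H_curl \<Omega> (\<lambda>x. 0) = 0"
proof -
  have z: "(\<lambda>x. 0) \<in> H_curl \<Omega>" by (rule H_curl_test_field(1)[OF test_fields_zero])
  have "AE x in lebesgue_on \<Omega>. weak_curl \<Omega> (\<lambda>x. 0) x = 0"
    using H_curl_lincomb(2)[OF z z, of 1] by simp
  then have "norm_L2 \<Omega> (weak_curl \<Omega> (\<lambda>x. 0)) = 0"
    using norm_L2_eq_0_iff[OF weak_curl(1)[OF z]] by simp
  then show ?thesis by (simp add: norm_H_curl_def norm_L2_def)
qed

lemma test_fields_H0_curl: "\<phi> \<in> test_fields \<Omega> \<Longrightarrow> \<phi> \<in> H0_curl \<Omega>"
  unfolding H0_curl_def using H_curl_test_field(1) norm_H_curl_zero by (auto intro!: bexI[of _ \<phi>])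

lemma H0_curl_zero: "(\<lambda>x. 0) \<in> H0_curl \<Omega>"
  by (rule test_fields_H0_curl[OF test_fields_zero])

lemma H0_curl_cong_AE:
  assumes "AE x in lebesgue_on \<Omega>. u x = v x" "u \<in> H0_curl \<Omega>"
  shows "v \<in> H0_curl \<Omega>"
proof -
  note u = H0_curl_H_curl[OF assms(2)]
  note v = weak_curl_cong_AE[OF assms(1) u]
  have "norm_H_curl \<Omega> (\<lambda>x. v x - \<phi> x) = norm_H_curl \<Omega> (\<lambda>x. u x - \<phi> x)" if "\<phi> \<in> test_fields \<Omega>" for \<phi>
  proof -
    have ae: "AE x in lebesgue_on \<Omega>. u x - \<phi> x = v x - \<phi> x" using assms(1) by eventually_elim simp
    have m: "(\<lambda>x. u x - \<phi> x) \<in> H_curl \<Omega>"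
      using H_curl_lincomb(1)[OF u H_curl_test_field(1)[OF that], of "-1"] by simp
    note c = weak_curl_cong_AE[OF ae m]
    show ?thesis unfolding norm_H_curl_def c(2)
      using norm_L2_cong_AE[OF ae H_curl_L2[OF m] H_curl_L2[OF c(1)]] by simp
  qed
  then show ?thesis using assms(2) v(1) by (auto simp: H0_curl_def)
qed
end

section \<open>Tensor fields and the equivalence of norms\<close>

text \<open>
  Both norms of the theorem in one: \<open>T\<close> is the identity for the norm of \<open>H(Curl)\<close> and \<open>sym_part\<close> for
  the other one.
\<close>

definition seminorm_Curl :: "(real^3^3 \<Rightarrow> real^3^3) \<Rightarrow> (real^3) set \<Rightarrow> (real^3 \<Rightarrow> real^3^3) \<Rightarrow> real" where
  "seminorm_Curl T \<Omega> P = sqrt ((norm_L2 \<Omega> (\<lambda>x. T (P x)))\<^sup>2 + (norm_L2 \<Omega> (weak_Curl \<Omega> P))\<^sup>2)"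

lemma norm_sym_part_le: "norm (sym_part A) \<le> norm A"
proof -
  have "norm (transpose A) = norm A" for A :: "real^3^3"
    by (rule power2_eq_imp_eq) (simp_all add: norm_sq_matrix3 transpose_def)
  then show ?thesis
    using norm_triangle_ineq[of A "transpose A"] by (simp add: sym_part_def)
qed

context bounded_open_set
begin

lemma H0_CurlD: "P \<in> H0_Curl \<Omega> \<Longrightarrow> (\<lambda>x. P x $ i) \<in> H0_curl \<Omega>"
  by (simp add: H0_Curl_def row_eq_nth)

lemma weak_Curl_nth: "weak_Curl \<Omega> P x $ i = weak_curl \<Omega> (\<lambda>y. P y $ i) x"
  by (simp add: weak_Curl_def row_eq_nth)

lemma H0_Curl_L2:
  assumes "P \<in> H0_Curl \<Omega>" shows "P \<in> L2_space \<Omega>" "weak_Curl \<Omega> P \<in> L2_space \<Omega>"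
  by (rule L2_space_vec; use weak_curl(1)[OF H0_curl_H_curl[OF H0_CurlD[OF assms]]]
      H_curl_L2[OF H0_curl_H_curl[OF H0_CurlD[OF assms]]] in \<open>simp add: weak_Curl_nth\<close>)+

lemma H0_Curl_lincomb:
  assumes P: "P \<in> H0_Curl \<Omega>" and Q: "Q \<in> H0_Curl \<Omega>"
  shows "(\<lambda>x. P x + a *\<^sub>R Q x) \<in> H0_Curl \<Omega>"
    "AE x in lebesgue_on \<Omega>. weak_Curl \<Omega> (\<lambda>x. P x + a *\<^sub>R Q x) x = weak_Curl \<Omega> P x + a *\<^sub>R weak_Curl \<Omega> Q x"
proof -
  show "(\<lambda>x. P x + a *\<^sub>R Q x) \<in> H0_Curl \<Omega>"
    using H0_curl_lincomb[OF H0_CurlD[OF P] H0_CurlD[OF Q], where a=a]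
    by (simp add: H0_Curl_def row_eq_nth)
  have "AE x in lebesgue_on \<Omega>. \<forall>i. weak_Curl \<Omega> (\<lambda>x. P x + a *\<^sub>R Q x) x $ i = (weak_Curl \<Omega> P x + a *\<^sub>R weak_Curl \<Omega> Q x) $ i"
    unfolding AE_all_countable
    using H_curl_lincomb(2)[OF H0_curl_H_curl[OF H0_CurlD[OF P]] H0_curl_H_curl[OF H0_CurlD[OF Q]], where a=a]
    by (simp add: weak_Curl_nth)
  then show "AE x in lebesgue_on \<Omega>. weak_Curl \<Omega> (\<lambda>x. P x + a *\<^sub>R Q x) x = weak_Curl \<Omega> P x + a *\<^sub>R weak_Curl \<Omega> Q x"
    by eventually_elim (rule vec_eq_iff[THEN iffD2])
qed

lemma H0_Curl_zero: "(\<lambda>x. 0) \<in> H0_Curl \<Omega>"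
  using H0_curl_zero by (simp add: H0_Curl_def row_eq_nth)

lemma H0_Curl_cong_AE:
  assumes "AE x in lebesgue_on \<Omega>. P x = Q x" "P \<in> H0_Curl \<Omega>"
  shows "Q \<in> H0_Curl \<Omega>" "weak_Curl \<Omega> Q = weak_Curl \<Omega> P"
proof -
  have ae: "AE x in lebesgue_on \<Omega>. P x $ i = Q x $ i" for i using assms(1) by eventually_elim simp
  show "Q \<in> H0_Curl \<Omega>"
    using H0_curl_cong_AE[OF ae H0_CurlD[OF assms(2)]] by (simp add: H0_Curl_def row_eq_nth)
  show "weak_Curl \<Omega> Q = weak_Curl \<Omega> P"
    using weak_curl_cong_AE(2)[OF ae H0_curl_H_curl[OF H0_CurlD[OF assms(2)]]]
    by (simp add: weak_Curl_def row_eq_nth fun_eq_iff)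
qed

lemma seminorm_Curl_eq_norm_L2:
  assumes "bounded_linear T" "P \<in> H0_Curl \<Omega>"
  shows "seminorm_Curl T \<Omega> P = norm_L2 \<Omega> (\<lambda>x. (T (P x), weak_Curl \<Omega> P x))"
    "(\<lambda>x. (T (P x), weak_Curl \<Omega> P x)) \<in> L2_space \<Omega>"
  using norm_L2_Pair[OF L2_space_bounded_linear[OF assms(1) H0_Curl_L2(1)[OF assms(2)]] H0_Curl_L2(2)[OF assms(2)]]
    L2_space_Pair[OF L2_space_bounded_linear[OF assms(1) H0_Curl_L2(1)[OF assms(2)]] H0_Curl_L2(2)[OF assms(2)]]
  by (simp_all add: seminorm_Curl_def)

lemma seminorm_Curl_lincomb_eq:
  assumes T: "bounded_linear T" and P: "P \<in> H0_Curl \<Omega>" and Q: "Q \<in> H0_Curl \<Omega>"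
  shows "seminorm_Curl T \<Omega> (\<lambda>x. P x + a *\<^sub>R Q x) =
    norm_L2 \<Omega> (\<lambda>x. (T (P x), weak_Curl \<Omega> P x) + a *\<^sub>R (T (Q x), weak_Curl \<Omega> Q x))"
proof -
  note PQ = H0_Curl_lincomb[OF P Q, of a]
  have lin: "T (P x + a *\<^sub>R Q x) = T (P x) + a *\<^sub>R T (Q x)" for x
    using linear_add[OF bounded_linear.linear[OF T]] linear_cmul[OF bounded_linear.linear[OF T]] by simp
  show ?thesis unfolding seminorm_Curl_eq_norm_L2(1)[OF T PQ(1)]
  proof (rule norm_L2_cong_AE[OF _ seminorm_Curl_eq_norm_L2(2)[OF T PQ(1)]])
    show "AE x in lebesgue_on \<Omega>. (T (P x + a *\<^sub>R Q x), weak_Curl \<Omega> (\<lambda>x. P x + a *\<^sub>R Q x) x) =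
       (T (P x), weak_Curl \<Omega> P x) + a *\<^sub>R (T (Q x), weak_Curl \<Omega> Q x)"
      using PQ(2) by eventually_elim (simp add: lin)
    show "(\<lambda>x. (T (P x), weak_Curl \<Omega> P x) + a *\<^sub>R (T (Q x), weak_Curl \<Omega> Q x)) \<in> L2_space \<Omega>"
      by (intro L2_space_add L2_space_scaleR seminorm_Curl_eq_norm_L2 T P Q)
  qed
qed

lemma seminorm_Curl_triangle:
  assumes T: "bounded_linear T" and P: "P \<in> H0_Curl \<Omega>" and Q: "Q \<in> H0_Curl \<Omega>"
  shows "seminorm_Curl T \<Omega> (\<lambda>x. P x + a *\<^sub>R Q x) \<le> seminorm_Curl T \<Omega> P + \<bar>a\<bar> * seminorm_Curl T \<Omega> Q"
  unfolding seminorm_Curl_lincomb_eq[OF assms] seminorm_Curl_eq_norm_L2(1)[OF T P] seminorm_Curl_eq_norm_L2(1)[OF T Q]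
    norm_L2_scaleR[symmetric]
  by (intro norm_L2_triangle L2_space_scaleR seminorm_Curl_eq_norm_L2 T P Q)

lemma seminorm_Curl_zero:
  assumes T: "bounded_linear T" and P: "P \<in> H0_Curl \<Omega>" "AE x in lebesgue_on \<Omega>. P x = 0"
  shows "seminorm_Curl T \<Omega> P = 0"
proof -
  note z = H0_Curl_zero
  have "seminorm_Curl T \<Omega> (\<lambda>x. 0) = 0"
    using seminorm_Curl_lincomb_eq[OF T z z, of "-1"] by (simp add: norm_L2_def)
  moreover have "AE x in lebesgue_on \<Omega>. 0 = P x" using P(2) by eventually_elim simp
  note c = H0_Curl_cong_AE[OF this z]
  have "AE x in lebesgue_on \<Omega>. (T 0, weak_Curl \<Omega> P x) = (T (P x), weak_Curl \<Omega> P x)"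
    using P(2) by eventually_elim simp
  then have "norm_L2 \<Omega> (\<lambda>x. (T 0, weak_Curl \<Omega> P x)) = norm_L2 \<Omega> (\<lambda>x. (T (P x), weak_Curl \<Omega> P x))"
    using seminorm_Curl_eq_norm_L2(2)[OF T z] seminorm_Curl_eq_norm_L2(2)[OF T P(1)] unfolding c(2)[symmetric]
    by (intro norm_L2_cong_AE) simp_all
  ultimately show ?thesis
    unfolding seminorm_Curl_eq_norm_L2(1)[OF T P(1)] seminorm_Curl_eq_norm_L2(1)[OF T z] c(2) by simp
qed

text \<open>
  Everything but definiteness holds for any bounded linear map \<open>T\<close>.
\<close>

lemma ae_norm_on_seminorm_Curl:
  assumes T: "bounded_linear T"
    and definite: "\<And>P. P \<in> H0_Curl \<Omega> \<Longrightarrow> seminorm_Curl T \<Omega> P = 0 \<Longrightarrow> norm_L2 \<Omega> P = 0"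
  shows "ae_norm_on (lebesgue_on \<Omega>) (H0_Curl \<Omega>) (seminorm_Curl T \<Omega>)"
  unfolding ae_norm_on_def
proof (intro conjI ballI allI impI)
  show "(\<lambda>x. 0) \<in> H0_Curl \<Omega>" by (rule H0_Curl_zero)
  fix P assume P: "P \<in> H0_Curl \<Omega>"
  show "seminorm_Curl T \<Omega> P \<ge> 0" by (simp add: seminorm_Curl_def)
  show "seminorm_Curl T \<Omega> P = 0 \<longleftrightarrow> (AE x in lebesgue_on \<Omega>. P x = 0)"
    using definite[OF P] seminorm_Curl_zero[OF T P] norm_L2_eq_0_iff[OF H0_Curl_L2(1)[OF P]] by blast
  show "(\<lambda>x. a *\<^sub>R P x) \<in> H0_Curl \<Omega>" for a
    using H0_Curl_lincomb(1)[OF H0_Curl_zero P, of a] by simp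
  \<comment> \<open>The weak curl of the zero field is a chosen representative and need only vanish almost everywhere.\<close>
  have z0: "AE x in lebesgue_on \<Omega>. (T 0, weak_Curl \<Omega> (\<lambda>x. 0) x) = 0"
    using seminorm_Curl_zero[OF T H0_Curl_zero]
    unfolding seminorm_Curl_eq_norm_L2(1)[OF T H0_Curl_zero] norm_L2_eq_0_iff[OF seminorm_Curl_eq_norm_L2(2)[OF T H0_Curl_zero]]
    by simp
  show "seminorm_Curl T \<Omega> (\<lambda>x. a *\<^sub>R P x) = \<bar>a\<bar> * seminorm_Curl T \<Omega> P" for a
  proof -
    have "seminorm_Curl T \<Omega> (\<lambda>x. a *\<^sub>R P x) = norm_L2 \<Omega> (\<lambda>x. (T 0, weak_Curl \<Omega> (\<lambda>x. 0) x) + a *\<^sub>R (T (P x), weak_Curl \<Omega> P x))"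
      using seminorm_Curl_lincomb_eq[OF T H0_Curl_zero P, of a] by simp
    also have "\<dots> = norm_L2 \<Omega> (\<lambda>x. a *\<^sub>R (T (P x), weak_Curl \<Omega> P x))"
    proof (rule norm_L2_cong_AE)
      show "AE x in lebesgue_on \<Omega>. (T 0, weak_Curl \<Omega> (\<lambda>x. 0) x) + a *\<^sub>R (T (P x), weak_Curl \<Omega> P x) = a *\<^sub>R (T (P x), weak_Curl \<Omega> P x)"
        using z0 by eventually_elim simp
    qed (intro L2_space_add L2_space_scaleR seminorm_Curl_eq_norm_L2(2)[OF T] H0_Curl_zero P)+
    also have "\<dots> = \<bar>a\<bar> * seminorm_Curl T \<Omega> P" unfolding norm_L2_scaleR seminorm_Curl_eq_norm_L2(1)[OF T P] ..
    finally show ?thesis .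
  qed
  fix Q
  show "seminorm_Curl T \<Omega> (\<lambda>x. P x + Q x) \<le> seminorm_Curl T \<Omega> P + seminorm_Curl T \<Omega> Q" if "Q \<in> H0_Curl \<Omega>"
    using seminorm_Curl_triangle[OF T P that, of 1] by simp
  show "(\<lambda>x. P x + Q x) \<in> H0_Curl \<Omega>" if "Q \<in> H0_Curl \<Omega>"
    using H0_Curl_lincomb(1)[OF P that, of 1] by simp
  assume ae: "AE x in lebesgue_on \<Omega>. P x = Q x"
  note c = H0_Curl_cong_AE[OF ae P]
  show "Q \<in> H0_Curl \<Omega>" by (rule c(1))
  have "AE x in lebesgue_on \<Omega>. (T (Q x), weak_Curl \<Omega> P x) = (T (P x), weak_Curl \<Omega> P x)"
    using ae by eventually_elim simp
  then show "seminorm_Curl T \<Omega> Q = seminorm_Curl T \<Omega> P"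
    using seminorm_Curl_eq_norm_L2(2)[OF T P] seminorm_Curl_eq_norm_L2(2)[OF T c(1)]
    unfolding seminorm_Curl_eq_norm_L2(1)[OF T P] seminorm_Curl_eq_norm_L2(1)[OF T c(1)] c(2)
    by (intro norm_L2_cong_AE) simp_all
qed

text \<open>
  The side \<open>2 \<pi> L\<close> is chosen such that the cube contains \<open>\<Omega>\<close> in its interior and has at least twice
  its volume.
\<close>

lemma sym_Curl_inequality_test_fields:
  "\<exists>C\<ge>0. \<forall>\<Phi>. (\<forall>i. (\<lambda>x. \<Phi> x $ i) \<in> test_fields \<Omega>) \<longrightarrow>
     (norm_L2 \<Omega> \<Phi>)\<^sup>2 \<le> C * ((norm_L2 \<Omega> (\<lambda>x. sym_part (\<Phi> x)))\<^sup>2 + (norm_L2 \<Omega> (classical_Curl \<Phi>))\<^sup>2)"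
proof -
  obtain R where R: "\<And>x. x \<in> \<Omega> \<Longrightarrow> norm x \<le> R" using radius by blast
  define L where "L = 1 + \<bar>R\<bar> + measure lebesgue \<Omega>"
  have L1: "L \<ge> 1" by (simp add: L_def)
  have pi1: "pi * L \<ge> L" using L1 pi_ge_two mult_right_mono[of 1 pi L] by simp
  have "R < L" using abs_ge_self[of R] measure_nonneg[of lebesgue \<Omega>] unfolding L_def by linarith
  then have piR: "pi * L > R" using pi1 by linarith
  have vol: "2 * measure lebesgue \<Omega> \<le> measure lebesgue (cube L :: (real^3) set)"
  proof -
    have "2 * measure lebesgue \<Omega> \<le> 2 * pi * L" using pi1 by (simp add: L_def)
    also have "\<dots> \<le> (2 * pi * L) ^ 3" by (rule self_le_power) (use pi1 L1 in linarith, simp)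
    finally show ?thesis using L1 by (simp add: measure_cube)
  qed
  show ?thesis
  proof (intro exI[of _ "10 + 8 * L\<^sup>2"] conjI allI impI)
    fix \<Phi> :: "real^3 \<Rightarrow> real^3^3" assume \<Phi>: "\<forall>i. (\<lambda>x. \<Phi> x $ i) \<in> test_fields \<Omega>"
    have C1: "C1_field (\<lambda>x. row i (\<Phi> x))" for i
      using test_fields_C1_field[OF \<Phi>[rule_format]] by (simp add: row_eq_nth)
    have out: "\<Phi> x = 0" "classical_Curl \<Phi> x = 0" if "x \<notin> \<Omega>" for x
      using test_fields_zero_outside[OF \<Phi>[rule_format] that] by (simp_all add: vec_eq_iff classical_Curl_def row_eq_nth)
    note L = sym_Curl_inequality_C1[OF C1 lmeasurable out(1) R _ piR vol]
    have n: "(norm_L2 \<Omega> \<Phi>)\<^sup>2 = (LINT x|lborel. (norm (\<Phi> x))\<^sup>2)"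
      "(norm_L2 \<Omega> (\<lambda>x. sym_part (\<Phi> x)))\<^sup>2 = (LINT x|lborel. (norm (sym_part (\<Phi> x)))\<^sup>2)"
      "(norm_L2 \<Omega> (classical_Curl \<Phi>))\<^sup>2 = (LINT x|lborel. (norm (classical_Curl \<Phi> x))\<^sup>2)"
      using out linear_0[OF linear_sym_part]
      by (intro L2_continuous_zero_outside(2) continuous_on_rows[OF C1] continuous_on_classical_Curl[OF C1]
           bounded_linear.continuous_on[OF bounded_linear_sym_part]; simp)+
    have "(norm_L2 \<Omega> \<Phi>)\<^sup>2 \<le> 10 * (norm_L2 \<Omega> (\<lambda>x. sym_part (\<Phi> x)))\<^sup>2 + 8 * L\<^sup>2 * (norm_L2 \<Omega> (classical_Curl \<Phi>))\<^sup>2"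
      unfolding n by (rule L) (use L1 in auto)
    also have "\<dots> \<le> (10 + 8 * L\<^sup>2) * ((norm_L2 \<Omega> (\<lambda>x. sym_part (\<Phi> x)))\<^sup>2 + (norm_L2 \<Omega> (classical_Curl \<Phi>))\<^sup>2)"
      by (simp add: distrib_right distrib_left)
    finally show "(norm_L2 \<Omega> \<Phi>)\<^sup>2 \<le> (10 + 8 * L\<^sup>2) * ((norm_L2 \<Omega> (\<lambda>x. sym_part (\<Phi> x)))\<^sup>2 + (norm_L2 \<Omega> (classical_Curl \<Phi>))\<^sup>2)" .
  qed simp
qed

text \<open>
  The three rows are approximated separately; the factor \<open>2\<close> is a convenient bound for \<open>sqrt 3\<close>.
\<close>

lemma H0_Curl_approximation:
  assumes P: "P \<in> H0_Curl \<Omega>" and e: "e > 0"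
  obtains \<Phi> where "\<And>i. (\<lambda>x. \<Phi> x $ i) \<in> test_fields \<Omega>" "seminorm_Curl (\<lambda>A. A) \<Omega> (\<lambda>x. P x + (-1) *\<^sub>R \<Phi> x) \<le> 2 * e"
proof -
  have "\<exists>\<phi>\<in>test_fields \<Omega>. norm_H_curl \<Omega> (\<lambda>x. P x $ i - \<phi> x) < e" for i
    using H0_CurlD[OF P] e by (simp add: H0_curl_def)
  then obtain \<phi> where \<phi>: "\<And>i. \<phi> i \<in> test_fields \<Omega>" "\<And>i. norm_H_curl \<Omega> (\<lambda>x. P x $ i - \<phi> i x) < e"
    by metis
  define \<Phi> where "\<Phi> x = (\<chi> i. \<phi> i x)" for x
  have \<Phi>: "(\<lambda>x. \<Phi> x $ i) \<in> test_fields \<Omega>" for i using \<phi>(1) by (simp add: \<Phi>_def)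
  then have "\<Phi> \<in> H0_Curl \<Omega>" by (simp add: H0_Curl_def row_eq_nth test_fields_H0_curl)
  note D = H0_Curl_lincomb(1)[OF P this, of "-1"]
  let ?D = "\<lambda>x. P x + (-1) *\<^sub>R \<Phi> x"
  have rowD: "(\<lambda>x. ?D x $ i) = (\<lambda>x. P x $ i - \<phi> i x)" for i by (simp add: \<Phi>_def)
  have L2: "(\<lambda>x. ?D x $ i) \<in> L2_space \<Omega>" "(\<lambda>x. weak_Curl \<Omega> ?D x $ i) \<in> L2_space \<Omega>" for i
    using H_curl_L2[OF H0_curl_H_curl[OF H0_CurlD[OF D]]] weak_curl(1)[OF H0_curl_H_curl[OF H0_CurlD[OF D]]]
    by (simp_all add: weak_Curl_nth)
  have "(seminorm_Curl (\<lambda>A. A) \<Omega> ?D)\<^sup>2 = (norm_L2 \<Omega> ?D)\<^sup>2 + (norm_L2 \<Omega> (weak_Curl \<Omega> ?D))\<^sup>2"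
    by (simp add: seminorm_Curl_def)
  also have "\<dots> = (\<Sum>i\<in>UNIV. (norm_L2 \<Omega> (\<lambda>x. ?D x $ i))\<^sup>2 + (norm_L2 \<Omega> (\<lambda>x. weak_Curl \<Omega> ?D x $ i))\<^sup>2)"
    unfolding norm_L2_vec_squared[OF L2(1)] norm_L2_vec_squared[OF L2(2)] by (rule sum.distrib[symmetric])
  also have "\<dots> = (\<Sum>i\<in>UNIV. (norm_H_curl \<Omega> (\<lambda>x. P x $ i - \<phi> i x))\<^sup>2)"
    unfolding weak_Curl_nth rowD by (simp add: norm_H_curl_def)
  also have "\<dots> \<le> (\<Sum>i\<in>(UNIV::3 set). e\<^sup>2)"
    by (intro sum_mono power_mono less_imp_le[OF \<phi>(2)]) (simp add: norm_H_curl_def)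
  also have "\<dots> \<le> (2 * e)\<^sup>2" by simp
  finally have "seminorm_Curl (\<lambda>A. A) \<Omega> ?D \<le> 2 * e" by (rule power2_le_imp_le) (use e in simp)
  with \<Phi> that show ?thesis by blast
qed

lemma seminorm_Curl_sym_part_le:
  assumes "P \<in> H0_Curl \<Omega>"
  shows "norm_L2 \<Omega> (\<lambda>x. sym_part (P x)) \<le> norm_L2 \<Omega> P" "seminorm_Curl sym_part \<Omega> P \<le> seminorm_Curl (\<lambda>A. A) \<Omega> P"
proof -
  note L2 = H0_Curl_L2(1)[OF assms]
  show le: "norm_L2 \<Omega> (\<lambda>x. sym_part (P x)) \<le> norm_L2 \<Omega> P"
    unfolding norm_L2_def
    by (intro real_sqrt_le_mono integral_mono L2_spaceD L2 L2_space_bounded_linear[OF bounded_linear_sym_part] power_mono norm_sym_part_le) simp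
  then show "seminorm_Curl sym_part \<Omega> P \<le> seminorm_Curl (\<lambda>A. A) \<Omega> P"
    unfolding seminorm_Curl_def by (intro real_sqrt_le_mono add_right_mono power_mono norm_L2_nonneg)
qed

lemma norm_L2_le_seminorm_Curl: "norm_L2 \<Omega> P \<le> seminorm_Curl (\<lambda>A. A) \<Omega> P"
  unfolding seminorm_Curl_def by (rule real_sqrt_sum_squares_ge1)

text \<open>
  Both sides are continuous in the graph norm, so the estimate passes from test fields to their
  closure.
\<close>

lemma sym_Curl_inequality:
  "\<exists>K\<ge>0. \<forall>P\<in>H0_Curl \<Omega>. norm_L2 \<Omega> P \<le> K * seminorm_Curl sym_part \<Omega> P"
proof -
  obtain C where C: "C \<ge> 0" "\<And>\<Phi>. (\<And>i. (\<lambda>x. \<Phi> x $ i) \<in> test_fields \<Omega>) \<Longrightarrow>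
     (norm_L2 \<Omega> \<Phi>)\<^sup>2 \<le> C * ((norm_L2 \<Omega> (\<lambda>x. sym_part (\<Phi> x)))\<^sup>2 + (norm_L2 \<Omega> (classical_Curl \<Phi>))\<^sup>2)"
    using sym_Curl_inequality_test_fields by blast
  have test: "norm_L2 \<Omega> \<Phi> \<le> sqrt C * seminorm_Curl sym_part \<Omega> \<Phi>" if \<Phi>: "\<And>i. (\<lambda>x. \<Phi> x $ i) \<in> test_fields \<Omega>" for \<Phi>
  proof -
    have m: "\<Phi> \<in> H0_Curl \<Omega>" using \<Phi> by (simp add: H0_Curl_def row_eq_nth test_fields_H0_curl)
    have "AE x in lebesgue_on \<Omega>. \<forall>i. weak_Curl \<Omega> \<Phi> x $ i = classical_Curl \<Phi> x $ i"
      unfolding AE_all_countable using H_curl_test_field(2)[OF \<Phi>] by (simp add: weak_Curl_nth classical_Curl_def row_eq_nth)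
    then have ae: "AE x in lebesgue_on \<Omega>. weak_Curl \<Omega> \<Phi> x = classical_Curl \<Phi> x"
      by eventually_elim (simp add: vec_eq_iff)
    have "norm_L2 \<Omega> (weak_Curl \<Omega> \<Phi>) = norm_L2 \<Omega> (classical_Curl \<Phi>)"
      by (rule norm_L2_cong_AE[OF ae H0_Curl_L2(2)[OF m] L2_cong_AE[OF sets_lebesgue ae H0_Curl_L2(2)[OF m]]])
    then have "(norm_L2 \<Omega> \<Phi>)\<^sup>2 \<le> (sqrt C * seminorm_Curl sym_part \<Omega> \<Phi>)\<^sup>2"
      using C(2)[OF \<Phi>] C(1) by (simp add: power_mult_distrib seminorm_Curl_def)
    then show ?thesis by (rule power2_le_imp_le) (simp add: C(1) seminorm_Curl_def)
  qed
  have "norm_L2 \<Omega> P \<le> sqrt C * seminorm_Curl sym_part \<Omega> P" if P: "P \<in> H0_Curl \<Omega>" for P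
  proof (rule field_le_epsilon)
    fix \<epsilon> :: real assume \<epsilon>: "\<epsilon> > 0"
    define e where "e = \<epsilon> / (2 * (1 + sqrt C))"
    have sC: "1 + sqrt C > 0" using real_sqrt_ge_zero[OF C(1)] by linarith
    have e: "e > 0" using \<epsilon> sC by (simp add: e_def)
    obtain \<Phi> where \<Phi>: "\<And>i. (\<lambda>x. \<Phi> x $ i) \<in> test_fields \<Omega>"
      and D: "seminorm_Curl (\<lambda>A. A) \<Omega> (\<lambda>x. P x + (-1) *\<^sub>R \<Phi> x) \<le> 2 * e"
      using H0_Curl_approximation[OF P e] by blast
    have m: "\<Phi> \<in> H0_Curl \<Omega>" using \<Phi> by (simp add: H0_Curl_def row_eq_nth test_fields_H0_curl)
    note Dm = H0_Curl_lincomb(1)[OF P m, of "-1"]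
    have "norm_L2 \<Omega> P \<le> norm_L2 \<Omega> \<Phi> + norm_L2 \<Omega> (\<lambda>x. P x + (-1) *\<^sub>R \<Phi> x)"
      using norm_L2_triangle[OF H0_Curl_L2(1)[OF m] H0_Curl_L2(1)[OF Dm]] by simp
    also have "\<dots> \<le> sqrt C * seminorm_Curl sym_part \<Omega> \<Phi> + 2 * e"
      using test[OF \<Phi>] norm_L2_le_seminorm_Curl[of "\<lambda>x. P x + (-1) *\<^sub>R \<Phi> x"] D by linarith
    also have "seminorm_Curl sym_part \<Omega> \<Phi> \<le> seminorm_Curl sym_part \<Omega> P + 2 * e"
    proof -
      \<comment> \<open>Write \<open>\<Phi>\<close> as \<open>P\<close> minus the error, whose norm is small.\<close>
      have "seminorm_Curl sym_part \<Omega> (\<lambda>x. P x + (-1) *\<^sub>R (P x + (-1) *\<^sub>R \<Phi> x))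
          \<le> seminorm_Curl sym_part \<Omega> P + \<bar>-1\<bar> * seminorm_Curl sym_part \<Omega> (\<lambda>x. P x + (-1) *\<^sub>R \<Phi> x)"
        by (rule seminorm_Curl_triangle[OF bounded_linear_sym_part P Dm])
      also have "(\<lambda>x. P x + (-1) *\<^sub>R (P x + (-1) *\<^sub>R \<Phi> x)) = \<Phi>" by simp
      finally show ?thesis using seminorm_Curl_sym_part_le(2)[OF Dm] D by linarith
    qed
    finally have "norm_L2 \<Omega> P \<le> sqrt C * (seminorm_Curl sym_part \<Omega> P + 2 * e) + 2 * e"
      using C(1) by (simp add: mult_left_mono)
    also have "\<dots> = sqrt C * seminorm_Curl sym_part \<Omega> P + (1 + sqrt C) * (2 * e)" by (simp add: algebra_simps)
    also have "(1 + sqrt C) * (2 * e) = \<epsilon>" using sC by (simp add: e_def field_simps)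
    finally show "norm_L2 \<Omega> P \<le> sqrt C * seminorm_Curl sym_part \<Omega> P + \<epsilon>" .
  qed
  then show ?thesis using C(1) by (intro exI[of _ "sqrt C"]) simp
qed
end

theorem theorem7:
  fixes \<Omega> :: "(real^3) set"
  assumes "bounded_domain \<Omega>"
    and "connected (frontier \<Omega>)"
    and "lipschitz_boundary \<Omega>"
  shows "equivalent_ae_norms_on (lebesgue_on \<Omega>) (H0_Curl \<Omega>) (norm_H_Curl \<Omega>) (norm_sym_Curl \<Omega>)
    \<and> ae_norm_on (lebesgue_on \<Omega>) (H0_Curl \<Omega>) (norm_sym_Curl \<Omega>)
    \<and> (\<exists>c > 0. \<forall>P \<in> H0_Curl \<Omega>.
          c * norm_H_Curl \<Omega> P
            \<le> norm_L2 \<Omega> (\<lambda>x. sym_part (P x)) + norm_L2 \<Omega> (weak_Curl \<Omega> P))"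
proof -
  interpret bounded_open_set \<Omega> using assms(1) by unfold_locales (auto simp: bounded_domain_def)
  let ?N1 = "norm_H_Curl \<Omega>" and ?N2 = "norm_sym_Curl \<Omega>"
  have N: "seminorm_Curl (\<lambda>A. A) \<Omega> = ?N1" "seminorm_Curl sym_part \<Omega> = ?N2"
    by (simp_all add: fun_eq_iff seminorm_Curl_def norm_H_Curl_def norm_sym_Curl_def)
  obtain K where K: "K \<ge> 0" "\<And>P. P \<in> H0_Curl \<Omega> \<Longrightarrow> norm_L2 \<Omega> P \<le> K * ?N2 P"
    using sym_Curl_inequality unfolding N by blast
  define c where "c = 1 / (K + 1)"
  have c: "c > 0" using K(1) by (simp add: c_def)
  have norm1: "ae_norm_on (lebesgue_on \<Omega>) (H0_Curl \<Omega>) ?N1"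
    unfolding N(1)[symmetric]
  proof (rule ae_norm_on_seminorm_Curl[OF bounded_linear_ident])
    show "norm_L2 \<Omega> P = 0" if "seminorm_Curl (\<lambda>A. A) \<Omega> P = 0" for P
      using norm_L2_le_seminorm_Curl[of P] norm_L2_nonneg[of \<Omega> P] that by simp
  qed
  have norm2: "ae_norm_on (lebesgue_on \<Omega>) (H0_Curl \<Omega>) ?N2"
    unfolding N(2)[symmetric]
  proof (rule ae_norm_on_seminorm_Curl[OF bounded_linear_sym_part])
    show "norm_L2 \<Omega> P = 0" if "P \<in> H0_Curl \<Omega>" "seminorm_Curl sym_part \<Omega> P = 0" for P
      using K(2)[OF that(1)] norm_L2_nonneg[of \<Omega> P] that(2) unfolding N by simp
  qed
  have lower: "c * ?N1 P \<le> ?N2 P" if P: "P \<in> H0_Curl \<Omega>" for P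
  proof -
    have "?N1 P \<le> norm_L2 \<Omega> P + norm_L2 \<Omega> (weak_Curl \<Omega> P)"
      unfolding norm_H_Curl_def by (intro sqrt_sum_squares_le_sum norm_L2_nonneg)
    also have "norm_L2 \<Omega> (weak_Curl \<Omega> P) \<le> ?N2 P"
      unfolding norm_sym_Curl_def by (rule real_sqrt_sum_squares_ge2)
    finally have "?N1 P \<le> (K + 1) * ?N2 P" using K(2)[OF P] by (simp add: algebra_simps)
    then show ?thesis using K(1) by (simp add: c_def field_simps)
  qed
  have upper: "?N2 P \<le> 1 * ?N1 P" if "P \<in> H0_Curl \<Omega>" for P
    using seminorm_Curl_sym_part_le(2)[OF that] unfolding N by simp
  have "c * ?N1 P \<le> norm_L2 \<Omega> (\<lambda>x. sym_part (P x)) + norm_L2 \<Omega> (weak_Curl \<Omega> P)" if P: "P \<in> H0_Curl \<Omega>" for P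
  proof -
    have "?N2 P \<le> norm_L2 \<Omega> (\<lambda>x. sym_part (P x)) + norm_L2 \<Omega> (weak_Curl \<Omega> P)"
      unfolding norm_sym_Curl_def by (intro sqrt_sum_squares_le_sum norm_L2_nonneg)
    with lower[OF P] show ?thesis by linarith
  qed
  with norm1 norm2 c lower upper show ?thesis
    unfolding equivalent_ae_norms_on_def using zero_less_one by blast
qed

end
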